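(* Let $n\ge 1$, let $\rho\in S$ be a weight function on $\mathbb B_n$, and let $\mu$ be a finite positive Borel measure on $\mathbb B_n$. Let $\mu_k=\chi_{\Omega_k}\mu$, $k\ge 0$. Then: (i) $\mu$ is a Carleson measure for $A^2_\rho$ if and only if each $\mu_k$, $k\ge 0$, is a Carleson measure for the Hardy space $H^2$ and there is a constant $C>0$ independent of $k$ such that $\mathcal C_{\mu_k}(H^2)\le C\,2^{-k}$ for all $k\ge 0$. (ii) $\mu$ is a vanishing Carleson measure for $A^2_\rho$ if and only if $$\lim_{k\to\infty}2^k\,\mathcal C_{\mu_k}(H^2)=0.$$
   Context: $\mathbb B_n$ is the open unit ball of $\mathbb C^n$, $\mathbb S_n$ the unit sphere, $dv$ the normalized volume measure on $\mathbb B_n$, $d\sigma$ the normalized surface measure on $\mathbb S_n$, $H(\mathbb B_n)$ the space of holomorphic functions on $\mathbb B_n$. A weight function is a positive continuous integrable function $\rho$ on $[0,1)$, extended to $\mathbb B_n$ by $\rho(z)=\rho(|z|)$, and normalized by $\int_0^1x^{2n-1}\rho(x)\,dx=1$. The points $r_k\in[0,1)$, $k\ge 0$, are determined by $\int_{r_k}^1\rho(x)\,dx=2^{-k}$. The class $S$ consists of the weights $\rho$ with $\inf_k\frac{1-r_k}{1-r_{k+1}}>1$. Set $\Omega_k=\{z\in\mathbb B_n: r_k\le|z|<r_{k+1}\}$, $k\ge 0$. $A^2_\rho$ is the Hilbert space of $f\in H(\mathbb B_n)$ with $\|f\|_\rho^2=\int_{\mathbb B_n}|f|^2\rho\,dv<\infty$.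 $H^2$ is the Hardy space of $f\in H(\mathbb B_n)$ with $\|f\|_{H^2}^2=\sup_{0<r<1}\int_{\mathbb S_n}|f(r\xi)|^2d\sigma(\xi)<\infty$. For a Hilbert space $X$ of holomorphic functions on $\mathbb B_n$, a finite positive Borel measure $\mu$ is a Carleson measure for $X$ if there is $C>0$ with $\int_{\mathbb B_n}|f|^2d\mu\le C\|f\|_X^2$ for all $f\in X$. The Carleson constant $\mathcal C_\mu(X)$ is the smallest such $C$, i.e. the square of the norm of the identity (inclusion) operator $X\to L^2(\mathbb B_n,d\mu)$. A Carleson measure $\mu$ for $A^2_\rho$ is a vanishing Carleson measure for $A^2_\rho$ if the inclusion $A^2_\rho\to L^2(\mathbb B_n,d\mu)$ is compact, that is, $\lim_{j\to\infty}\int_{\mathbb B_n}|f_j|^2d\mu=0$ whenever $\{f_j\}$ is a bounded sequence in $A^2_\rho$ converging to $0$ uniformly on compact subsets of $\mathbb B_n$. *)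

theory Defs
  imports "HOL-Analysis.Analysis"
begin

section \<open>Measures on the ball and on the sphere\<close>

definition ball_measure :: "(complex ^ 'n) measure" where
  "ball_measure = restrict_space (uniform_measure lborel (ball 0 1)) (ball 0 1)"

text \<open>The normalized surface measure is obtained from the normalized volume through polar
  coordinates: a Borel set \<open>E\<close> of the sphere has the measure of the cone
  \<open>{z. 0 < |z| < 1, z / |z| \<in> E}\<close>. The origin, mapped to \<open>0\<close> by \<open>z \<mapsto> z / |z|\<close>, is a null set.\<close>

definition sphere_measure :: "(complex ^ 'n) measure" where
  "sphere_measure =
     restrict_space (distr (uniform_measure lborel (ball 0 1)) borel (\<lambda>z. z /\<^sub>R norm z)) (sphere 0 1)"

lemma emeasure_sphere_measure: "emeasure (sphere_measure :: (complex^'n) measure) (sphere 0 1) = 1"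
proof -
  let ?U = "uniform_measure lborel (ball 0 1) :: (complex^'n) measure"
  let ?p = "\<lambda>z::complex^'n. z /\<^sub>R norm z"
  have b: "emeasure lborel (ball 0 1 :: (complex^'n) set) \<noteq> 0"
    "emeasure lborel (ball 0 1 :: (complex^'n) set) \<noteq> \<infinity>"
    using emeasure_lborel_ball_finite[of "0::complex^'n" 1] content_ball_pos[of 1 "0::complex^'n"]
    by (auto simp: measure_def)
  have m: "?p \<in> borel_measurable borel" by measurable
  have "emeasure (sphere_measure :: (complex^'n) measure) (sphere 0 1) = emeasure (distr ?U borel ?p) (sphere 0 1)"
    unfolding sphere_measure_def by (rule emeasure_restrict_space) auto
  also have "\<dots> = emeasure ?U (?p -` sphere 0 1)"
    by (subst emeasure_distr) (use m in auto)
  also have "?p -` sphere 0 1 = - {0}" by (auto simp: divide_simps)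
  also have "emeasure ?U (-{0}) = emeasure lborel (ball 0 1 \<inter> - {0} :: (complex^'n) set) / emeasure lborel (ball 0 1 :: (complex^'n) set)"
    by (rule emeasure_uniform_measure) auto
  also have "ball 0 1 \<inter> - {0} = ball 0 1 - {0::complex^'n}" by auto
  also have "emeasure lborel (ball 0 1 - {0::complex^'n}) = emeasure lborel (ball 0 1 :: (complex^'n) set)"
    by (rule emeasure_Diff_null_set) auto
  finally show ?thesis using b by (simp add: ennreal_divide_self less_top)
qed

section \<open>Spaces of holomorphic functions on the ball\<close>

text \<open>Holomorphy in several variables: Frechet differentiability with a complex linear derivative.
  Functions are total; only their values on the ball play a role.\<close>

definition holomorphic_ball :: "(complex ^ 'n \<Rightarrow> complex) \<Rightarrow> bool" where
  "holomorphic_ball f \<longleftrightarrow>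
     (\<forall>z\<in>ball 0 1. \<exists>L. (f has_derivative L) (at z) \<and> (\<forall>c v. L (c *s v) = c * L v))"

text \<open>Squared norms take values in \<open>[0, \<infinity>]\<close>; the spaces consist of the functions for which they
  are finite.\<close>

definition bergman_normsq :: "(real \<Rightarrow> real) \<Rightarrow> (complex ^ 'n \<Rightarrow> complex) \<Rightarrow> ennreal" where
  "bergman_normsq \<rho> f = (\<integral>\<^sup>+ z. ennreal ((cmod (f z))\<^sup>2 * \<rho> (norm z)) \<partial>ball_measure)"

definition bergman_space :: "(real \<Rightarrow> real) \<Rightarrow> (complex ^ 'n \<Rightarrow> complex) set" where
  "bergman_space \<rho> = {f. holomorphic_ball f \<and> bergman_normsq \<rho> f < \<infinity>}"

definition hardy_normsq :: "(complex ^ 'n \<Rightarrow> complex) \<Rightarrow> ennreal" where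
  "hardy_normsq f = (SUP r\<in>{0<..<1}. \<integral>\<^sup>+ \<xi>. ennreal ((cmod (f (r *\<^sub>R \<xi>)))\<^sup>2) \<partial>sphere_measure)"

definition hardy_space :: "(complex ^ 'n \<Rightarrow> complex) set" where
  "hardy_space = {f. holomorphic_ball f \<and> hardy_normsq f < \<infinity>}"

section \<open>Weights\<close>

definition weight :: "nat \<Rightarrow> (real \<Rightarrow> real) \<Rightarrow> bool" where
  "weight n \<rho> \<longleftrightarrow>
     (\<forall>x\<in>{0..<1}. 0 < \<rho> x) \<and> continuous_on {0..<1} \<rho> \<and> set_integrable lborel {0..<1} \<rho> \<and>
     (LBINT x:{0..<1}. x ^ (2 * n - 1) * \<rho> x) = 1"

definition weight_point :: "(real \<Rightarrow> real) \<Rightarrow> nat \<Rightarrow> real" where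
  "weight_point \<rho> k = (THE r. r \<in> {0..<1} \<and> (LBINT x:{r..<1}. \<rho> x) = (1 / 2) ^ k)"

lemma weight_point_exists_unique:
  assumes w: "weight n \<rho>" and n: "n \<ge> 1"
  shows "\<exists>!r. r \<in> {0..<1} \<and> (LBINT x:{r..<1}. \<rho> x) = (1 / 2) ^ k"
proof -
  have pos: "\<And>x. x \<in> {0..<1} \<Longrightarrow> 0 < \<rho> x" and cont: "continuous_on {0..<1} \<rho>"
    and int: "set_integrable lborel {0..<1} \<rho>"
    and norm1: "(LBINT x:{0..<1}. x ^ (2 * n - 1) * \<rho> x) = 1"
    using w by (auto simp: weight_def)
  define T where "T = (\<lambda>r. LBINT x:{r..<1}. \<rho> x)"
  have sub: "set_integrable lborel A \<rho>" if "A \<subseteq> {0..<1}" "A \<in> sets borel" for A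
    using set_integrable_subset[OF int] that by simp
  have mid: "(LBINT x:{r..<s}. \<rho> x) = T r - T s" if "0 \<le> r" "r \<le> s" "s \<le> 1" for r s
  proof -
    have "T r = (LBINT x:{r..<s} \<union> {s..<1}. \<rho> x)"
      unfolding T_def using that by (simp add: ivl_disj_un)
    also have "\<dots> = (LBINT x:{r..<s}. \<rho> x) + T s"
      unfolding T_def by (rule set_integral_Un) (use that in \<open>auto intro!: sub\<close>)
    finally show ?thesis by simp
  qed
  have T1: "T 1 = 0" by (simp add: T_def set_lebesgue_integral_def)
  have posint: "(LBINT x:{r..<s}. g x) > 0"
    if rs: "0 \<le> r" "r < s" "s \<le> 1" and g: "set_integrable lborel {r..<s} g"
      and gp: "\<And>x. x \<in> {r<..<s} \<Longrightarrow> g x > 0" "g r \<ge> 0" for r s and g :: "real \<Rightarrow> real"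
  proof -
    have nn: "g x \<ge> 0" if "x \<in> {r..<s}" for x
      using gp that rs by (cases "x = r") (auto intro: less_imp_le)
    have ge: "(LBINT x:{r..<s}. g x) \<ge> 0"
      unfolding set_lebesgue_integral_def
      by (rule Bochner_Integration.integral_nonneg) (use nn in \<open>auto simp: indicator_def\<close>)
    have "(LBINT x:{r..<s}. g x) \<noteq> 0"
    proof
      assume "(LBINT x:{r..<s}. g x) = 0"
      then have "AE x in lborel. indicator {r..<s} x *\<^sub>R g x = 0"
        using g unfolding set_lebesgue_integral_def set_integrable_def
        by (subst (asm) integral_nonneg_eq_0_iff_AE) (use nn in \<open>auto simp: indicator_def\<close>)
      then have "AE x in lborel. x \<notin> {r<..<s}"
        by eventually_elim (use gp in \<open>fastforce simp: indicator_def\<close>)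
      then have "emeasure lborel {r<..<s} = 0"
        by (subst (asm) AE_iff_measurable[where N = "{r<..<s}"]) auto
      then show False using rs by simp
    qed
    with ge show ?thesis by simp
  qed
  have strict: "T s < T r" if "0 \<le> r" "r < s" "s \<le> 1" for r s
    using posint[of r s \<rho>] mid[of r s] that pos sub[of "{r..<s}"] by (auto simp: less_imp_le)
  have T0: "T 0 > 1"
  proof -
    let ?h = "\<lambda>x. x ^ (2 * n - 1) * \<rho> x"
    have ih: "set_integrable lborel {0..<1} ?h"
      using norm1 not_integrable_integral_eq
      unfolding set_lebesgue_integral_def set_integrable_def by fastforce
    have *: "(LBINT x:{0..<1}. \<rho> x - ?h x) > 0"
    proof (rule posint)
      show "set_integrable lborel {0..<1} (\<lambda>x. \<rho> x - ?h x)"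
        using int ih by (rule set_integral_diff)
      show "\<rho> x - ?h x > 0" if "x \<in> {0<..<1}" for x
      proof -
        have "x ^ (2 * n - 1) < 1" using that n by (intro power_Suc_less_one[of x "2*n-2", simplified] power_less_one_iff[THEN iffD2]) auto
        then have "x ^ (2 * n - 1) * \<rho> x < 1 * \<rho> x"
          using pos[of x] that by (intro mult_strict_right_mono) auto
        then show ?thesis by simp
      qed
      show "\<rho> 0 - ?h 0 \<ge> 0" using n pos[of 0] by (simp add: power_0_left)
    qed auto
    have "(LBINT x:{0..<1}. \<rho> x - ?h x) = T 0 - 1"
      using set_integral_diff(2)[OF int ih] norm1 by (simp add: T_def)
    with * show ?thesis by simp
  qed
  have contT: "continuous_on {0..1} T"
  proof -
    define g where "g = (\<lambda>x. indicator {0..<1} x *\<^sub>R \<rho> x)"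
    have gi: "integrable lborel g" using int by (simp add: g_def set_integrable_def)
    have "g integrable_on {0..1}"
      using integrable_on_lborel[OF gi] integrable_on_subinterval
      by (metis top_greatest)
    then have c: "continuous_on {0..1} (\<lambda>r. integral {0..r} g)"
      by (rule indefinite_integral_continuous_1)
    have eq: "T r = T 0 - integral {0..r} g" if "r \<in> {0..1}" for r
    proof -
      have "integral {0..r} g = (LBINT x:{0..r}. g x)"
        by (rule set_borel_integral_eq_integral(2)[symmetric])
           (use gi in \<open>auto simp: set_integrable_def intro!: integrable_mult_indicator[where 'b=real, simplified]\<close>)
      also have "\<dots> = (LBINT x:{0..<r}. \<rho> x)"
        unfolding set_lebesgue_integral_def
        by (rule integral_cong_AE)
           (use gi that AE_lborel_singleton[of r] sub[of "{0..<r}"] in \<open>auto simp: g_def indicator_def set_integrable_def dest!: borel_measurable_integrable elim!: eventually_mono\<close>)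
      finally show ?thesis using mid[of 0 r] that by simp
    qed
    have "continuous_on {0..1} (\<lambda>r. T 0 - integral {0..r} g)"
      by (intro continuous_intros c)
    then show ?thesis by (rule continuous_on_eq) (rule eq[symmetric])
  qed
  have "\<exists>r\<ge>0. r \<le> 1 \<and> T r = (1 / 2) ^ k"
    by (rule IVT2') (use T1 T0 contT power_le_one[of "1/2::real" k] in auto)
  then obtain r where r: "0 \<le> r" "r \<le> 1" "T r = (1 / 2) ^ k" by blast
  then have "r < 1" using T1 by (cases "r = 1") auto
  show ?thesis
  proof (rule ex1I[of _ r])
    show "r \<in> {0..<1} \<and> (LBINT x:{r..<1}. \<rho> x) = (1 / 2) ^ k"
      using r \<open>r < 1\<close> by (simp add: T_def)
    fix s assume "s \<in> {0..<1} \<and> (LBINT x:{s..<1}. \<rho> x) = (1 / 2) ^ k"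
    then show "s = r"
      using strict[of r s] strict[of s r] r \<open>r < 1\<close> by (cases r s rule: linorder_cases) (auto simp: T_def)
  qed
qed

definition weight_class_S :: "nat \<Rightarrow> (real \<Rightarrow> real) \<Rightarrow> bool" where
  "weight_class_S n \<rho> \<longleftrightarrow>
     weight n \<rho> \<and> (INF k. (1 - weight_point \<rho> k) / (1 - weight_point \<rho> (Suc k))) > 1"

definition shell :: "(real \<Rightarrow> real) \<Rightarrow> nat \<Rightarrow> (complex ^ 'n) set" where
  "shell \<rho> k = {z \<in> ball 0 1. weight_point \<rho> k \<le> norm z \<and> norm z < weight_point \<rho> (Suc k)}"

section \<open>Carleson measures\<close>

text \<open>A space of holomorphic functions on the ball is given by its carrier \<open>X\<close> and its squared
  norm \<open>N\<close>, which is finite on \<open>X\<close>.\<close>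

definition carleson_measure ::
  "(complex ^ 'n \<Rightarrow> complex) set \<Rightarrow> ((complex ^ 'n \<Rightarrow> complex) \<Rightarrow> ennreal) \<Rightarrow>
   (complex ^ 'n) measure \<Rightarrow> bool" where
  "carleson_measure X N \<mu> \<longleftrightarrow>
     (\<exists>C::real. C > 0 \<and> (\<forall>f\<in>X. (\<integral>\<^sup>+ z. ennreal ((cmod (f z))\<^sup>2) \<partial>\<mu>) \<le> ennreal C * N f))"

text \<open>The value is \<open>\<infinity>\<close> when \<open>\<mu>\<close> is not a Carleson measure, and \<open>0\<close> is an admissible constant,
  so that this is always the square of the norm of the inclusion.\<close>

definition carleson_constant ::
  "(complex ^ 'n \<Rightarrow> complex) set \<Rightarrow> ((complex ^ 'n \<Rightarrow> complex) \<Rightarrow> ennreal) \<Rightarrow>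
   (complex ^ 'n) measure \<Rightarrow> ennreal" where
  "carleson_constant X N \<mu> =
     Inf {C. \<forall>f\<in>X. (\<integral>\<^sup>+ z. ennreal ((cmod (f z))\<^sup>2) \<partial>\<mu>) \<le> C * N f}"

text \<open>Compactness of the inclusion, in its sequential form.\<close>

definition vanishing_carleson_measure ::
  "(complex ^ 'n \<Rightarrow> complex) set \<Rightarrow> ((complex ^ 'n \<Rightarrow> complex) \<Rightarrow> ennreal) \<Rightarrow>
   (complex ^ 'n) measure \<Rightarrow> bool" where
  "vanishing_carleson_measure X N \<mu> \<longleftrightarrow>
     carleson_measure X N \<mu> \<and>
     (\<forall>f :: nat \<Rightarrow> complex ^ 'n \<Rightarrow> complex.
        (\<forall>j. f j \<in> X) \<and> (\<exists>M::real. \<forall>j. N (f j) \<le> ennreal M) \<and>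
        (\<forall>K. compact K \<and> K \<subseteq> ball 0 1 \<longrightarrow> uniform_limit K f (\<lambda>_. 0) sequentially) \<longrightarrow>
        (\<lambda>j. \<integral>\<^sup>+ z. ennreal ((cmod (f j z))\<^sup>2) \<partial>\<mu>) \<longlonglongrightarrow> 0)"

end

theory Submission
  imports Defs "HOL-Complex_Analysis.Complex_Analysis"
begin

text \<open>The proof avoids the geometric characterization of Carleson measures by tents. Let
  \<open>\<nu>\<close> be a measure on \<open>|z| \<le> R\<close> and \<open>R < s < 1\<close>. The Szego kernel of the ball of radius \<open>s\<close>
  is the Szego kernel of the unit ball times \<open>((1 - \<langle>z, w\<rangle>) / (1 - \<langle>z, w\<rangle> / s\<^sup>2))^n\<close>, which on
  \<open>|z| \<le> R\<close> is a bounded Schur multiplier. So a Hardy space embedding for \<open>\<nu>\<close> bounds \<open>\<integral> |f|\<^sup>2 d\<nu>\<close>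
  by the mean of \<open>|f|\<^sup>2\<close> over the sphere of radius \<open>s\<close>. For \<open>\<nu> = \<mu>\<^sub>k\<close> and \<open>r\<^sub>k\<^sub>+\<^sub>2 \<le> s < r\<^sub>k\<^sub>+\<^sub>3\<close> the
  constants are uniform by the class S condition; integrating in \<open>s\<close> against \<open>\<rho>\<close> and summing over
  \<open>k\<close> gives the Bergman norm.

  Conversely, an \<open>H\<^sup>2\<close> function \<open>f\<close> is multiplied by the monomials of degree
  \<open>m = \<lceil>1 / (1 - r\<^sub>k)\<rceil>\<close>, whose squares add up to \<open>|z|^(2m)\<close>. This is bounded below on \<open>\<Omega>\<^sub>k\<close>, while
  \<open>\<integral> x^(2m) \<rho>(x) dx\<close> is \<open>O(2^-k)\<close>. The normalized products vanish to order \<open>m\<close> at the origin, so by the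
  Schwarz lemma they tend to \<open>0\<close> locally uniformly, which gives the compactness statement.\<close>

text \<open>Positivity makes the Schur multiplier tractable. With q = 1 / s^2 the ratio (1 - x) / (1
  - q x) has nonnegative Taylor coefficients, and multiplying a kernel by <z, w>, a sum of products
  of coordinates, multiplies its operator bound by at most R^2. Summing over the powers gives the
  value of the ratio at x = R^2, once for each of the n factors.

  This value blows up as s approaches R, so the spheres of integration must keep away from the
  support. Class S bounds \<open>1 - r (k + 1)\<close> by a multiple of
  \<open>r (k + 2) - r (k + 1)\<close>: leaving out one shell is enough, and it costs only a fixed
  power of 2 in the mass of \<rho>.

  The Szego expansion is derived from two facts only, the invariance of surface measure under linear
  isometries and the mean value property on circles.

  The degree m is a compromise. An order of 1 / (1 - r_k) is the largest for which |z|^(2m) stays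
  bounded below on the shell, and it is large enough to push the mass of x^(2m) \<rho>(x) dx out to
  where \<rho> has mass about 2^-k.\<close>

unbundle no fps_syntax

section \<open>The surface measure and polar coordinates\<close>

text \<open>Uniqueness of Haar measure made concrete. The pushforward \<open>\<nu>\<close> is
  translation invariant because \<open>T\<close> is additive and onto, and it agrees with
  \<open>lborel\<close> on centred balls because \<open>T\<close> preserves norms. Fubini for the
  indicators of the unit ball B and of A, with a translation on either side, gives |B| \<nu>(A) =
  \<nu>(B) |A|, and |B| = \<nu>(B) cancels.\<close>

lemma lborel_distr_isometry:
  fixes T :: "'a::euclidean_space \<Rightarrow> 'a"
  assumes lin: "linear T" and iso: "\<And>x. norm (T x) = norm x"
  shows "distr lborel borel T = lborel"
proof -
  define \<nu> where "\<nu> = distr lborel borel T"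
  have cT: "continuous_on UNIV T" using lin linear_continuous_on linear_conv_bounded_linear by blast
  have mT[measurable]: "T \<in> borel_measurable borel" by (rule borel_measurable_continuous_onI[OF cT])
  have injT: "inj T" using lin iso by (metis linear_injective_0 norm_eq_zero)
  have surjT: "surj T" using linear_inj_imp_surj[OF lin injT] .
  have sets\<nu>[measurable_cong, simp]: "sets \<nu> = sets borel" by (simp add: \<nu>_def)
  have em\<nu>: "emeasure \<nu> A = emeasure lborel (T -` A)" if "A \<in> sets borel" for A
    unfolding \<nu>_def using that by (subst emeasure_distr) auto
  have ball\<nu>: "emeasure \<nu> (ball 0 r) = emeasure lborel (ball 0 r :: 'a set)" for r
  proof -
    have "T -` ball 0 r = ball 0 r" using iso by auto
    then show ?thesis by (simp add: em\<nu>)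
  qed
  have sf: "sigma_finite_measure \<nu>"
  proof
    show "\<exists>A. countable A \<and> A \<subseteq> sets \<nu> \<and> \<Union>A = space \<nu> \<and> (\<forall>a\<in>A. emeasure \<nu> a \<noteq> \<infinity>)"
    proof (intro exI[of _ "range (\<lambda>n::nat. ball 0 (real n))"] conjI ballI)
      show "\<Union>(range (\<lambda>n::nat. ball (0::'a) (real n))) = space \<nu>"
        using reals_Archimedean2 by (auto simp: \<nu>_def)
    next
      fix a assume "a \<in> range (\<lambda>n::nat. ball (0::'a) (real n))"
      then show "emeasure \<nu> a \<noteq> \<infinity>"
        using emeasure_lborel_ball_finite[of "0::'a"] by (auto simp: ball\<nu> less_top)
    qed auto
  qed
  interpret \<nu>: sigma_finite_measure \<nu> by (rule sf)
  interpret pair_sigma_finite lborel \<nu> ..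
  have tr\<nu>: "(\<integral>\<^sup>+x. f (y + x) \<partial>\<nu>) = (\<integral>\<^sup>+x. f x \<partial>\<nu>)" if [measurable]: "f \<in> borel_measurable borel" for f y
  proof -
    obtain u where u: "y = T u" using surjT by (metis surjD)
    have "(\<integral>\<^sup>+x. f (y + x) \<partial>\<nu>) = (\<integral>\<^sup>+x. f (T (u + x)) \<partial>lborel)"
      unfolding \<nu>_def by (subst nn_integral_distr) (auto simp: u linear_add[OF lin])
    also have "\<dots> = (\<integral>\<^sup>+x. f (T x) \<partial>distr lborel borel ((+) u))"
      by (subst nn_integral_distr) auto
    also have "\<dots> = (\<integral>\<^sup>+x. f x \<partial>\<nu>)"
      unfolding \<nu>_def lborel_distr_plus by (subst nn_integral_distr) auto
    finally show ?thesis .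
  qed
  have trl: "(\<integral>\<^sup>+x. f (y + x) \<partial>lborel) = (\<integral>\<^sup>+x. f x \<partial>lborel)"
    if [measurable]: "f \<in> borel_measurable borel" for f and y :: 'a
    by (subst (2) lborel_distr_plus[of y, symmetric], subst nn_integral_distr) auto
  let ?B = "ball (0::'a) 1"
  have "emeasure \<nu> A = emeasure lborel A" if [measurable]: "A \<in> sets borel" for A
  proof -
    have [measurable]: "?B \<in> sets borel" "A \<in> sets borel" using that by simp_all
    have [measurable]: "(\<lambda>x. indicator A (fst x + snd x) :: ennreal) \<in> borel_measurable (lborel \<Otimes>\<^sub>M \<nu>)"
      by (rule measurable_compose[of _ _ borel, OF _ borel_measurable_indicator]) (use that in measurable)
    have "emeasure lborel ?B * emeasure \<nu> A = (\<integral>\<^sup>+y. \<integral>\<^sup>+x. indicator ?B y * indicator A x \<partial>\<nu> \<partial>lborel)"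
    proof -
      have [measurable]: "?B \<in> sets borel" by simp
      show ?thesis by (simp add: nn_integral_cmult nn_integral_multc)
    qed
    also have "\<dots> = (\<integral>\<^sup>+y. \<integral>\<^sup>+x. indicator ?B y * indicator A (y + x) \<partial>\<nu> \<partial>lborel)"
      by (subst tr\<nu>) (auto)
    also have "\<dots> = (\<integral>\<^sup>+x. \<integral>\<^sup>+y. indicator ?B y * indicator A (y + x) \<partial>lborel \<partial>\<nu>)"
      by (rule Fubini'[symmetric]) measurable
    also have "\<dots> = (\<integral>\<^sup>+x. \<integral>\<^sup>+y. indicator ?B (-x + y) * indicator A y \<partial>lborel \<partial>\<nu>)"
    proof (rule nn_integral_cong)
      fix x
      have "(\<integral>\<^sup>+y. indicator ?B (-x + (x + y)) * indicator A (x + y) \<partial>lborel) =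
        (\<integral>\<^sup>+y. indicator ?B (-x + y) * indicator A y \<partial>lborel)"
        by (rule trl) measurable
      then show "(\<integral>\<^sup>+y. indicator ?B y * indicator A (y + x) \<partial>lborel) =
        (\<integral>\<^sup>+y. indicator ?B (-x + y) * indicator A y \<partial>lborel)"
        by (simp add: add.commute)
    qed
    also have "\<dots> = (\<integral>\<^sup>+y. \<integral>\<^sup>+x. indicator ?B (-x + y) * indicator A y \<partial>\<nu> \<partial>lborel)"
      by (rule Fubini') measurable
    \<comment> \<open>The unit ball is symmetric, so y - x and x - y lie in it together; the
      variable integrated against \<open>\<nu>\<close> is then merely translated.\<close>
    also have "\<dots> = (\<integral>\<^sup>+y. \<integral>\<^sup>+x. indicator ?B (-y + x) * indicator A y \<partial>\<nu> \<partial>lborel)"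
      by (intro nn_integral_cong) (auto simp: indicator_def dist_norm norm_minus_commute algebra_simps)
    also have "\<dots> = (\<integral>\<^sup>+y. \<integral>\<^sup>+x. indicator ?B x * indicator A y \<partial>\<nu> \<partial>lborel)"
      by (subst tr\<nu>) auto
    also have "\<dots> = emeasure lborel ?B * emeasure lborel A"
    proof -
      have [measurable]: "?B \<in> sets borel" by simp
      show ?thesis by (simp add: nn_integral_cmult nn_integral_multc ball\<nu>)
    qed
    finally show ?thesis
      using emeasure_lborel_ball_finite[of "0::'a" 1] content_ball_pos[of 1 "0::'a"]
      by (subst (asm) ennreal_mult_cancel_left) (auto simp: measure_def)
  qed
  then show ?thesis unfolding \<nu>_def[symmetric] by (intro measure_eqI) auto
qed

abbreviation vunit :: "complex ^ 'n \<Rightarrow> complex ^ 'n" where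
  "vunit z \<equiv> z /\<^sub>R norm z"

lemma emeasure_sphere_measure_eq:
  assumes "E \<in> sets borel" "E \<subseteq> sphere 0 1"
  shows "emeasure (sphere_measure :: (complex^'n) measure) E
    = emeasure lborel (ball 0 1 \<inter> vunit -` E) / emeasure lborel (ball 0 1 :: (complex^'n) set)"
proof -
  have [measurable]: "vunit \<in> borel_measurable borel" by measurable
  have "vunit -` E \<in> sets borel" using measurable_sets[of vunit borel borel E] assms by simp
  then show ?thesis
    unfolding sphere_measure_def using assms
    by (simp add: emeasure_restrict_space emeasure_distr)
qed

lemma space_sphere_measure [simp]: "space sphere_measure = sphere 0 1"
  by (simp add: sphere_measure_def space_restrict_space)

lemma sets_sphere_measure [measurable_cong]:
  "sets sphere_measure = sets (restrict_space borel (sphere 0 1))"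
  unfolding sphere_measure_def by (intro sets_restrict_space_cong) simp

lemma finite_measure_sphere_measure: "finite_measure (sphere_measure :: (complex^'n) measure)"
  by (intro finite_measureI) (simp add: emeasure_sphere_measure)

lemma measure_sphere_measure: "measure (sphere_measure :: (complex^'n) measure) (sphere 0 1) = 1"
  by (simp add: measure_def emeasure_sphere_measure)

text \<open>A linear isometry commutes with z / |z|, so the cone over a preimage is the preimage of
  the cone; invariance of volume does the rest.\<close>

lemma sphere_measure_isometry:
  fixes T :: "complex^'n \<Rightarrow> complex^'n"
  assumes lin: "linear T" and iso: "\<And>x. norm (T x) = norm x"
  shows "T \<in> sphere_measure \<rightarrow>\<^sub>M sphere_measure" "distr sphere_measure sphere_measure T = sphere_measure"
proof -
  have cT: "continuous_on UNIV T" using lin linear_continuous_on linear_conv_bounded_linear by blast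
  have mT[measurable]: "T \<in> borel_measurable borel" by (rule borel_measurable_continuous_onI[OF cT])
  show *: "T \<in> sphere_measure \<rightarrow>\<^sub>M sphere_measure"
    unfolding measurable_cong_sets[OF sets_sphere_measure sets_sphere_measure]
    by (rule measurable_restrict_space3) (use iso in \<open>auto\<close>)
  show "distr sphere_measure sphere_measure T = sphere_measure"
  proof (rule measure_eqI)
    fix A assume "A \<in> sets (distr sphere_measure sphere_measure T :: (complex^'n) measure)"
    then have A': "A \<in> sets sphere_measure" by simp
    then have A: "A \<in> sets borel" "A \<subseteq> sphere 0 1"
      by (auto simp: sets_sphere_measure sets_restrict_space)
    have TA: "T -` A \<in> sets borel" using measurable_sets[OF mT A(1)] by simp
    have TA': "T -` A \<subseteq> sphere 0 1" using A iso by auto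
    have "emeasure (distr sphere_measure sphere_measure T) A = emeasure sphere_measure (T -` A)"
      using emeasure_distr[OF * A'] TA' by (simp add: Int_absorb2)
    also have "\<dots> = emeasure lborel (ball 0 1 \<inter> vunit -` (T -` A)) / emeasure lborel (ball 0 1 :: (complex^'n) set)"
      by (rule emeasure_sphere_measure_eq) (use TA TA' in auto)
    also have "ball 0 1 \<inter> vunit -` (T -` A) = T -` (ball 0 1 \<inter> vunit -` A)"
      using iso by (auto simp: linear_scale[OF lin])
    also have "emeasure lborel (T -` (ball 0 1 \<inter> vunit -` A)) = emeasure (distr lborel borel T) (ball 0 1 \<inter> vunit -` A)"
    proof -
      have "vunit \<in> borel_measurable borel" by measurable
      then have "vunit -` A \<in> sets borel" using measurable_sets[of vunit borel borel A] A by simp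
      then show ?thesis by (subst emeasure_distr) auto
    qed
    also have "distr lborel borel T = lborel" by (rule lborel_distr_isometry) fact+
    also have "emeasure lborel (ball 0 1 \<inter> vunit -` A) / emeasure lborel (ball 0 1 :: (complex^'n) set) = emeasure sphere_measure A"
      by (rule emeasure_sphere_measure_eq[symmetric]) (use A in auto)
    finally show "emeasure (distr sphere_measure sphere_measure T) A = emeasure sphere_measure A" .
  qed simp
qed

lemma integral_sphere_measure_isometry:
  fixes T :: "complex^'n \<Rightarrow> complex^'n" and f :: "complex^'n \<Rightarrow> 'b::{banach, second_countable_topology}"
  assumes "linear T" "\<And>x. norm (T x) = norm x" "f \<in> borel_measurable sphere_measure"
  shows "(\<integral>\<xi>. f (T \<xi>) \<partial>sphere_measure) = (\<integral>\<xi>. f \<xi> \<partial>sphere_measure)"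
  using sphere_measure_isometry[OF assms(1,2)] integral_distr[of T sphere_measure sphere_measure f] assms(3)
  by simp

text \<open>The bijection \<open>z \<mapsto> (|z|, z / |z|)\<close> turns volume into a product measure: both sides agree on
  rectangles \<open>{..t} \<times> E\<close>, because dilations scale volume.\<close>

definition radial_measure :: "nat \<Rightarrow> real measure" where
  "radial_measure n = density lborel (\<lambda>r. ennreal (2 * real n * r ^ (2 * n - 1)) * indicator {0..1} r)"

lemma sets_radial_measure [measurable_cong, simp]: "sets (radial_measure n) = sets borel"
  by (simp add: radial_measure_def)

lemma emeasure_radial_measure_lessThan:
  assumes n: "n \<ge> 1"
  shows "emeasure (radial_measure n) {..<t} = (if t < 0 then 0 else ennreal (min t 1 ^ (2 * n)))"
proof (cases "t < 0")
  case True
  have "emeasure (radial_measure n) {..<t} = (\<integral>\<^sup>+x. ennreal (2 * real n * x ^ (2 * n - 1)) * indicator {0..1} x * indicator {..<t} x \<partial>lborel)"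
    unfolding radial_measure_def by (subst emeasure_density) auto
  also have "\<dots> = (\<integral>\<^sup>+x. 0 \<partial>(lborel :: real measure))"
    using True by (intro nn_integral_cong) (auto split: split_indicator)
  finally show ?thesis using True by simp
next
  case False
  have "emeasure (radial_measure n) {..<t} =
      (\<integral>\<^sup>+x. ennreal (2 * real n * x ^ (2 * n - 1)) * indicator {0..min t 1} x \<partial>lborel)"
    unfolding radial_measure_def using AE_lborel_singleton[of t]
    by (subst emeasure_density)
       (auto intro!: nn_integral_cong_AE elim!: eventually_mono split: split_indicator)
  also have "\<dots> = ennreal (min t 1 ^ (2 * n) - 0 ^ (2 * n))"
    by (rule nn_integral_FTC_Icc)
      (use False n in \<open>auto intro!: derivative_eq_intros simp: has_real_derivative_iff_has_vector_derivative[symmetric]\<close>)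
  finally show ?thesis using False n by (simp add: power_0_left)
qed

lemma finite_measure_radial_measure: "n \<ge> 1 \<Longrightarrow> finite_measure (radial_measure n)"
proof (intro finite_measureI)
  assume n: "n \<ge> 1"
  have "emeasure (radial_measure n) (space (radial_measure n)) = emeasure (radial_measure n) {..<2}"
    unfolding radial_measure_def
    by (simp add: emeasure_density, intro nn_integral_cong) (auto split: split_indicator)
  then show "emeasure (radial_measure n) (space (radial_measure n)) \<noteq> \<infinity>"
    using emeasure_radial_measure_lessThan[OF n, of 2] by simp
qed

lemma emeasure_lborel_scale:
  fixes X :: "'a::euclidean_space set"
  assumes "c > 0" "X \<in> sets borel"
  shows "emeasure lborel ((\<lambda>x. c *\<^sub>R x) -` X) * ennreal (c ^ DIM('a)) = emeasure lborel X"
proof -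
  have "emeasure lborel X = emeasure (density (distr lborel borel (\<lambda>x. 0 + c *\<^sub>R x)) (\<lambda>_. \<bar>c\<bar>^DIM('a))) X"
    using lborel_affine[of c "0::'a"] assms by simp
  also have "\<dots> = ennreal (c ^ DIM('a)) * emeasure (distr lborel borel (\<lambda>x. 0 + c *\<^sub>R x)) X"
    using assms by (subst emeasure_density_const) auto
  also have "emeasure (distr lborel borel (\<lambda>x. 0 + c *\<^sub>R x)) X = emeasure lborel ((\<lambda>x. c *\<^sub>R x) -` X)"
    using assms by (subst emeasure_distr) auto
  finally show ?thesis by (simp add: mult.commute)
qed

text \<open>Dilation by \<open>t\<close> carries the cone over \<open>B\<close> in the unit ball
  onto its part of radius below \<open>t\<close>; the exponent is the real dimension of the
  space.\<close>

lemma emeasure_cone_lessThan: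
  fixes B :: "(complex ^ 'n) set"
  assumes B: "B \<in> sets borel" and t: "0 < t" "t \<le> 1"
  shows "emeasure lborel (ball 0 1 \<inter> vunit -` B \<inter> norm -` {..<t})
    = ennreal (t ^ (2 * CARD('n))) * emeasure lborel (ball 0 1 \<inter> vunit -` B)"
proof -
  have "vunit \<in> borel_measurable (borel :: (complex^'n) measure)" by measurable
  then have vB: "vunit -` B \<in> sets borel" using measurable_sets[of vunit borel borel B] B by simp
  have nt: "norm -` {..<t} = (ball 0 t :: (complex^'n) set)" by auto
  have m: "ball 0 1 \<inter> vunit -` B \<inter> norm -` {..<t} \<in> sets borel"
    unfolding nt using vB by auto
  have "(\<lambda>x. t *\<^sub>R x) -` (ball 0 1 \<inter> vunit -` B \<inter> norm -` {..<t}) = ball 0 1 \<inter> vunit -` B"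
  proof -
    have "norm (t *\<^sub>R x) < 1" if "norm x < 1" for x :: "complex^'n"
      using that t mult_strict_mono[of "norm x" 1 t 1] mult_left_le[of t "norm x"]
      by (simp add: mult.commute)
    moreover have "vunit (t *\<^sub>R x) = vunit x" for x :: "complex^'n"
      using t by (simp add: divide_simps)
    ultimately show ?thesis using t by (auto simp: mult_less_cancel_left1 simp del: scaleR_scaleR)
  qed
  then show ?thesis
    using emeasure_lborel_scale[OF t(1) m] by (simp add: mult.commute)
qed

lemma polar_measure:
  defines "U \<equiv> uniform_measure lborel (ball 0 1) :: (complex ^ 'n) measure"
  shows "distr U (borel \<Otimes>\<^sub>M borel) (\<lambda>z. (norm z, vunit z)) = radial_measure CARD('n) \<Otimes>\<^sub>M distr U borel vunit"
proof (rule sym, rule pair_measure_eqI)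
  have n: "CARD('n) \<ge> 1" by (simp add: Suc_leI)
  have b: "emeasure lborel (ball 0 1 :: (complex^'n) set) \<noteq> 0"
    "emeasure lborel (ball 0 1 :: (complex^'n) set) \<noteq> \<infinity>"
    using emeasure_lborel_ball_finite[of "0::complex^'n" 1] content_ball_pos[of 1 "0::complex^'n"]
    by (auto simp: measure_def)
  have [measurable]: "vunit \<in> borel_measurable (borel :: (complex^'n) measure)" by measurable
  have setsU[simp, measurable_cong]: "sets U = sets borel" by (simp add: U_def)
  have spU[simp]: "space U = UNIV" by (simp add: U_def)
  have fU: "finite_measure U"
    using b by (intro finite_measureI) (simp add: U_def ennreal_divide_self less_top)
  interpret R: finite_measure "radial_measure CARD('n)" by (rule finite_measure_radial_measure[OF n])
  interpret V: finite_measure "distr U borel vunit" using fU by (rule finite_measure.finite_measure_distr) simp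
  show "sigma_finite_measure (radial_measure CARD('n))" by unfold_locales
  show "sigma_finite_measure (distr U borel vunit)" by unfold_locales
  show "sets (radial_measure CARD('n) \<Otimes>\<^sub>M distr U borel vunit) = sets (distr U (borel \<Otimes>\<^sub>M borel) (\<lambda>z. (norm z, vunit z)))"
    by (simp cong: sets_pair_measure_cong)
  fix A B assume A: "A \<in> sets (radial_measure CARD('n))" and B': "B \<in> sets (distr U borel vunit)"
  then have B[measurable]: "B \<in> sets borel" and A[measurable]: "A \<in> sets borel" by auto
  have vB[measurable]: "vunit -` B \<in> sets borel" using measurable_sets[of vunit borel borel B] by simp
  let ?c = "emeasure U (vunit -` B)"
  \<comment> \<open>With the angular set \<open>B\<close> fixed, both sides of the rectangle
    identity are finite measures of the radial set. They agree on the half-lines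
    \<open>{..<t}\<close>, an intersection-stable generator of the Borel sets, hence
    everywhere.\<close>
  define N1 where "N1 = scale_measure ?c (radial_measure CARD('n))"
  define N2 where "N2 = distr (density U (indicator (vunit -` B))) borel norm"
  have N2: "emeasure N2 X = emeasure U (vunit -` B \<inter> norm -` X)" if [measurable]: "X \<in> sets borel" for X
  proof -
    have "norm -` X \<in> sets (borel :: (complex^'n) measure)" using measurable_sets[of norm borel borel X] by simp
    then show ?thesis unfolding N2_def
      by (subst emeasure_distr) (auto simp: emeasure_density indicator_inter_arith[symmetric])
  qed
  have "N1 = N2"
  proof (rule measure_eqI_generator_eq[where E = "range lessThan" and \<Omega> = UNIV and A = "\<lambda>i::nat. {..<real i}"])
    show "Int_stable (range lessThan :: real set set)" proof (rule Int_stableI)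
      fix a b :: "real set" assume "a \<in> range lessThan" "b \<in> range lessThan"
      then obtain x y where "a = {..<x}" "b = {..<y}" by auto
      then have "a \<inter> b = {..<min x y}" by auto
      then show "a \<inter> b \<in> range lessThan" by simp
    qed
    show "sets N1 = sigma_sets UNIV (range lessThan)" "sets N2 = sigma_sets UNIV (range lessThan)"
      by (simp_all add: N1_def N2_def borel_Iio)
    show "(\<Union>i. {..<real i}) = UNIV" using reals_Archimedean2 by auto
    show "emeasure N1 {..<real i} \<noteq> \<infinity>" for i
      using finite_measure.emeasure_finite[OF fU] R.emeasure_finite
      by (simp add: N1_def ennreal_mult_eq_top_iff)
    fix X :: "real set" assume "X \<in> range lessThan"
    then obtain t where X: "X = {..<t}" by auto
    show "emeasure N1 X = emeasure N2 X"
    proof (cases "0 < t")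
      case False
      then have "vunit -` B \<inter> norm -` X = {}" unfolding X by (auto simp: not_less) (smt (verit) norm_ge_zero)
      then show ?thesis using False
        by (simp add: N2 X N1_def emeasure_radial_measure_lessThan[OF n])
    next
      case True
      define s where "s = min t 1"
      have s: "0 < s" "s \<le> 1" using True by (auto simp: s_def)
      have nX: "norm -` X = (ball 0 t :: (complex^'n) set)" unfolding X by auto
      have "emeasure N2 X = emeasure lborel (ball 0 1 \<inter> (vunit -` B \<inter> norm -` X)) / emeasure lborel (ball 0 1 :: (complex^'n) set)"
      proof -
        have "X \<in> sets borel" by (simp add: X)
        moreover have "vunit -` B \<inter> norm -` X \<in> sets lborel" unfolding nX using vB by simp
        ultimately show ?thesis unfolding N2[OF \<open>X \<in> sets borel\<close>] U_def
          by (intro emeasure_uniform_measure) auto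
      qed
      also have "ball 0 1 \<inter> (vunit -` B \<inter> norm -` X) = ball 0 1 \<inter> vunit -` B \<inter> norm -` {..<s}"
        by (auto simp: X s_def)
      also have "emeasure lborel \<dots> = ennreal (s ^ (2 * CARD('n))) * emeasure lborel (ball 0 1 \<inter> vunit -` B)"
        by (rule emeasure_cone_lessThan) (use s in auto)
      also have "\<dots> / emeasure lborel (ball 0 1 :: (complex^'n) set) = ennreal (s ^ (2 * CARD('n))) * ?c"
        unfolding U_def by (subst emeasure_uniform_measure) (auto simp: ennreal_times_divide)
      finally show ?thesis using True
        by (simp add: N1_def X emeasure_radial_measure_lessThan[OF n] s_def mult.commute)
    qed
  qed auto
  have "emeasure (radial_measure CARD('n)) A * emeasure (distr U borel vunit) B = emeasure N1 A"
    by (simp add: N1_def emeasure_distr mult.commute)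
  also have "\<dots> = emeasure U (vunit -` B \<inter> norm -` A)" using N2[OF A] \<open>N1 = N2\<close> by simp
  also have "\<dots> = emeasure (distr U (borel \<Otimes>\<^sub>M borel) (\<lambda>z. (norm z, vunit z))) (A \<times> B)"
    by (subst emeasure_distr) (auto intro!: arg_cong[where f = "emeasure U"])
  finally show "emeasure (radial_measure CARD('n)) A * emeasure (distr U borel vunit) B =
    emeasure (distr U (borel \<Otimes>\<^sub>M borel) (\<lambda>z. (norm z, vunit z))) (A \<times> B)" .
qed

text \<open>Measurability is assumed only after cutting off to the ball, because the functions
  integrated later are arbitrary outside it.\<close>

lemma nn_integral_polar:
  fixes h :: "complex ^ 'n \<Rightarrow> ennreal"
  assumes [measurable]: "(\<lambda>z. h z * indicator (ball 0 1) z) \<in> borel_measurable borel"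
  shows "(\<integral>\<^sup>+z. h z \<partial>ball_measure) =
    (\<integral>\<^sup>+r. ennreal (2 * real CARD('n) * r ^ (2 * CARD('n) - 1)) * indicator {0..<1} r *
       (\<integral>\<^sup>+\<xi>. h (r *\<^sub>R \<xi>) \<partial>sphere_measure) \<partial>lborel)"
proof -
  define U where "U = (uniform_measure lborel (ball 0 1) :: (complex ^ 'n) measure)"
  define g where "g = (\<lambda>z. h z * indicator (ball 0 1) z)"
  have [measurable]: "g \<in> borel_measurable borel" by (simp add: g_def)
  have [measurable]: "vunit \<in> borel_measurable (borel :: (complex^'n) measure)" by measurable
  have setsU[simp, measurable_cong]: "sets U = sets borel" by (simp add: U_def)
  have b: "emeasure lborel (ball 0 1 :: (complex^'n) set) \<noteq> 0"
    "emeasure lborel (ball 0 1 :: (complex^'n) set) \<noteq> \<infinity>"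
    using emeasure_lborel_ball_finite[of "0::complex^'n" 1] content_ball_pos[of 1 "0::complex^'n"]
    by (auto simp: measure_def)
  have "finite_measure U"
    using b by (intro finite_measureI) (simp add: U_def ennreal_divide_self less_top)
  then interpret V: finite_measure "distr U borel vunit" by (rule finite_measure.finite_measure_distr) simp
  have "(\<integral>\<^sup>+z. h z \<partial>ball_measure) = (\<integral>\<^sup>+z. g z \<partial>U)"
    unfolding ball_measure_def g_def U_def by (subst nn_integral_restrict_space) auto
  also have "\<dots> = (\<integral>\<^sup>+z. g (norm z *\<^sub>R vunit z) \<partial>U)"
  proof (intro nn_integral_cong arg_cong[where f = g])
    show "z = norm z *\<^sub>R vunit z" for z :: "complex^'n" by (cases "z = 0") auto
  qed
  also have "\<dots> = (\<integral>\<^sup>+p. g (fst p *\<^sub>R snd p) \<partial>distr U (borel \<Otimes>\<^sub>M borel) (\<lambda>z. (norm z, vunit z)))"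
    by (subst nn_integral_distr) auto
  also have "\<dots> = (\<integral>\<^sup>+p. g (fst p *\<^sub>R snd p) \<partial>(radial_measure CARD('n) \<Otimes>\<^sub>M distr U borel vunit))"
    unfolding U_def by (subst polar_measure) simp
  also have "\<dots> = (\<integral>\<^sup>+r. \<integral>\<^sup>+\<xi>. g (r *\<^sub>R \<xi>) \<partial>distr U borel vunit \<partial>radial_measure CARD('n))"
    by (subst V.nn_integral_fst[symmetric]) auto
  also have "\<dots> = (\<integral>\<^sup>+r. ennreal (2 * real CARD('n) * r ^ (2 * CARD('n) - 1)) * indicator {0..1} r *
      (\<integral>\<^sup>+\<xi>. g (r *\<^sub>R \<xi>) \<partial>distr U borel vunit) \<partial>lborel)"
    unfolding radial_measure_def by (subst nn_integral_density) auto
  also have "\<dots> = (\<integral>\<^sup>+r. ennreal (2 * real CARD('n) * r ^ (2 * CARD('n) - 1)) * indicator {0..<1} r *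
       (\<integral>\<^sup>+\<xi>. h (r *\<^sub>R \<xi>) \<partial>sphere_measure) \<partial>lborel)"
  \<comment> \<open>Two null sets are discarded: the radius 1, where the cut-off \<open>g\<close>
    stops agreeing with \<open>h\<close>, and the origin, the only point that \<open>vunit\<close>
    sends off the sphere.\<close>
  proof (rule nn_integral_cong_AE)
    have "AE r in lborel. r \<noteq> (1::real)" by (rule AE_lborel_singleton)
    then show "AE r in lborel. ennreal (2 * real CARD('n) * r ^ (2 * CARD('n) - 1)) * indicator {0..1} r *
      (\<integral>\<^sup>+\<xi>. g (r *\<^sub>R \<xi>) \<partial>distr U borel vunit) =
      ennreal (2 * real CARD('n) * r ^ (2 * CARD('n) - 1)) * indicator {0..<1} r *
      (\<integral>\<^sup>+\<xi>. h (r *\<^sub>R \<xi>) \<partial>sphere_measure)"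
    proof eventually_elim
      case (elim r)
      show ?case
      proof (cases "r \<in> {0..<1}")
        case True
        have "AE \<xi> in distr U borel vunit. \<xi> \<in> sphere 0 1"
        proof (subst AE_distr_iff)
          have "AE z in lborel. z \<noteq> (0::complex^'n)" by (rule AE_lborel_singleton)
          then show "AE z in U. vunit z \<in> sphere 0 1"
            unfolding U_def by (subst AE_uniform_measure) (use b in \<open>auto elim!: eventually_mono simp: less_top\<close>)
        qed auto
        then have "(\<integral>\<^sup>+\<xi>. g (r *\<^sub>R \<xi>) \<partial>distr U borel vunit) =
            (\<integral>\<^sup>+\<xi>. h (r *\<^sub>R \<xi>) * indicator (sphere 0 1) \<xi> \<partial>distr U borel vunit)"
          by (intro nn_integral_cong_AE) (use True in \<open>auto elim!: eventually_mono simp: g_def\<close>)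
        also have "\<dots> = (\<integral>\<^sup>+\<xi>. h (r *\<^sub>R \<xi>) \<partial>sphere_measure)"
          unfolding sphere_measure_def U_def by (subst nn_integral_restrict_space) auto
        finally show ?thesis using True by simp
      qed (use elim in auto)
    qed
  qed
  finally show ?thesis .
qed

section \<open>Holomorphic functions and the Hermitian inner product\<close>

definition hip :: "complex ^ 'n \<Rightarrow> complex ^ 'n \<Rightarrow> complex" where
  "hip z w = (\<Sum>i\<in>UNIV. z $ i * cnj (w $ i))"

lemma hip_add_left: "hip (a + b) w = hip a w + hip b w"
  and hip_add_right: "hip w (a + b) = hip w a + hip w b"
  and hip_diff_left: "hip (a - b) w = hip a w - hip b w"
  and hip_scale_left: "hip (c *s a) w = c * hip a w"
  and hip_scale_right: "hip w (c *s a) = cnj c * hip w a"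
  and hip_scaleR_left: "hip (r *\<^sub>R a) w = of_real r * hip a w"
  and hip_scaleR_right: "hip w (r *\<^sub>R a) = of_real r * hip w a"
  and hip_zero_left [simp]: "hip 0 w = 0"
  and hip_zero_right [simp]: "hip w 0 = 0"
  and cnj_hip: "cnj (hip a w) = hip w a"
  unfolding hip_def
  by (simp_all add: sum.distrib sum_subtractf algebra_simps sum_distrib_left scaleR_conv_of_real[where 'a=complex])

lemma hip_axis_right: "hip z (axis i 1) = z $ i"
proof -
  have "hip z (axis i 1) = (\<Sum>k\<in>UNIV. if k = i then z $ k else 0)"
    unfolding hip_def by (intro sum.cong) (auto simp: axis_def)
  then show ?thesis by simp
qed

lemma norm_vec_power2: "(norm (z :: complex ^ 'n))\<^sup>2 = (\<Sum>i\<in>UNIV. (cmod (z $ i))\<^sup>2)"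
  unfolding norm_vec_def L2_set_def by (simp add: sum_nonneg)

lemma hip_self: "hip z z = of_real ((norm z)\<^sup>2)"
  unfolding hip_def norm_vec_power2 by (simp add: complex_norm_square[symmetric] del: of_real_power)

lemma cmod_hip_le: "cmod (hip z w) \<le> norm z * norm w"
proof -
  have "cmod (hip z w) \<le> (\<Sum>i\<in>UNIV. cmod (z $ i) * cmod (w $ i))"
    unfolding hip_def by (rule order_trans[OF norm_sum]) (simp add: norm_mult)
  also have "\<dots> \<le> norm z * norm w"
    unfolding norm_vec_def using L2_set_mult_ineq[of "\<lambda>i. cmod (z $ i)" "\<lambda>i. cmod (w $ i)" UNIV] by simp
  finally show ?thesis .
qed

lemma norm_vec_scale: "norm (c *s (z :: complex ^ 'n)) = cmod c * norm z"
proof -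
  have "(norm (c *s z))\<^sup>2 = (cmod c * norm z)\<^sup>2"
    by (simp add: norm_vec_power2 norm_mult power_mult_distrib sum_distrib_left)
  then show ?thesis by (simp add: power2_eq_iff_nonneg)
qed

lemma norm_add_orthogonal:
  assumes "hip p q = 0"
  shows "(norm (p + c *s q))\<^sup>2 = (norm p)\<^sup>2 + (cmod c)\<^sup>2 * (norm q)\<^sup>2"
proof -
  have qp: "hip q p = 0" using assms cnj_hip[of p q] by simp
  have "hip (p + c *s q) (p + c *s q) = hip p p + c * cnj c * hip q q"
    using assms qp by (simp add: hip_add_left hip_add_right hip_scale_left hip_scale_right)
  then have "of_real ((norm (p + c *s q))\<^sup>2) = (of_real ((norm p)\<^sup>2 + (cmod c)\<^sup>2 * (norm q)\<^sup>2) :: complex)"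
    by (simp add: hip_self complex_norm_square[symmetric])
  then show ?thesis using of_real_eq_iff by blast
qed

lemma scaleR_conv_vec_scale: "r *\<^sub>R (z :: complex ^ 'n) = of_real r *s z"
  by (simp add: vec_eq_iff scaleR_conv_of_real[where 'a=complex])

lemma bounded_linear_vec_scale: "bounded_linear (\<lambda>c. c *s (b :: complex ^ 'n))"
  unfolding linear_conv_bounded_linear[symmetric]
  by (rule linearI) (simp_all add: vec_eq_iff algebra_simps scaleR_conv_of_real[where 'a=complex])

lemma borel_measurable_hip [measurable]:
  "f \<in> borel_measurable M \<Longrightarrow> g \<in> borel_measurable M \<Longrightarrow> (\<lambda>x. hip (f x) (g x :: complex ^ 'n)) \<in> borel_measurable M"
proof -
  assume [measurable]: "f \<in> borel_measurable M" "g \<in> borel_measurable M"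
  have [measurable]: "(\<lambda>z::complex^'n. z $ i) \<in> borel_measurable borel" for i
    by (intro borel_measurable_continuous_onI continuous_intros)
  have [measurable]: "cnj \<in> borel_measurable borel"
    by (intro borel_measurable_continuous_onI continuous_intros)
  show ?thesis unfolding hip_def by measurable
qed

lemma borel_measurable_vec_scale [measurable]:
  assumes [measurable]: "f \<in> borel_measurable M" "g \<in> borel_measurable M"
  shows "(\<lambda>x. f x *s (g x :: complex ^ 'n)) \<in> borel_measurable M"
proof -
  have "continuous_on UNIV (\<lambda>p :: complex \<times> (complex ^ 'n). \<chi> i. fst p * snd p $ i)"
    by (intro continuous_intros)
  then have [measurable]: "(\<lambda>p :: complex \<times> (complex ^ 'n). fst p *s snd p) \<in> borel_measurable borel"
    by (intro borel_measurable_continuous_onI) (simp add: vector_scalar_mult_def)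
  have "(\<lambda>x. (\<lambda>p. fst p *s snd p) (f x, g x)) \<in> borel_measurable M" by measurable
  then show ?thesis by simp
qed

lemma holomorphic_ball_const: "holomorphic_ball (\<lambda>_. c)"
  unfolding holomorphic_ball_def by (intro ballI exI[of _ "\<lambda>_. 0"]) simp

lemma holomorphic_ball_component: "holomorphic_ball (\<lambda>z. z $ i)"
  unfolding holomorphic_ball_def
  by (intro ballI exI[of _ "\<lambda>v. v $ i"]) (auto intro: bounded_linear_imp_has_derivative bounded_linear_vec_nth)

lemma holomorphic_ball_add:
  assumes "holomorphic_ball f" "holomorphic_ball g"
  shows "holomorphic_ball (\<lambda>z. f z + g z)"
  unfolding holomorphic_ball_def
proof
  fix z :: "complex ^ 'a" assume z: "z \<in> ball 0 1"
  obtain L L' where "(f has_derivative L) (at z)" "(g has_derivative L') (at z)"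
    "\<forall>c v. L (c *s v) = c * L v" "\<forall>c v. L' (c *s v) = c * L' v"
    using assms z unfolding holomorphic_ball_def by metis
  then show "\<exists>L. ((\<lambda>z. f z + g z) has_derivative L) (at z) \<and> (\<forall>c v. L (c *s v) = c * L v)"
    by (intro exI[of _ "\<lambda>v. L v + L' v"] conjI has_derivative_add) (auto simp: distrib_left)
qed

lemma holomorphic_ball_mult:
  assumes "holomorphic_ball f" "holomorphic_ball g"
  shows "holomorphic_ball (\<lambda>z. f z * g z)"
  unfolding holomorphic_ball_def
proof
  fix z :: "complex ^ 'a" assume z: "z \<in> ball 0 1"
  obtain L L' where "(f has_derivative L) (at z)" "(g has_derivative L') (at z)"
    "\<forall>c v. L (c *s v) = c * L v" "\<forall>c v. L' (c *s v) = c * L' v"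
    using assms z unfolding holomorphic_ball_def by metis
  then show "\<exists>L. ((\<lambda>z. f z * g z) has_derivative L) (at z) \<and> (\<forall>c v. L (c *s v) = c * L v)"
    by (intro exI[of _ "\<lambda>v. f z * L' v + L v * g z"] conjI has_derivative_mult) (auto simp: distrib_left mult_ac)
qed

lemma holomorphic_ball_power: "holomorphic_ball f \<Longrightarrow> holomorphic_ball (\<lambda>z. f z ^ m)"
  by (induction m) (simp_all add: holomorphic_ball_const holomorphic_ball_mult)

lemma holomorphic_ball_sum:
  "finite I \<Longrightarrow> (\<And>i. i \<in> I \<Longrightarrow> holomorphic_ball (f i)) \<Longrightarrow> holomorphic_ball (\<lambda>z. \<Sum>i\<in>I. f i z)"
  by (induction I rule: finite_induct) (simp_all add: holomorphic_ball_const holomorphic_ball_add)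

lemma holomorphic_ball_hip: "holomorphic_ball (\<lambda>z. hip z w)"
  unfolding hip_def
  by (intro holomorphic_ball_sum holomorphic_ball_mult holomorphic_ball_component holomorphic_ball_const) auto

lemma holomorphic_ball_continuous_on: "holomorphic_ball f \<Longrightarrow> continuous_on (ball 0 1) f"
  unfolding holomorphic_ball_def
  by (meson continuous_at_imp_continuous_on has_derivative_continuous)

text \<open>Nothing is known about \<open>f\<close> off the ball; setting it to 0 there gives a
  Borel function on the whole space, which product measurability arguments can handle.\<close>

lemma holomorphic_ball_borel:
  assumes "holomorphic_ball f"
  shows "(\<lambda>z. if norm z < 1 then f z else 0) \<in> borel_measurable borel"
proof -
  have "(\<lambda>z. indicator (ball 0 1) z *\<^sub>R f z) \<in> borel_measurable borel"
    by (rule borel_measurable_continuous_on_indicator)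
      (use holomorphic_ball_continuous_on[OF assms] in auto)
  also have "(\<lambda>z. indicator (ball 0 1) z *\<^sub>R f z) = (\<lambda>z. if norm z < 1 then f z else 0)"
    by (auto simp: fun_eq_iff indicator_def)
  finally show ?thesis .
qed

text \<open>The bridge to one complex variable: a complex linear derivative restricted to a complex
  line is multiplication by a number. The mean value property, power series and the maximum
  principle are all applied to such slices.\<close>

lemma holomorphic_on_slice:
  assumes f: "holomorphic_ball f"
  shows "(\<lambda>c. f (a + c *s b)) holomorphic_on {c. norm (a + c *s b) < 1}"
proof (rule holomorphic_onI)
  fix c assume c: "c \<in> {c. norm (a + c *s b) < 1}"
  then obtain L where L: "(f has_derivative L) (at (a + c *s b))" "\<And>c v. L (c *s v) = c * L v"
    using f unfolding holomorphic_ball_def by (metis mem_Collect_eq mem_ball_0)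
  have "((\<lambda>c. a + c *s b) has_derivative (\<lambda>h. 0 + h *s b)) (at c)"
    by (intro has_derivative_add has_derivative_const bounded_linear_imp_has_derivative bounded_linear_vec_scale)
  from has_derivative_compose[OF this L(1)]
  have "((\<lambda>c. f (a + c *s b)) has_derivative (\<lambda>h. h * L b)) (at c)"
    by (simp add: L(2))
  then have "((\<lambda>c. f (a + c *s b)) has_field_derivative L b) (at c)"
    by (simp add: has_field_derivative_def mult.commute[of _ "L b"])
  then show "(\<lambda>c. f (a + c *s b)) field_differentiable at c within {c. norm (a + c *s b) < 1}"
    by (meson field_differentiable_at_within field_differentiable_def)
qed

section \<open>Averages over circles\<close>

lemma circle_mean_value:
  assumes u: "u holomorphic_on ball 0 r" and r: "r > 1"
  shows "(LBINT t:{0..1}. u (cis (2 * pi * t))) = u 0"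
proof -
  have sub: "cball 0 1 \<subseteq> ball (0::complex) r" using r by auto
  have u1: "u holomorphic_on cball 0 1" using u sub by (rule holomorphic_on_subset)
  have e: "cis (2 * pi * t) = exp (2 * of_real pi * \<i> * of_real t)" for t
    by (simp add: cis_conv_exp mult_ac)
  have "((\<lambda>w. u w / (w - 0)) has_contour_integral (2 * of_real pi * \<i> * u 0)) (circlepath 0 1)"
    by (rule Cauchy_integral_circlepath_simple) (use u1 in auto)
  then have "((\<lambda>t. u (circlepath 0 1 t) / circlepath 0 1 t * vector_derivative (circlepath 0 1) (at t within {0..1}))
     has_integral (2 * of_real pi * \<i> * u 0)) {0..1}"
    by (simp add: has_contour_integral_def)
  then have "((\<lambda>t. (2 * of_real pi * \<i>) * u (cis (2 * pi * t))) has_integral (2 * of_real pi * \<i> * u 0)) {0..1}"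
  proof (rule has_integral_eq[rotated])
    fix t :: real assume "t \<in> {0..1}"
    then have "vector_derivative (circlepath 0 1) (at t within {0..1}) =
        2 * of_real pi * \<i> * exp (2 * of_real pi * \<i> * of_real t)"
      using vector_derivative_circlepath01[of t 0 1] by simp
    moreover have "circlepath 0 1 t = exp (2 * of_real pi * \<i> * of_real t)"
      by (simp add: circlepath)
    ultimately show "u (circlepath 0 1 t) / circlepath 0 1 t * vector_derivative (circlepath 0 1) (at t within {0..1})
        = (2 * of_real pi * \<i>) * u (cis (2 * pi * t))"
      unfolding e by simp
  qed
  moreover have "K * a / K = a" if "K \<noteq> 0" for K a :: complex using that by simp
  ultimately have *: "((\<lambda>t. u (cis (2 * pi * t))) has_integral u 0) {0..1}"
    using has_integral_divide[of _ "2 * of_real pi * \<i> * u 0" "{0..1}" "2 * of_real pi * \<i>"] by fastforce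
  have "continuous_on {0..1} (\<lambda>t::real. u (cis (2 * pi * t)))"
    by (rule continuous_on_compose2[OF holomorphic_on_imp_continuous_on[OF u1]])
       (auto intro!: continuous_intros)
  then have "set_integrable lborel {0..1} (\<lambda>t::real. u (cis (2 * pi * t)))"
    by (rule borel_integrable_atLeastAtMost')
  then show ?thesis using * set_borel_integral_eq_integral(2) by (metis integral_unique)
qed

text \<open>Average the invariance over the circle |c| = 1, exchange the integrals, and apply the
  mean value property in \<open>c\<close> for each fixed \<open>x\<close>. A symmetry that rotates a
  variable thus allows the variable to be collapsed to 0.\<close>

lemma rotation_average:
  assumes M: "finite_measure M"
    and meas: "(\<lambda>(t, x). G (cis (2 * pi * t)) x) \<in> borel_measurable (borel \<Otimes>\<^sub>M M)"
    and bdd: "\<And>c x. cmod c = 1 \<Longrightarrow> x \<in> space M \<Longrightarrow> cmod (G c x) \<le> B"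
    and hol: "\<And>x. x \<in> space M \<Longrightarrow> (\<lambda>c. G c x) holomorphic_on ball 0 r" and r: "r > 1"
    and inv: "\<And>c. cmod c = 1 \<Longrightarrow> (\<integral>x. G c x \<partial>M) = I"
  shows "(\<integral>x. G 0 x \<partial>M) = (I :: complex)"
proof -
  interpret M: finite_measure M by fact
  define L where "L = restrict_space lborel {0..1::real}"
  have sL: "sets L = sets (restrict_space borel {0..1})" unfolding L_def by (intro sets_restrict_space_cong) simp
  have emL: "emeasure L (space L) = 1" by (simp add: L_def emeasure_restrict_space space_restrict_space)
  interpret L: finite_measure L by (intro finite_measureI) (simp add: emL)
  interpret pair_sigma_finite L M by unfold_locales
  interpret LM: finite_measure "L \<Otimes>\<^sub>M M"
    by (intro finite_measureI) (simp add: space_pair_measure M.emeasure_pair_measure_Times ennreal_mult_eq_top_iff emL M.emeasure_finite)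
  have "id \<in> L \<rightarrow>\<^sub>M borel" unfolding measurable_cong_sets[OF sL refl] by (rule measurable_restrict_space1) simp
  then have [measurable]: "(\<lambda>x. x) \<in> L \<rightarrow>\<^sub>M borel" by (simp add: id_def)
  have meas': "(\<lambda>(t, x). G (cis (2 * pi * t)) x) \<in> borel_measurable (L \<Otimes>\<^sub>M M)"
  proof -
    have "(\<lambda>p. (fst p, snd p)) \<in> L \<Otimes>\<^sub>M M \<rightarrow>\<^sub>M borel \<Otimes>\<^sub>M M" by measurable
    from measurable_compose[OF this meas] show ?thesis by simp
  qed
  have int: "integrable (L \<Otimes>\<^sub>M M) (\<lambda>(t, x). G (cis (2 * pi * t)) x)"
    by (rule LM.integrable_const_bound[where B = B]) (use bdd meas' in \<open>auto intro!: AE_I2 simp: space_pair_measure\<close>)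
  have "I = (\<integral>t. (\<integral>x. G (cis (2 * pi * t)) x \<partial>M) \<partial>L)"
    using emL by (simp add: inv measure_def)
  also have "\<dots> = (\<integral>x. (\<integral>t. G (cis (2 * pi * t)) x \<partial>L) \<partial>M)"
    using Fubini_integral[OF int] by simp
  also have "\<dots> = (\<integral>x. G 0 x \<partial>M)"
  proof (rule Bochner_Integration.integral_cong[OF refl])
    fix x assume "x \<in> space M"
    then have "(LBINT t:{0..1}. G (cis (2 * pi * t)) x) = G 0 x"
      by (intro circle_mean_value[where r = r] hol r)
    then show "(\<integral>t. G (cis (2 * pi * t)) x \<partial>L) = G 0 x"
      unfolding L_def set_lebesgue_integral_def by (subst integral_restrict_space) auto
  qed
  finally show ?thesis by simp
qed

section \<open>The Cauchy--Szego formula\<close>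

interpretation sphere_measure: finite_measure "sphere_measure :: (complex ^ 'n) measure"
  by (rule finite_measure_sphere_measure)

lemma borel_measurable_sphere [measurable (raw)]:
  "f \<in> borel_measurable borel \<Longrightarrow> f \<in> borel_measurable sphere_measure"
  unfolding measurable_cong_sets[OF sets_sphere_measure refl] by (rule measurable_restrict_space1)

lemma integrable_sphere:
  fixes f :: "complex ^ 'n \<Rightarrow> 'b :: {banach, second_countable_topology}"
  assumes "f \<in> borel_measurable sphere_measure" "\<And>\<xi>. norm \<xi> = 1 \<Longrightarrow> norm (f \<xi>) \<le> B"
  shows "integrable sphere_measure f"
  by (rule sphere_measure.integrable_const_bound[where B = B]) (use assms in \<open>auto intro!: AE_I2\<close>)

lemma hip_projection:
  fixes \<xi> e :: "complex ^ 'n"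
  assumes e: "norm e = 1"
  defines "q \<equiv> \<xi> - hip \<xi> e *s e"
  shows "hip (hip \<xi> e *s e) q = 0" "hip q e = 0"
    "\<And>c. (norm (hip \<xi> e *s e + c *s q))\<^sup>2 = (cmod (hip \<xi> e))\<^sup>2 + (cmod c)\<^sup>2 * (norm q)\<^sup>2"
    "(cmod (hip \<xi> e))\<^sup>2 + (norm q)\<^sup>2 = (norm \<xi>)\<^sup>2"
proof -
  have ee: "hip e e = 1" using e by (simp add: hip_self)
  show qe: "hip q e = 0" by (simp add: q_def hip_diff_left hip_scale_left ee)
  then have "hip e q = 0" using cnj_hip[of q e] by simp
  then show pq: "hip (hip \<xi> e *s e) q = 0" by (simp add: hip_scale_left)
  show *: "(norm (hip \<xi> e *s e + c *s q))\<^sup>2 = (cmod (hip \<xi> e))\<^sup>2 + (cmod c)\<^sup>2 * (norm q)\<^sup>2" for c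
    using norm_add_orthogonal[OF pq] e by (simp add: norm_vec_scale)
  show "(cmod (hip \<xi> e))\<^sup>2 + (norm q)\<^sup>2 = (norm \<xi>)\<^sup>2"
    using *[of 1] by (simp add: q_def)
qed

text \<open>The unitary maps fixing \<open>e\<close> and rotating its orthogonal complement reduce the integral to
  the complex line through \<open>e\<close>.\<close>

lemma sphere_integral_slice:
  fixes f :: "complex ^ 'n \<Rightarrow> complex"
  assumes f: "holomorphic_ball f" and s: "0 < s" "s < 1" and e: "norm e = 1"
  shows "(\<integral>\<xi>. f (s *\<^sub>R \<xi>) * hip e \<xi> ^ m \<partial>sphere_measure)
    = (\<integral>\<xi>. f (s *\<^sub>R (hip \<xi> e *s e)) * hip e \<xi> ^ m \<partial>sphere_measure)"
proof -
  define F where "F = (\<lambda>z. if norm z < 1 then f z else 0)"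
  have [measurable]: "F \<in> borel_measurable borel"
    unfolding F_def by (rule holomorphic_ball_borel[OF f])
  \<comment> \<open>\<open>R c\<close> fixes the component along \<open>e\<close> and multiplies the
    orthogonal component by \<open>c\<close>: an isometry for |c| = 1, the identity at c = 1, the
    projection onto the line of \<open>e\<close> at c = 0.\<close>
  define R where "R = (\<lambda>c \<xi>. hip \<xi> e *s e + c *s (\<xi> - hip \<xi> e *s e))"
  define G where "G = (\<lambda>c \<xi>. F (s *\<^sub>R R c \<xi>) * hip e \<xi> ^ m)"
  have ee: "hip e e = 1" using e by (simp add: hip_self)
  have nR: "(norm (R c \<xi>))\<^sup>2 = (cmod (hip \<xi> e))\<^sup>2 + (cmod c)\<^sup>2 * (norm (\<xi> - hip \<xi> e *s e))\<^sup>2" for c \<xi>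
    unfolding R_def by (rule hip_projection(3)[OF e])
  have nx: "(cmod (hip \<xi> e))\<^sup>2 + (norm (\<xi> - hip \<xi> e *s e))\<^sup>2 = (norm \<xi>)\<^sup>2" for \<xi>
    by (rule hip_projection(4)[OF e])
  have iso: "norm (R c \<xi>) = norm \<xi>" if "cmod c = 1" for c \<xi>
    using nR[of c \<xi>] nx[of \<xi>] that by (simp add: power2_eq_iff_nonneg)
  \<comment> \<open>The room between \<open>s\<close> and 1 lets |c| exceed 1 a little, which gives
    holomorphy in \<open>c\<close> on a disc larger than the unit disc.\<close>
  have inside: "norm (s *\<^sub>R R c \<xi>) < 1" if "norm \<xi> = 1" "cmod c < 1 / s" for c \<xi>
  proof -
    define b where "b = max 1 (cmod c)"
    have "b \<ge> 1" "cmod c \<le> b" "s * b < 1" using that s by (auto simp: b_def field_simps max_def)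
    have "(norm (R c \<xi>))\<^sup>2 \<le> b\<^sup>2 * (norm \<xi>)\<^sup>2"
      unfolding nR[of c \<xi>] nx[of \<xi>, symmetric] distrib_left
      using mult_right_mono[of 1 "b\<^sup>2" "(cmod (hip \<xi> e))\<^sup>2"] one_le_power[OF \<open>b \<ge> 1\<close>, of 2]
        mult_right_mono[of "(cmod c)\<^sup>2" "b\<^sup>2" "(norm (\<xi> - hip \<xi> e *s e))\<^sup>2"] power_mono[OF \<open>cmod c \<le> b\<close>, of 2]
      by auto
    then have "norm (R c \<xi>) \<le> b"
      using that \<open>b \<ge> 1\<close> by (simp add: power2_le_iff_abs_le)
    then have "s * norm (R c \<xi>) \<le> s * b" using s by (intro mult_left_mono) auto
    with \<open>s * b < 1\<close> have "s * norm (R c \<xi>) < 1" by linarith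
    with s show ?thesis by simp
  qed
  have linR: "linear (R c)" for c
    unfolding R_def
    by (rule linearI) (simp_all add: hip_add_left hip_scaleR_left vec_eq_iff algebra_simps scaleR_conv_of_real[where 'a=complex])
  \<comment> \<open>The antiholomorphic factor sees only the component along \<open>e\<close>. So it
    stays constant in \<open>c\<close>, and composing \<open>G 1\<close> with \<open>R c\<close>
    gives exactly \<open>G c\<close>.\<close>
  have hipR: "hip e (R c \<xi>) = hip e \<xi>" for c \<xi>
  proof -
    have "hip (R c \<xi>) e = hip \<xi> e"
      by (simp add: R_def hip_add_left hip_diff_left hip_scale_left ee)
    then show ?thesis by (metis cnj_hip)
  qed
  have "compact (cball 0 s :: (complex^'n) set)" "cball 0 s \<subseteq> ball (0::complex^'n) 1" using s by auto
  then have "bounded (f ` cball 0 s)"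
    by (meson compact_continuous_image compact_imp_bounded continuous_on_subset f holomorphic_ball_continuous_on)
  then obtain B where B': "\<forall>z\<in>cball 0 s. cmod (f z) \<le> B" "B > 0"
    unfolding bounded_pos by blast
  then have B: "\<And>z. norm z \<le> s \<Longrightarrow> cmod (f z) \<le> B" "B > 0" by auto
  have FB: "cmod (F z) \<le> B" if "norm z \<le> s" for z using B that s by (auto simp: F_def)
  have [measurable]: "cis \<in> borel_measurable borel" by (intro borel_measurable_continuous_onI continuous_intros)
  have id[measurable]: "(\<lambda>\<xi>. \<xi>) \<in> sphere_measure \<rightarrow>\<^sub>M (borel :: (complex^'n) measure)"
    by (rule borel_measurable_sphere) simp
  have "(\<integral>\<xi>. G 0 \<xi> \<partial>sphere_measure) = (\<integral>\<xi>. G 1 \<xi> \<partial>sphere_measure)"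
  proof (rule rotation_average[where B = B and r = "1 / s"])
    show "finite_measure (sphere_measure :: (complex^'n) measure)" by (rule finite_measure_sphere_measure)
    show "(\<lambda>(t, \<xi>). G (cis (2 * pi * t)) \<xi>) \<in> borel_measurable (borel \<Otimes>\<^sub>M sphere_measure)"
      unfolding G_def R_def by measurable
    show "cmod (G c \<xi>) \<le> B" if "cmod c = 1" "\<xi> \<in> space sphere_measure" for c \<xi>
    proof -
      have "cmod (hip e \<xi>) \<le> 1" using cmod_hip_le[of e \<xi>] that e by simp
      then have "cmod (hip e \<xi> ^ m) \<le> 1" by (simp add: norm_power power_le_one)
      moreover have "cmod (F (s *\<^sub>R R c \<xi>)) \<le> B" using that s by (intro FB) (simp add: iso)
      ultimately show ?thesis
        using mult_mono[of "cmod (F (s *\<^sub>R R c \<xi>))" B "cmod (hip e \<xi> ^ m)" 1] B(2)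
        unfolding G_def norm_mult by simp
    qed
    show "(\<lambda>c. G c \<xi>) holomorphic_on ball 0 (1 / s)" if "\<xi> \<in> space sphere_measure" for \<xi>
    proof -
      have R': "s *\<^sub>R R c \<xi> = s *\<^sub>R (hip \<xi> e *s e) + c *s (s *\<^sub>R (\<xi> - hip \<xi> e *s e))" for c
        unfolding R_def by (simp add: vec_eq_iff algebra_simps)
      have "(\<lambda>c. f (s *\<^sub>R R c \<xi>)) holomorphic_on ball 0 (1 / s)"
        unfolding R'
        by (rule holomorphic_on_subset[OF holomorphic_on_slice[OF f]])
           (use inside that in \<open>auto simp: R'[symmetric]\<close>)
      then have "(\<lambda>c. f (s *\<^sub>R R c \<xi>) * hip e \<xi> ^ m) holomorphic_on ball 0 (1 / s)"
        by (intro holomorphic_intros)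
      then show ?thesis
        by (rule holomorphic_transform) (use inside that in \<open>auto simp: G_def F_def\<close>)
    qed
    show "1 < 1 / s" using s by simp
    show "(\<integral>\<xi>. G c \<xi> \<partial>sphere_measure) = (\<integral>\<xi>. G 1 \<xi> \<partial>sphere_measure)" if c: "cmod c = 1" for c
    proof -
      have "(\<integral>\<xi>. G 1 (R c \<xi>) \<partial>sphere_measure) = (\<integral>\<xi>. G 1 \<xi> \<partial>sphere_measure)"
        by (rule integral_sphere_measure_isometry) (use linR iso c in \<open>auto simp: G_def R_def\<close>)
      moreover have "G 1 (R c \<xi>) = G c \<xi>" for \<xi>
      proof -
        have "R 1 x = x" for x by (simp add: R_def)
        then show ?thesis by (simp add: G_def hipR)
      qed
      ultimately show ?thesis by simp
    qed
  qed
  moreover have "G 0 \<xi> = f (s *\<^sub>R (hip \<xi> e *s e)) * hip e \<xi> ^ m" if "norm \<xi> = 1" for \<xi>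
    using inside[OF that, of 0] s by (simp add: G_def F_def R_def)
  moreover have "G 1 \<xi> = f (s *\<^sub>R \<xi>) * hip e \<xi> ^ m" if "norm \<xi> = 1" for \<xi>
    using inside[OF that, of 1] s that by (simp add: G_def F_def R_def)
  ultimately show ?thesis
    using Bochner_Integration.integral_cong[OF refl, of sphere_measure "G 0" "\<lambda>\<xi>. f (s *\<^sub>R (hip \<xi> e *s e)) * hip e \<xi> ^ m"]
      Bochner_Integration.integral_cong[OF refl, of sphere_measure "G 1" "\<lambda>\<xi>. f (s *\<^sub>R \<xi>) * hip e \<xi> ^ m"]
    by simp
qed

section \<open>Moments of the surface measure\<close>

definition sphere_moment :: "complex ^ 'n \<Rightarrow> nat \<Rightarrow> real" where
  "sphere_moment e m = (\<integral>\<xi>. (cmod (hip \<xi> e)) ^ (2 * m) \<partial>sphere_measure)"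

lemma sphere_moment_0: "sphere_moment (e :: complex ^ 'n) 0 = 1"
  by (simp add: sphere_moment_def measure_sphere_measure)

lemma sphere_integral_hip_powers:
  fixes e :: "complex ^ 'n"
  shows "(\<integral>\<xi>. hip \<xi> e ^ j * hip e \<xi> ^ m \<partial>sphere_measure) = (if j = m then of_real (sphere_moment e m) else 0)"
proof -
  have eq: "hip \<xi> e ^ m * hip e \<xi> ^ m = of_real ((cmod (hip \<xi> e)) ^ (2 * m))" for \<xi>
    by (simp add: cnj_hip[of \<xi> e, symmetric] power_mult_distrib[symmetric] complex_norm_square[symmetric] power_mult)
  have "(\<integral>\<xi>. hip \<xi> e ^ j * hip e \<xi> ^ m \<partial>sphere_measure) = 0" (is "?I = 0") if "j \<noteq> m"
  proof -
    define k where "k = real j - real m"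
    have k: "k \<noteq> 0" using that by (simp add: k_def)
    \<comment> \<open>Rotation by \<open>c\<close> multiplies the integrand by c^j (cnj c)^m = cis
      \<pi> = -1, while the integral is invariant; hence it vanishes.\<close>
    define c where "c = cis (pi / k)"
    have c: "cmod c = 1" by (simp add: c_def)
    have "c ^ j * cnj c ^ m = cis (real j * (pi / k) + real m * (- (pi / k)))"
      by (simp only: c_def cis_cnj Complex.DeMoivre cis_mult)
    also have "real j * (pi / k) + real m * (- (pi / k)) = pi"
    proof -
      have "real j * (pi / k) + real m * (- (pi / k)) = k * (pi / k)"
        unfolding k_def left_diff_distrib by simp
      then show ?thesis using k by simp
    qed
    finally have cc: "c ^ j * cnj c ^ m = -1" by simp
    have lin: "linear (\<lambda>\<xi> :: complex ^ 'n. c *s \<xi>)"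
      by (rule linearI) (simp_all add: vec_eq_iff algebra_simps)
    have "(\<integral>\<xi>. hip (c *s \<xi>) e ^ j * hip e (c *s \<xi>) ^ m \<partial>sphere_measure) = ?I"
      by (rule integral_sphere_measure_isometry[OF lin]) (use c in \<open>auto simp: norm_vec_scale\<close>)
    moreover have "hip (c *s \<xi>) e ^ j * hip e (c *s \<xi>) ^ m = (c ^ j * cnj c ^ m) * (hip \<xi> e ^ j * hip e \<xi> ^ m)" for \<xi>
      by (simp add: hip_scale_left hip_scale_right power_mult_distrib)
    ultimately have "-1 * ?I = ?I" unfolding cc by simp
    then show ?thesis by simp
  qed
  moreover have "(\<integral>\<xi>. hip \<xi> e ^ m * hip e \<xi> ^ m \<partial>sphere_measure) = of_real (sphere_moment e m)"
    unfolding eq sphere_moment_def by (rule integral_complex_of_real)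
  ultimately show ?thesis by auto
qed

lemma sphere_integral_homogeneous_unit:
  fixes f :: "complex ^ 'n \<Rightarrow> complex"
  assumes f: "holomorphic_ball f" and hom: "\<And>c z. f (c *s z) = c ^ d * f z" and e: "norm e = 1"
  shows "(\<integral>\<xi>. f \<xi> * hip e \<xi> ^ m \<partial>sphere_measure) = (if d = m then of_real (sphere_moment e m) * f e else 0)"
proof -
  \<comment> \<open>The slice formula needs a radius below 1. Homogeneity permits the radius 1/2,
    whose factor cancels at the end.\<close>
  have half: "f ((1/2) *\<^sub>R \<xi>) = (1/2) ^ d * f \<xi>" for \<xi>
    using hom[of "1/2" \<xi>] by (simp add: scaleR_conv_vec_scale)
  have "(1/2) ^ d * (\<integral>\<xi>. f \<xi> * hip e \<xi> ^ m \<partial>sphere_measure)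
      = (\<integral>\<xi>. f ((1/2) *\<^sub>R \<xi>) * hip e \<xi> ^ m \<partial>sphere_measure)"
    unfolding half mult.assoc by simp
  also have "\<dots> = (\<integral>\<xi>. f ((1/2) *\<^sub>R (hip \<xi> e *s e)) * hip e \<xi> ^ m \<partial>sphere_measure)"
    by (rule sphere_integral_slice[OF f _ _ e]) auto
  also have "\<dots> = (1/2) ^ d * f e * (\<integral>\<xi>. hip \<xi> e ^ d * hip e \<xi> ^ m \<partial>sphere_measure)"
    unfolding half hom by (subst integral_mult_right_zero[symmetric]) (simp add: mult_ac)
  finally show ?thesis unfolding sphere_integral_hip_powers by (auto simp: mult_ac)
qed

text \<open>The integral of <\<xi>, v>^m <u, \<xi>>^m is evaluated twice, reproducing at
  \<open>u\<close> and, after conjugation, at \<open>v\<close>. This gives the two moments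
  multiplied by the same power of <v, u>, which cancels unless the vectors are orthogonal.\<close>

lemma sphere_moment_eq:
  fixes u v :: "complex ^ 'n"
  assumes u: "norm u = 1" and v: "norm v = 1"
  shows "sphere_moment u m = sphere_moment v m"
proof -
  have *: "sphere_moment u m = sphere_moment v m"
    if u: "norm u = 1" and v: "norm v = 1" and uv: "hip u v \<noteq> 0" for u v :: "complex ^ 'n"
  proof -
    have h: "(\<integral>\<xi>. hip \<xi> b ^ m * hip a \<xi> ^ m \<partial>sphere_measure) = of_real (sphere_moment a m) * hip a b ^ m"
      if "norm a = 1" for a b :: "complex ^ 'n"
      using sphere_integral_homogeneous_unit[of "\<lambda>z. hip z b ^ m" m a m] that
      by (simp add: holomorphic_ball_power holomorphic_ball_hip hip_scale_left power_mult_distrib)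
    have "cnj (\<integral>\<xi>. hip \<xi> v ^ m * hip u \<xi> ^ m \<partial>sphere_measure) = (\<integral>\<xi>. hip \<xi> u ^ m * hip v \<xi> ^ m \<partial>sphere_measure)"
    proof -
      have "(\<integral>\<xi>. cnj (hip \<xi> v ^ m * hip u \<xi> ^ m) \<partial>sphere_measure) = cnj (\<integral>\<xi>. hip \<xi> v ^ m * hip u \<xi> ^ m \<partial>sphere_measure)"
        by (rule Bochner_Integration.integral_cnj)
      moreover have "cnj (hip \<xi> v ^ m * hip u \<xi> ^ m) = hip \<xi> u ^ m * hip v \<xi> ^ m" for \<xi>
        by (simp add: cnj_hip mult.commute)
      ultimately show ?thesis by (simp only:)
    qed
    then have "of_real (sphere_moment u m) * hip v u ^ m = (of_real (sphere_moment v m) * hip v u ^ m :: complex)"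
      unfolding h[OF u] h[OF v] by (simp add: cnj_hip)
    moreover have "hip v u \<noteq> 0" using uv cnj_hip[of u v] by auto
    ultimately show ?thesis by simp
  qed
  show ?thesis
  proof (cases "hip u v = 0")
    case True
    then have vu: "hip v u = 0" using cnj_hip[of u v] by simp
    have "u + v \<noteq> 0"
    proof
      assume "u + v = 0"
      then have "hip (u + v) v = 0" by simp
      then show False using True v by (simp add: hip_add_left hip_self)
    qed
    \<comment> \<open>For orthogonal unit vectors the normalized sum is orthogonal to neither, so it
      links the two moments.\<close>
    define w where "w = vunit (u + v)"
    have w: "norm w = 1" using \<open>u + v \<noteq> 0\<close> by (simp add: w_def)
    have "hip u w \<noteq> 0" "hip w v \<noteq> 0"
      using \<open>u + v \<noteq> 0\<close> True u v by (auto simp: w_def hip_scaleR_left hip_scaleR_right hip_add_left hip_add_right hip_self)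
    then show ?thesis using *[OF u w] *[OF w v] by simp
  qed (use *[OF u v] in auto)
qed

lemma sphere_integral_homogeneous:
  fixes f :: "complex ^ 'n \<Rightarrow> complex" and e :: "complex ^ 'n"
  assumes f: "holomorphic_ball f" and hom: "\<And>c z. f (c *s z) = c ^ d * f z" and e: "norm e = 1"
  shows "(\<integral>\<xi>. f \<xi> * hip w \<xi> ^ m \<partial>sphere_measure) = (if d = m then of_real (sphere_moment e m) * f w else 0)"
proof (cases "w = 0")
  case False
  define u where "u = vunit w"
  have u: "norm u = 1" "w = of_real (norm w) *s u"
    using False by (simp_all add: u_def scaleR_conv_vec_scale[symmetric])
  have fw: "f w = of_real (norm w) ^ d * f u" by (subst u(2)) (rule hom)
  have hw: "hip w \<xi> = of_real (norm w) * hip u \<xi>" for \<xi> by (subst u(2)) (simp add: hip_scale_left)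
  have "(\<integral>\<xi>. f \<xi> * hip w \<xi> ^ m \<partial>sphere_measure) = of_real (norm w) ^ m * (\<integral>\<xi>. f \<xi> * hip u \<xi> ^ m \<partial>sphere_measure)"
    unfolding hw power_mult_distrib by (subst integral_mult_right_zero[symmetric]) (simp add: mult_ac)
  then show ?thesis
    using sphere_integral_homogeneous_unit[OF f hom u(1), where m = m] sphere_moment_eq[OF e u(1), of m]
    by (auto simp: fw mult_ac)
next
  case True
  have u: "norm (axis i 1 :: complex ^ 'n) = 1" for i by (simp add: norm_axis_1)
  have f0: "f 0 = 0 ^ d * f 0" using hom[of 0 0] by simp
  show ?thesis
  \<comment> \<open>Since \<open>0 ^ 0 = 1\<close>, the case m = 0 has content at w = 0: the
    integral no longer depends on \<open>w\<close>, so a unit vector may replace 0, and homogeneity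
    of degree 0 makes \<open>f\<close> agree at both points.\<close>
  proof (cases "m = 0")
    case True
    have "(\<integral>\<xi>. f \<xi> * hip w \<xi> ^ m \<partial>sphere_measure) = (\<integral>\<xi>. f \<xi> * hip (axis undefined 1) \<xi> ^ m \<partial>sphere_measure)"
      using True by simp
    also have "\<dots> = (if d = m then of_real (sphere_moment e m) * f (axis undefined 1) else 0)"
      using sphere_integral_homogeneous_unit[OF f hom u, where m = m] sphere_moment_eq[OF e u, of m] by simp
    also have "d = 0 \<Longrightarrow> f (axis undefined 1) = f 0"
      using hom[of 0 "axis undefined 1"] by (simp add: vec_eq_iff)
    ultimately show ?thesis using True \<open>w = 0\<close> by simp
  next
    case False
    then show ?thesis using f0 True by (auto simp: power_0_left)
  qed
qed

text \<open>The reproducing formula for z_i^m z_k is applied at w = e_i + t e_k. Both sides are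
  polynomials in t, and f(w) = t. Comparing the coefficients of t gives the mixed moment, with the
  factor \<open>Suc m\<close> coming from the binomial expansion of <w, \<xi>>^(m+1).\<close>

lemma sphere_moment_mixed:
  fixes i k :: "'n::finite" and e :: "complex ^ 'n"
  assumes e: "norm e = 1" and ik: "i \<noteq> k"
  shows "(\<integral>\<xi>. (cmod (\<xi> $ i)) ^ (2 * m) * (cmod (\<xi> $ k))\<^sup>2 \<partial>(sphere_measure :: (complex ^ 'n) measure))
    = sphere_moment e (Suc m) / real (Suc m)"
proof -
  define f where "f = (\<lambda>z :: complex ^ 'n. z $ i ^ m * z $ k)"
  have f: "holomorphic_ball f"
    unfolding f_def by (intro holomorphic_ball_mult holomorphic_ball_power holomorphic_ball_component)
  have hom: "f (c *s z) = c ^ Suc m * f z" for c z by (simp add: f_def power_mult_distrib)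
  define b where "b = (\<lambda>j. of_nat (Suc m choose j) * (\<integral>\<xi>. f \<xi> * (cnj (\<xi> $ k) ^ j * cnj (\<xi> $ i) ^ (Suc m - j)) \<partial>sphere_measure))"
  have comp: "cmod (\<xi> $ l) \<le> 1" if "norm \<xi> = 1" for \<xi> :: "complex ^ 'n" and l
    using Finite_Cartesian_Product.norm_nth_le[of \<xi> l] that by simp
  have [measurable]: "(\<lambda>z::complex^'n. z $ l) \<in> borel_measurable borel" for l
    by (intro borel_measurable_continuous_onI continuous_intros)
  have [measurable]: "cnj \<in> borel_measurable borel"
    by (intro borel_measurable_continuous_onI continuous_intros)
  have int: "integrable sphere_measure (\<lambda>\<xi>. f \<xi> * (cnj (\<xi> $ k) ^ j * cnj (\<xi> $ i) ^ (Suc m - j)))" for j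
  proof (rule integrable_sphere[where B = 1])
    show "(\<lambda>\<xi>. f \<xi> * (cnj (\<xi> $ k) ^ j * cnj (\<xi> $ i) ^ (Suc m - j))) \<in> borel_measurable sphere_measure"
      unfolding f_def by (intro borel_measurable_sphere) measurable
    show "cmod (f \<xi> * (cnj (\<xi> $ k) ^ j * cnj (\<xi> $ i) ^ (Suc m - j))) \<le> 1" if "norm \<xi> = 1" for \<xi>
      unfolding f_def norm_mult norm_power complex_mod_cnj
      by (intro mult_le_one power_le_one comp that mult_nonneg_nonneg zero_le_power norm_ge_zero)
  qed
  have "(\<Sum>j\<le>Suc m. b j * t ^ j) = (\<Sum>j\<le>Suc m. (if j = 1 then of_real (sphere_moment e (Suc m)) else 0) * t ^ j)" for t
  proof -
    define w where "w = axis i 1 + t *s (axis k 1 :: complex ^ 'n)"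
    have hw: "hip w \<xi> = t * cnj (\<xi> $ k) + cnj (\<xi> $ i)" for \<xi>
      using cnj_hip[of \<xi> "axis i 1"] cnj_hip[of \<xi> "axis k 1"]
      by (simp add: w_def hip_add_left hip_scale_left hip_axis_right)
    have "(\<Sum>j\<le>Suc m. b j * t ^ j) =
        (\<integral>\<xi>. (\<Sum>j\<le>Suc m. of_nat (Suc m choose j) * t ^ j * (f \<xi> * (cnj (\<xi> $ k) ^ j * cnj (\<xi> $ i) ^ (Suc m - j)))) \<partial>sphere_measure)"
    proof (subst Bochner_Integration.integral_sum)
      show "(\<Sum>j\<le>Suc m. b j * t ^ j) = (\<Sum>j\<le>Suc m. (\<integral>\<xi>. of_nat (Suc m choose j) * t ^ j * (f \<xi> * (cnj (\<xi> $ k) ^ j * cnj (\<xi> $ i) ^ (Suc m - j))) \<partial>sphere_measure))"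
        unfolding integral_mult_right_zero b_def by (simp only: mult_ac)
    qed (intro integrable_mult_right int)
    also have "\<dots> = (\<integral>\<xi>. f \<xi> * hip w \<xi> ^ Suc m \<partial>sphere_measure)"
      by (intro Bochner_Integration.integral_cong refl)
         (simp only: hw binomial_ring sum_distrib_left power_mult_distrib mult_ac)
    also have "\<dots> = of_real (sphere_moment e (Suc m)) * f w"
      using sphere_integral_homogeneous[OF f hom e, of w "Suc m"] by simp
    also have "f w = t" using ik by (simp add: f_def w_def axis_def)
    also have "of_real (sphere_moment e (Suc m)) * t = (\<Sum>j\<le>Suc m. (if j = 1 then of_real (sphere_moment e (Suc m)) else 0) * t ^ j)"
      by (subst sum.cong[OF refl, of _ _ "\<lambda>j. if j = 1 then of_real (sphere_moment e (Suc m)) * t else 0"]) auto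
    finally show ?thesis .
  qed
  then have "\<forall>j\<le>Suc m. b j = (if j = 1 then of_real (sphere_moment e (Suc m)) else 0)"
    by (subst polyfun_eq_coeffs[symmetric]) blast
  then have "b 1 = of_real (sphere_moment e (Suc m))" by simp
  then have "of_nat (Suc m) * (\<integral>\<xi>. f \<xi> * (cnj (\<xi> $ k) * cnj (\<xi> $ i) ^ m) \<partial>sphere_measure) = (of_real (sphere_moment e (Suc m)) :: complex)"
    by (simp add: b_def)
  moreover have "f \<xi> * (cnj (\<xi> $ k) * cnj (\<xi> $ i) ^ m) = of_real ((cmod (\<xi> $ i)) ^ (2 * m) * (cmod (\<xi> $ k))\<^sup>2)" for \<xi>
  proof -
    have "f \<xi> * (cnj (\<xi> $ k) * cnj (\<xi> $ i) ^ m) = (\<xi> $ i * cnj (\<xi> $ i)) ^ m * (\<xi> $ k * cnj (\<xi> $ k))"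
      by (simp add: f_def power_mult_distrib mult_ac)
    then show ?thesis by (simp add: complex_norm_square[symmetric] power_mult)
  qed
  ultimately have "of_nat (Suc m) * of_real (\<integral>\<xi>. (cmod (\<xi> $ i)) ^ (2 * m) * (cmod (\<xi> $ k))\<^sup>2 \<partial>(sphere_measure :: (complex ^ 'n) measure))
     = (of_real (sphere_moment e (Suc m)) :: complex)"
    by (simp only: integral_complex_of_real)
  then have "of_real (real (Suc m) * (\<integral>\<xi>. (cmod (\<xi> $ i)) ^ (2 * m) * (cmod (\<xi> $ k))\<^sup>2 \<partial>(sphere_measure :: (complex ^ 'n) measure)))
     = (of_real (sphere_moment e (Suc m)) :: complex)"
    by (simp del: of_nat_Suc of_real_power)
  then show ?thesis unfolding of_real_eq_iff by (simp add: field_simps)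
qed

text \<open>Insert 1 = \<Sum> |\<xi>_k|^2 into the moment in direction e_i: the term k = i is the
  next moment, and each of the other n - 1 terms is the next moment divided by m + 1.\<close>

lemma sphere_moment_Suc:
  fixes e :: "complex ^ 'n"
  assumes e: "norm e = 1"
  shows "real (m + CARD('n)) * sphere_moment e (Suc m) = real (Suc m) * sphere_moment e m"
proof -
  obtain i :: 'n where "True" by simp
  have u: "norm (axis i 1 :: complex ^ 'n) = 1" by (simp add: norm_axis_1)
  have comp: "cmod (\<xi> $ l) \<le> 1" if "norm \<xi> = 1" for \<xi> :: "complex ^ 'n" and l
    using Finite_Cartesian_Product.norm_nth_le[of \<xi> l] that by simp
  have [measurable]: "(\<lambda>z::complex^'n. z $ l) \<in> borel_measurable borel" for l
    by (intro borel_measurable_continuous_onI continuous_intros)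
  have int: "integrable (sphere_measure :: (complex ^ 'n) measure) (\<lambda>\<xi>. (cmod (\<xi> $ i)) ^ (2 * m) * (cmod (\<xi> $ k))\<^sup>2)" for k
  proof (rule integrable_sphere[where B = 1])
    show "(\<lambda>\<xi>. (cmod (\<xi> $ i)) ^ (2 * m) * (cmod (\<xi> $ k))\<^sup>2) \<in> borel_measurable (sphere_measure :: (complex ^ 'n) measure)"
      by (intro borel_measurable_sphere) measurable
    show "norm ((cmod (\<xi> $ i)) ^ (2 * m) * (cmod (\<xi> $ k))\<^sup>2) \<le> 1" if "norm \<xi> = 1" for \<xi> :: "complex ^ 'n"
      using mult_le_one[of "(cmod (\<xi> $ i)) ^ (2 * m)" "(cmod (\<xi> $ k))\<^sup>2"] comp[OF that] by (simp add: power_le_one)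
  qed
  have M: "(\<integral>\<xi>. (cmod (\<xi> $ i)) ^ (2 * l) \<partial>(sphere_measure :: (complex ^ 'n) measure)) = sphere_moment e l" for l
    using sphere_moment_eq[OF e u, of l] by (simp add: sphere_moment_def hip_axis_right)
  have "sphere_moment e m = (\<integral>\<xi>. (\<Sum>k\<in>UNIV. (cmod (\<xi> $ i)) ^ (2 * m) * (cmod (\<xi> $ k))\<^sup>2) \<partial>(sphere_measure :: (complex ^ 'n) measure))"
    unfolding M[symmetric] sum_distrib_left[symmetric] norm_vec_power2[symmetric]
    by (intro Bochner_Integration.integral_cong) auto
  also have "\<dots> = (\<Sum>k\<in>UNIV. (\<integral>\<xi>. (cmod (\<xi> $ i)) ^ (2 * m) * (cmod (\<xi> $ k))\<^sup>2 \<partial>(sphere_measure :: (complex ^ 'n) measure)))"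
    by (rule Bochner_Integration.integral_sum) (rule int)
  also have "\<dots> = (\<Sum>k\<in>UNIV. if k = i then sphere_moment e (Suc m) else sphere_moment e (Suc m) / real (Suc m))"
  proof (rule sum.cong[OF refl])
    fix k :: 'n
    show "(\<integral>\<xi>. (cmod (\<xi> $ i)) ^ (2 * m) * (cmod (\<xi> $ k))\<^sup>2 \<partial>(sphere_measure :: (complex ^ 'n) measure))
      = (if k = i then sphere_moment e (Suc m) else sphere_moment e (Suc m) / real (Suc m))"
      using sphere_moment_mixed[OF e, of i k m] M[of "Suc m"] by (auto simp: power_add[symmetric] power2_eq_square mult_ac)
  qed
  also have "\<dots> = sphere_moment e (Suc m) + (real CARD('n) - 1) * (sphere_moment e (Suc m) / real (Suc m))"
    by (simp add: sum.If_cases Collect_neg_eq[symmetric] Compl_eq_Diff_UNIV card_Diff_singleton of_nat_diff Suc_leI del: of_nat_Suc) simp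
  finally show ?thesis by (simp add: field_simps)
qed

text \<open>The binomial coefficients satisfy the recursion inverse to that of the moments, and both
  sequences start at 1.\<close>

lemma szego_coeff_mult_sphere_moment:
  fixes e :: "complex ^ 'n"
  assumes e: "norm e = 1"
  shows "real (CARD('n) + m - 1 choose m) * sphere_moment e m = 1"
proof (induction m)
  case 0
  then show ?case by (simp add: sphere_moment_0)
next
  case (Suc m)
  define N where "N = CARD('n) - 1"
  have N: "CARD('n) = Suc N" by (simp add: N_def)
  have "Suc m * (Suc (N + m) choose Suc m) = (N + m + 1) * (N + m choose m)"
    using Suc_times_binomial_eq[of "N + m" m] by (simp add: mult_ac)
  then have "real (Suc m) * real (Suc (N + m) choose Suc m) = real (N + m + 1) * real (N + m choose m)"
    by (metis of_nat_mult)
  moreover have "real (m + N + 1) * sphere_moment e (Suc m) = real (Suc m) * sphere_moment e m"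
    using sphere_moment_Suc[OF e, of m] N by simp
  ultimately have "real (Suc m) * (real (Suc (N + m) choose Suc m) * sphere_moment e (Suc m)) =
      real (Suc m) * (real (N + m choose m) * sphere_moment e m)"
    by (metis add.commute mult.assoc mult.left_commute)
  then show ?case using Suc N by simp
qed

text \<open>The Taylor coefficients of (1 - x)^(-n) with n = \<open>CARD('n)\<close>, that is, of
  the Szego kernel of the unit ball in x = <z, w>.\<close>

abbreviation szego_coeff :: "'n itself \<Rightarrow> nat \<Rightarrow> real" where
  "szego_coeff _ m \<equiv> real (CARD('n) + m - 1 choose m)"

section \<open>The Szego expansion and bounds for point evaluations\<close>

lemma vec_polar_decomposition:
  obtains u :: "complex ^ 'n" where "norm u = 1" "w = of_real (norm w) *s u"
proof (cases "w = 0")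
  case True
  have "norm (axis undefined 1 :: complex ^ 'n) = 1" by (simp add: norm_axis_1)
  with True that[of "axis undefined 1"] show ?thesis by (simp add: vec_eq_iff)
next
  case False
  then show ?thesis using that[of "vunit w"] by (simp add: scaleR_conv_vec_scale[symmetric])
qed

text \<open>On the complex line through \<open>w\<close> the function is a power series in one
  variable. Integration against <u, \<xi>>^m picks out its m-th coefficient times the moment, and
  \<open>szego_coeff\<close> undoes the moment. The formula is kept as a series rather than a closed
  kernel because the later argument works degree by degree.\<close>

lemma szego_expansion:
  fixes f :: "complex ^ 'n \<Rightarrow> complex"
  assumes f: "holomorphic_ball f" and s: "0 < s" "s < 1" and w: "norm w < 1"
  shows "(\<lambda>m. of_real (szego_coeff TYPE('n) m) * (\<integral>\<xi>. f (s *\<^sub>R \<xi>) * hip w \<xi> ^ m \<partial>sphere_measure)) sums f (s *\<^sub>R w)"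
proof -
  obtain u where u: "norm u = 1" "w = of_real (norm w) *s u" by (rule vec_polar_decomposition)
  define p where "p = (\<lambda>c. f (0 + c *s (s *\<^sub>R u)))"
  have p: "p holomorphic_on ball 0 (1 / s)"
    unfolding p_def
    by (rule holomorphic_on_subset[OF holomorphic_on_slice[OF f]])
       (use s u in \<open>auto simp: norm_vec_scale field_simps\<close>)
  define c where "c = (\<lambda>j. (deriv ^^ j) p 0 / fact j)"
  have ps: "(\<lambda>j. c j * x ^ j) sums p x" if "cmod x < 1 / s" for x
    using holomorphic_power_series[OF p, of x] that by (simp add: c_def)
  \<comment> \<open>The slice converges at the midpoint of 1 and 1/s, hence absolutely at 1. This
    dominates the series uniformly on the sphere and justifies integrating it term by term.\<close>
  have "summable (\<lambda>j. norm (c j * 1 ^ j))"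
  proof (rule powser_insidea)
    have "1 < 1 / s" using s by simp
    then have "cmod (of_real ((1 + 1 / s) / 2)) < 1 / s" unfolding norm_of_real using s by (simp add: field_simps)
    from ps[OF this] show "summable (\<lambda>j. c j * of_real ((1 + 1 / s) / 2) ^ j)" by (rule sums_summable)
    show "norm (1::complex) < norm (of_real ((1 + 1 / s) / 2) :: complex)"
      unfolding norm_of_real using s by (simp add: field_simps)
  qed
  then have sumc: "summable (\<lambda>j. norm (c j))" by simp
  have hle: "cmod (hip \<xi> u) \<le> 1" "cmod (hip u \<xi>) \<le> 1" if "norm \<xi> = 1" for \<xi>
    using cmod_hip_le[of \<xi> u] cmod_hip_le[of u \<xi>] that u by auto
  have coeff: "(\<integral>\<xi>. f (s *\<^sub>R \<xi>) * hip u \<xi> ^ m \<partial>sphere_measure) = c m * of_real (sphere_moment u m)" for m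
  proof -
    have "(\<integral>\<xi>. f (s *\<^sub>R \<xi>) * hip u \<xi> ^ m \<partial>sphere_measure) = (\<integral>\<xi>. f (s *\<^sub>R (hip \<xi> u *s u)) * hip u \<xi> ^ m \<partial>sphere_measure)"
      by (rule sphere_integral_slice[OF f s u(1)])
    also have "\<dots> = (\<integral>\<xi>. (\<Sum>j. c j * (hip \<xi> u ^ j * hip u \<xi> ^ m)) \<partial>sphere_measure)"
    proof (rule Bochner_Integration.integral_cong[OF refl])
      fix \<xi> :: "complex ^ 'n" assume "\<xi> \<in> space sphere_measure"
      then have "cmod (hip \<xi> u) < 1 / s" using hle(1)[of \<xi>] s by (smt (verit) less_divide_eq_1_pos mem_sphere_0 space_sphere_measure)
      from sums_mult2[OF ps[OF this], of "hip u \<xi> ^ m"]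
      have "(\<Sum>j. c j * (hip \<xi> u ^ j * hip u \<xi> ^ m)) = p (hip \<xi> u) * hip u \<xi> ^ m"
        by (simp add: sums_iff mult.assoc)
      moreover have "s *\<^sub>R (hip \<xi> u *s u) = 0 + hip \<xi> u *s (s *\<^sub>R u)"
        by (simp add: vec_eq_iff)
      ultimately show "f (s *\<^sub>R (hip \<xi> u *s u)) * hip u \<xi> ^ m = (\<Sum>j. c j * (hip \<xi> u ^ j * hip u \<xi> ^ m))"
        by (simp add: p_def)
    qed
    also have "\<dots> = (\<Sum>j. (\<integral>\<xi>. c j * (hip \<xi> u ^ j * hip u \<xi> ^ m) \<partial>sphere_measure))"
    proof (rule integral_suminf)
      have le: "norm (c j * (hip \<xi> u ^ j * hip u \<xi> ^ m)) \<le> norm (c j)" if "norm \<xi> = 1" for j \<xi>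
      proof -
        have "cmod (hip \<xi> u ^ j * hip u \<xi> ^ m) \<le> 1"
          unfolding norm_mult norm_power by (intro mult_le_one power_le_one hle that) auto
        then show ?thesis unfolding norm_mult[of "c j"] by (simp add: mult_left_le)
      qed
      show int: "integrable sphere_measure (\<lambda>\<xi>. c j * (hip \<xi> u ^ j * hip u \<xi> ^ m))" for j
        by (rule integrable_sphere[where B = "norm (c j)"]) (use le in \<open>auto intro!: borel_measurable_sphere\<close>)
      show "AE \<xi> in sphere_measure. summable (\<lambda>j. norm (c j * (hip \<xi> u ^ j * hip u \<xi> ^ m)))"
        by (intro AE_I2 summable_comparison_test'[OF sumc, of 0]) (use le in auto)
      show "summable (\<lambda>j. \<integral>\<xi>. norm (c j * (hip \<xi> u ^ j * hip u \<xi> ^ m)) \<partial>sphere_measure)"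
      proof (rule summable_comparison_test'[OF sumc, of 0])
        fix j
        have "(\<integral>\<xi>. norm (c j * (hip \<xi> u ^ j * hip u \<xi> ^ m)) \<partial>sphere_measure) \<le> (\<integral>\<xi>. norm (c j) \<partial>(sphere_measure :: (complex ^ 'n) measure))"
          by (intro integral_mono integrable_norm int) (use le in auto)
        then show "norm (\<integral>\<xi>. norm (c j * (hip \<xi> u ^ j * hip u \<xi> ^ m)) \<partial>sphere_measure) \<le> norm (c j)"
          by (simp add: measure_sphere_measure)
      qed
    qed
    also have "\<dots> = (\<Sum>j. if j = m then c j * of_real (sphere_moment u j) else 0)"
      unfolding integral_mult_right_zero sphere_integral_hip_powers by (intro suminf_cong) auto
    also have "\<dots> = c m * of_real (sphere_moment u m)"
      by (rule sums_unique[OF sums_single, symmetric])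
    finally show ?thesis .
  qed
  have hw: "hip w \<xi> = of_real (norm w) * hip u \<xi>" for \<xi> by (subst u(2)) (simp add: hip_scale_left)
  have "of_real (szego_coeff TYPE('n) m) * (\<integral>\<xi>. f (s *\<^sub>R \<xi>) * hip w \<xi> ^ m \<partial>sphere_measure) = c m * of_real (norm w) ^ m" for m
  proof -
    have "(\<integral>\<xi>. f (s *\<^sub>R \<xi>) * hip w \<xi> ^ m \<partial>sphere_measure) = of_real (norm w) ^ m * (\<integral>\<xi>. f (s *\<^sub>R \<xi>) * hip u \<xi> ^ m \<partial>sphere_measure)"
      unfolding hw power_mult_distrib integral_mult_right_zero[symmetric]
      by (intro Bochner_Integration.integral_cong refl) (simp only: mult_ac)
    moreover have "of_real (szego_coeff TYPE('n) m) * of_real (sphere_moment u m) = (1::complex)"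
      unfolding of_real_mult[symmetric] szego_coeff_mult_sphere_moment[OF u(1)] by simp
    moreover have "a * (x * (y * b)) = y * x" if "a * b = 1" for a b x y :: complex
      using arg_cong[OF that, of "\<lambda>t. t * (x * y)"] by (simp add: mult_ac)
    ultimately show ?thesis unfolding coeff by (simp add: mult.commute)
  qed
  moreover have "p (of_real (norm w)) = f (s *\<^sub>R w)"
  proof -
    have "0 + of_real (norm w) *s (s *\<^sub>R u) = s *\<^sub>R (of_real (norm w) *s u)" by (simp add: vec_eq_iff)
    then show ?thesis unfolding p_def using u(2) by simp
  qed
  moreover have "cmod (of_real (norm w)) < 1 / s" using w s by (simp add: field_simps) (smt (verit) mult_le_cancel_right1 mult_less_cancel_left2 norm_ge_zero)
  ultimately show ?thesis using ps[of "of_real (norm w)"] by simp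
qed

lemma summable_szego_coeff:
  assumes q: "0 \<le> q" "q < 1"
  shows "summable (\<lambda>m. szego_coeff TYPE('n::finite) m * q ^ m)"
proof -
  define N where "N = CARD('n) - 1"
  have N: "CARD('n) = Suc N" by (simp add: N_def)
  define c where "c = (1 + q) / 2"
  have c: "q < c" "c < 1" "0 < c" using q by (auto simp: c_def)
  \<comment> \<open>From \<open>M\<close> on, the ratio q (N + m + 1) / (m + 1) of consecutive terms
    is at most \<open>c\<close>, the midpoint of q and 1.\<close>
  obtain M :: nat where M: "q * (real N + 1) / (c - q) \<le> real M" using real_arch_simple by blast
  have "summable (\<lambda>m. real (N + m choose m) * q ^ m)"
  proof (rule summable_ratio_test[OF c(2)])
    fix m assume "m \<ge> M"
    then have "q * (real N + 1) / (c - q) \<le> real m" using M by simp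
    then have "q * (real N + 1) \<le> real m * (c - q)" using c by (simp add: divide_le_eq mult.commute)
    then have le: "q * real (N + m + 1) \<le> c * real (Suc m)" using c by (simp add: algebra_simps)
    have "Suc m * (Suc (N + m) choose Suc m) = (N + m + 1) * (N + m choose m)"
      using Suc_times_binomial_eq[of "N + m" m] by (simp add: mult_ac)
    then have rec: "real (Suc m) * real (Suc (N + m) choose Suc m) = real (N + m + 1) * real (N + m choose m)"
      by (metis of_nat_mult)
    have "real (Suc m) * (real (Suc (N + m) choose Suc m) * q ^ Suc m) = (q * real (N + m + 1)) * (real (N + m choose m) * q ^ m)"
      using rec by (simp add: algebra_simps del: of_nat_Suc of_nat_add)
    also have "\<dots> \<le> (c * real (Suc m)) * (real (N + m choose m) * q ^ m)"
      by (rule mult_right_mono[OF le]) (use q in auto)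
    finally have "real (Suc m) * (real (Suc (N + m) choose Suc m) * q ^ Suc m) \<le> real (Suc m) * (c * (real (N + m choose m) * q ^ m))"
      by (simp only: mult_ac)
    then have "real (Suc (N + m) choose Suc m) * q ^ Suc m \<le> c * (real (N + m choose m) * q ^ m)"
      by (subst (asm) mult_le_cancel_left_pos) auto
    then show "norm (real (N + Suc m choose Suc m) * q ^ Suc m) \<le> c * norm (real (N + m choose m) * q ^ m)"
      using q by simp
  qed
  then show ?thesis using N by simp
qed

lemma sphere_slice_measurable_bounded:
  assumes f: "holomorphic_ball f" and s: "0 < s" "s < 1"
  shows "(\<lambda>\<xi>. f (s *\<^sub>R \<xi>)) \<in> borel_measurable sphere_measure"
    "\<exists>B. \<forall>\<xi>. norm \<xi> = 1 \<longrightarrow> cmod (f (s *\<^sub>R \<xi>)) \<le> B"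
proof -
  have c: "continuous_on (sphere 0 1) (\<lambda>\<xi>. f (s *\<^sub>R \<xi>))"
    by (rule continuous_on_compose2[OF holomorphic_ball_continuous_on[OF f]])
       (use s in \<open>auto intro!: continuous_intros\<close>)
  show "(\<lambda>\<xi>. f (s *\<^sub>R \<xi>)) \<in> borel_measurable sphere_measure"
    unfolding measurable_cong_sets[OF sets_sphere_measure refl]
    by (rule borel_measurable_continuous_on_restrict[OF c])
  have "bounded ((\<lambda>\<xi>. f (s *\<^sub>R \<xi>)) ` sphere 0 1)"
    by (intro compact_imp_bounded compact_continuous_image c) simp
  then obtain B where "\<forall>\<xi>\<in>sphere 0 1. cmod (f (s *\<^sub>R \<xi>)) \<le> B"
    unfolding bounded_iff by auto
  then show "\<exists>B. \<forall>\<xi>. norm \<xi> = 1 \<longrightarrow> cmod (f (s *\<^sub>R \<xi>)) \<le> B"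
    by (intro exI[of _ B]) auto
qed

definition sphere_mean :: "(complex ^ 'n \<Rightarrow> complex) \<Rightarrow> real \<Rightarrow> real" where
  "sphere_mean f s = (\<integral>\<xi>. (cmod (f (s *\<^sub>R \<xi>)))\<^sup>2 \<partial>sphere_measure)"

lemma nn_integral_sphere_mean:
  assumes f: "holomorphic_ball f" and s: "0 < s" "s < 1"
  shows "integrable sphere_measure (\<lambda>\<xi>. (cmod (f (s *\<^sub>R \<xi>)))\<^sup>2)"
    "(\<integral>\<^sup>+\<xi>. ennreal ((cmod (f (s *\<^sub>R \<xi>)))\<^sup>2) \<partial>sphere_measure) = ennreal (sphere_mean f s)"
proof -
  obtain B where B: "\<And>\<xi>. norm \<xi> = 1 \<Longrightarrow> cmod (f (s *\<^sub>R \<xi>)) \<le> B"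
    using sphere_slice_measurable_bounded(2)[OF f s] by blast
  have [measurable]: "(\<lambda>\<xi>. f (s *\<^sub>R \<xi>)) \<in> borel_measurable sphere_measure"
    by (rule sphere_slice_measurable_bounded[OF f s])
  show i: "integrable sphere_measure (\<lambda>\<xi>. (cmod (f (s *\<^sub>R \<xi>)))\<^sup>2)"
    by (rule integrable_sphere[where B = "B\<^sup>2"]) (use B in \<open>auto intro!: power_mono\<close>)
  then show "(\<integral>\<^sup>+\<xi>. ennreal ((cmod (f (s *\<^sub>R \<xi>)))\<^sup>2) \<partial>sphere_measure) = ennreal (sphere_mean f s)"
    unfolding sphere_mean_def by (intro nn_integral_eq_integral) auto
qed

lemma sphere_mean_nonneg: "0 \<le> sphere_mean f s"
  unfolding sphere_mean_def by (rule Bochner_Integration.integral_nonneg) simp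

text \<open>The expansion at w = z / s is dominated by \<open>K\<close> times the mean of |f| over
  the sphere of radius \<open>s\<close>. Only the quotient |z| / s enters, so the constant depends
  on \<open>q\<close> alone; this uniformity in \<open>s\<close> allows later integration over
  \<open>s\<close>.\<close>

lemma sphere_mean_pointwise:
  assumes q: "0 \<le> q" "q < 1"
  shows "\<exists>C > 0. \<forall>f s z. holomorphic_ball f \<longrightarrow> 0 < s \<longrightarrow> s < 1 \<longrightarrow> norm z \<le> q * s \<longrightarrow>
    (cmod (f (z :: complex ^ 'n)))\<^sup>2 \<le> C * sphere_mean f s"
proof -
  define K where "K = (\<Sum>m. szego_coeff TYPE('n) m * q ^ m)"
  have "szego_coeff TYPE('n) 0 * q ^ 0 \<le> K"
    using sum_le_suminf[OF summable_szego_coeff[OF q], of "{0}"] q by (simp add: K_def)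
  then have K: "K > 0" by simp
  show ?thesis
  proof (intro exI[of _ "K\<^sup>2"] conjI allI impI)
    show "K\<^sup>2 > 0" using K by simp
    fix f :: "complex ^ 'n \<Rightarrow> complex" and s and z :: "complex ^ 'n" assume f: "holomorphic_ball f" and s: "0 < s" "s < 1" and z: "norm z \<le> q * s"
    define w where "w = z /\<^sub>R s"
    have w: "norm w \<le> q" "z = s *\<^sub>R w" using z s by (auto simp: w_def field_simps)
    define I where "I = (\<integral>\<xi>. cmod (f (s *\<^sub>R \<xi>)) \<partial>sphere_measure)"
    obtain B where B: "\<And>\<xi>. norm \<xi> = 1 \<Longrightarrow> cmod (f (s *\<^sub>R \<xi>)) \<le> B"
      using sphere_slice_measurable_bounded(2)[OF f s] by blast
    have [measurable]: "(\<lambda>\<xi>. f (s *\<^sub>R \<xi>)) \<in> borel_measurable sphere_measure"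
      by (rule sphere_slice_measurable_bounded[OF f s])
    have i1: "integrable sphere_measure (\<lambda>\<xi>. cmod (f (s *\<^sub>R \<xi>)))"
      by (rule integrable_sphere[where B = B]) (use B in auto)
    have I0: "I \<ge> 0" unfolding I_def by (rule Bochner_Integration.integral_nonneg) simp
    have bnd: "cmod (of_real (szego_coeff TYPE('n) m) * (\<integral>\<xi>. f (s *\<^sub>R \<xi>) * hip w \<xi> ^ m \<partial>sphere_measure))
        \<le> szego_coeff TYPE('n) m * q ^ m * I" for m
    proof -
      have "cmod (\<integral>\<xi>. f (s *\<^sub>R \<xi>) * hip w \<xi> ^ m \<partial>sphere_measure) \<le> (\<integral>\<xi>. cmod (f (s *\<^sub>R \<xi>)) * q ^ m \<partial>sphere_measure)"
      proof (rule order_trans[OF integral_norm_bound integral_mono])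
        have le: "cmod (f (s *\<^sub>R \<xi>) * hip w \<xi> ^ m) \<le> cmod (f (s *\<^sub>R \<xi>)) * q ^ m" if "norm \<xi> = 1" for \<xi>
          unfolding norm_mult norm_power using cmod_hip_le[of w \<xi>] w that
          by (intro mult_left_mono power_mono) auto
        show i2: "integrable sphere_measure (\<lambda>\<xi>. cmod (f (s *\<^sub>R \<xi>)) * q ^ m)" using i1 by simp
        have [measurable]: "(\<lambda>\<xi>. hip w \<xi> ^ m) \<in> borel_measurable sphere_measure" by (intro borel_measurable_sphere) measurable
        show "integrable sphere_measure (\<lambda>\<xi>. cmod (f (s *\<^sub>R \<xi>) * hip w \<xi> ^ m))"
          by (rule Bochner_Integration.integrable_bound[OF i2])
             (use le q in \<open>auto intro!: AE_I2 simp: abs_mult\<close>)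
        show "cmod (f (s *\<^sub>R \<xi>) * hip w \<xi> ^ m) \<le> cmod (f (s *\<^sub>R \<xi>)) * q ^ m" if "\<xi> \<in> space sphere_measure" for \<xi>
          using le that by simp
      qed
      also have "\<dots> = q ^ m * I" by (simp add: I_def mult.commute)
      finally show ?thesis unfolding norm_mult by (simp add: mult_left_mono mult.assoc)
    qed
    have sm: "summable (\<lambda>m. szego_coeff TYPE('n) m * q ^ m * I)"
      by (rule summable_mult2[OF summable_szego_coeff[OF q]])
    have "cmod (f z) \<le> (\<Sum>m. szego_coeff TYPE('n) m * q ^ m * I)"
      unfolding w(2) sums_unique[OF szego_expansion[OF f s, of w], OF order.strict_trans1[OF w(1) q(2)]]
      by (rule norm_suminf_le[OF bnd sm])
    also have "\<dots> = K * I" unfolding K_def by (rule suminf_mult2[symmetric, OF summable_szego_coeff[OF q]])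
    finally have "(cmod (f z))\<^sup>2 \<le> (K * I)\<^sup>2" by (simp add: power_mono)
    also have "\<dots> = K\<^sup>2 * I\<^sup>2" by (simp add: power_mult_distrib)
    \<comment> \<open>Cauchy-Schwarz in the form that a variance is nonnegative; the sphere has
      total mass 1.\<close>
    also have "I\<^sup>2 \<le> sphere_mean f s"
    proof -
      have "0 \<le> (\<integral>\<xi>. (cmod (f (s *\<^sub>R \<xi>)) - I)\<^sup>2 \<partial>sphere_measure)"
        by (rule Bochner_Integration.integral_nonneg) simp
      also have "\<dots> = (\<integral>\<xi>. (cmod (f (s *\<^sub>R \<xi>)))\<^sup>2 - (2 * I) * cmod (f (s *\<^sub>R \<xi>)) + I\<^sup>2 \<partial>sphere_measure)"
        by (simp add: power2_diff algebra_simps)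
      also have "\<dots> = sphere_mean f s - 2 * I * I + I\<^sup>2"
        using nn_integral_sphere_mean(1)[OF f s] i1
        by (simp add: sphere_mean_def I_def measure_sphere_measure)
      finally show ?thesis by (simp add: power2_eq_square)
    qed
    finally show "(cmod (f z))\<^sup>2 \<le> K\<^sup>2 * sphere_mean f s" using K by (simp add: mult_left_mono)
  qed
qed

section \<open>Dilation of Carleson measures for the Hardy space\<close>

lemma szego_coeff_pos: "szego_coeff TYPE('n::finite) m > 0"
proof -
  have "CARD('n) \<ge> 1" by (simp add: Suc_leI)
  then have "m \<le> CARD('n) + m - 1" by linarith
  then show ?thesis by (simp only: of_nat_0_less_iff zero_less_binomial)
qed

lemma sphere_integral_homogeneous_szego:
  fixes f :: "complex ^ 'n \<Rightarrow> complex"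
  assumes f: "holomorphic_ball f" and hom: "\<And>c z. f (c *s z) = c ^ d * f z"
  shows "(\<integral>\<xi>. f \<xi> * hip w \<xi> ^ m \<partial>sphere_measure) = (if d = m then f w / of_real (szego_coeff TYPE('n) m) else 0)"
proof -
  obtain e :: "complex ^ 'n" where e: "norm e = 1" using vec_polar_decomposition by blast
  have "sphere_moment e m = 1 / szego_coeff TYPE('n) m"
    using szego_coeff_mult_sphere_moment[OF e, of m] szego_coeff_pos[where 'n = 'n, of m] by (simp add: field_simps)
  then show ?thesis using sphere_integral_homogeneous[OF f hom e, of w m] by simp
qed

abbreviation sq_integral :: "('a \<Rightarrow> complex) \<Rightarrow> 'a measure \<Rightarrow> ennreal" where
  "sq_integral f M \<equiv> \<integral>\<^sup>+z. ennreal ((cmod (f z))\<^sup>2) \<partial>M"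

section \<open>Moments and energies with respect to a finite measure on the ball\<close>

locale ball_finite_measure = finite_measure \<nu> for \<nu> :: "(complex ^ 'n) measure" +
  assumes sets_\<nu>: "sets \<nu> = sets (restrict_space borel (ball 0 1))"
begin

lemma space_\<nu>: "space \<nu> = ball 0 1"
  using sets_eq_imp_space_eq[OF sets_\<nu>] by (simp add: space_restrict_space)

lemma id_measurable_\<nu> [measurable]: "(\<lambda>z. z) \<in> \<nu> \<rightarrow>\<^sub>M borel"
  unfolding measurable_cong_sets[OF sets_\<nu> refl] by (rule measurable_restrict_space1) simp

lemma id_measurable_sphere [measurable]: "(\<lambda>z. z) \<in> (sphere_measure :: (complex ^ 'n) measure) \<rightarrow>\<^sub>M borel"
  by (rule borel_measurable_sphere) simp

lemma cnj_measurable [measurable]: "cnj \<in> borel_measurable borel"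
  by (intro borel_measurable_continuous_onI continuous_intros)

lemma component_measurable [measurable]: "(\<lambda>z::complex^'n. z $ i) \<in> borel_measurable borel"
  by (intro borel_measurable_continuous_onI continuous_intros)

text \<open>A class of test functions on which every integral below exists, \<open>\<nu>\<close>
  being finite, and which is stable under products, conjugation and the passage to moments.\<close>

definition bdd_fun :: "(complex ^ 'n \<Rightarrow> complex) \<Rightarrow> bool" where
  "bdd_fun \<phi> \<longleftrightarrow> \<phi> \<in> borel_measurable \<nu> \<and> (\<exists>B. \<forall>z\<in>space \<nu>. cmod (\<phi> z) \<le> B)"

lemma bdd_fun_measurable: "bdd_fun \<phi> \<Longrightarrow> \<phi> \<in> borel_measurable \<nu>"
  by (simp add: bdd_fun_def)

lemma bdd_fun_integrable: "bdd_fun \<phi> \<Longrightarrow> integrable \<nu> \<phi>"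
  unfolding bdd_fun_def by (auto intro!: integrable_const_bound AE_I2)

lemma bdd_fun_mult:
  assumes "bdd_fun \<phi>" "bdd_fun \<psi>" shows "bdd_fun (\<lambda>z. \<phi> z * \<psi> z)"
proof -
  obtain B B' where B: "\<And>z. z \<in> space \<nu> \<Longrightarrow> cmod (\<phi> z) \<le> B" "\<And>z. z \<in> space \<nu> \<Longrightarrow> cmod (\<psi> z) \<le> B'"
    and [measurable]: "\<phi> \<in> borel_measurable \<nu>" "\<psi> \<in> borel_measurable \<nu>"
    using assms unfolding bdd_fun_def by blast
  have "cmod (\<phi> z * \<psi> z) \<le> B * B'" if "z \<in> space \<nu>" for z
    unfolding norm_mult using B that by (meson mult_mono norm_ge_zero order_trans)
  then show ?thesis unfolding bdd_fun_def by auto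
qed

lemma bdd_fun_cnj: "bdd_fun \<phi> \<Longrightarrow> bdd_fun (\<lambda>z. cnj (\<phi> z))"
  unfolding bdd_fun_def by auto

lemma bdd_fun_const: "bdd_fun (\<lambda>_. c)"
  unfolding bdd_fun_def by auto

lemma bdd_fun_sum: "finite I \<Longrightarrow> (\<And>i. i \<in> I \<Longrightarrow> bdd_fun (\<phi> i)) \<Longrightarrow> bdd_fun (\<lambda>z. \<Sum>i\<in>I. \<phi> i z)"
proof (induction I rule: finite_induct)
  case (insert i I)
  then obtain B B' where B: "\<And>z. z \<in> space \<nu> \<Longrightarrow> cmod (\<phi> i z) \<le> B" "\<And>z. z \<in> space \<nu> \<Longrightarrow> cmod (\<Sum>i\<in>I. \<phi> i z) \<le> B'"
    and [measurable]: "\<phi> i \<in> borel_measurable \<nu>" "(\<lambda>z. \<Sum>i\<in>I. \<phi> i z) \<in> borel_measurable \<nu>"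
    unfolding bdd_fun_def by (metis insertCI)
  have "cmod (\<phi> i z + (\<Sum>i\<in>I. \<phi> i z)) \<le> B + B'" if "z \<in> space \<nu>" for z
    using B[OF that] norm_triangle_mono by blast
  then show ?case unfolding bdd_fun_def using insert by auto
qed (simp add: bdd_fun_const)

lemma bdd_fun_component: "bdd_fun (\<lambda>z. z $ i)"
  unfolding bdd_fun_def space_\<nu>
  by (auto intro!: exI[of _ 1] order.trans[OF Finite_Cartesian_Product.norm_nth_le])

lemma bdd_fun_square_integrable: "bdd_fun \<phi> \<Longrightarrow> integrable \<nu> (\<lambda>z. (cmod (\<phi> z))\<^sup>2)"
  using integrable_norm[OF bdd_fun_integrable[OF bdd_fun_mult[of \<phi> \<phi>]]]
  by (simp add: norm_mult power2_eq_square)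

text \<open>The integral operator with kernel <x, w>^m on \<open>\<nu>\<close>. In \<open>x\<close>
  it yields a holomorphic homogeneous polynomial, the degree m part, up to
  \<open>szego_coeff\<close>, of the Szego projection of \<open>\<phi>\<close> times
  \<open>\<nu>\<close>.\<close>

definition moment :: "(complex ^ 'n \<Rightarrow> complex) \<Rightarrow> nat \<Rightarrow> complex ^ 'n \<Rightarrow> complex" where
  "moment \<phi> m x = (\<integral>w. hip x w ^ m * \<phi> w \<partial>\<nu>)"

lemma moment_integrable:
  assumes "bdd_fun \<phi>" shows "integrable \<nu> (\<lambda>w. hip x w ^ m * \<phi> w)"
proof -
  obtain B where B: "\<And>z. z \<in> space \<nu> \<Longrightarrow> cmod (\<phi> z) \<le> B"
    and [measurable]: "\<phi> \<in> borel_measurable \<nu>"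
    using assms unfolding bdd_fun_def by blast
  show ?thesis
  proof (rule integrable_const_bound[where B = "norm x ^ m * B"])
    show "AE w in \<nu>. cmod (hip x w ^ m * \<phi> w) \<le> norm x ^ m * B"
    proof (rule AE_I2)
      fix w assume w: "w \<in> space \<nu>"
      then have "norm w \<le> 1" by (simp add: space_\<nu>)
      then have "cmod (hip x w) \<le> norm x"
        using cmod_hip_le[of x w] by (meson mult_left_le norm_ge_zero order_trans)
      then show "cmod (hip x w ^ m * \<phi> w) \<le> norm x ^ m * B"
        unfolding norm_mult norm_power by (intro mult_mono power_mono B[OF w]) auto
    qed
  qed measurable
qed

text \<open>One factor <x, w> is split into coordinates: x_i leaves the integral and cnj w_i joins
  \<open>\<phi>\<close>. This drives the inductions on the degree.\<close>

lemma moment_Suc: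
  assumes "bdd_fun \<phi>"
  shows "moment \<phi> (Suc m) x = (\<Sum>i\<in>UNIV. x $ i * moment (\<lambda>w. cnj (w $ i) * \<phi> w) m x)"
proof -
  have b: "bdd_fun (\<lambda>w. cnj (w $ i) * \<phi> w)" for i
    by (intro bdd_fun_mult bdd_fun_cnj bdd_fun_component assms)
  have "moment \<phi> (Suc m) x = (\<integral>w. (\<Sum>i\<in>UNIV. x $ i * (hip x w ^ m * (cnj (w $ i) * \<phi> w))) \<partial>\<nu>)"
    unfolding moment_def
    by (intro Bochner_Integration.integral_cong refl)
       (simp add: hip_def[of x] sum_distrib_left sum_distrib_right mult_ac)
  also have "\<dots> = (\<Sum>i\<in>UNIV. (\<integral>w. x $ i * (hip x w ^ m * (cnj (w $ i) * \<phi> w)) \<partial>\<nu>))"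
    by (intro Bochner_Integration.integral_sum integrable_mult_right moment_integrable b)
  finally show ?thesis by (simp add: moment_def)
qed

lemma holomorphic_ball_moment: "bdd_fun \<phi> \<Longrightarrow> holomorphic_ball (moment \<phi> m)"
proof (induction m arbitrary: \<phi>)
  case 0
  have "moment \<phi> 0 = (\<lambda>_. \<integral>w. \<phi> w \<partial>\<nu>)" by (simp add: moment_def fun_eq_iff)
  then show ?case by (simp add: holomorphic_ball_const)
next
  case (Suc m)
  have "moment \<phi> (Suc m) = (\<lambda>x. \<Sum>i\<in>UNIV. x $ i * moment (\<lambda>w. cnj (w $ i) * \<phi> w) m x)"
    using moment_Suc[OF Suc.prems] by (simp add: fun_eq_iff)
  then show ?case
    by (auto intro!: holomorphic_ball_sum holomorphic_ball_mult holomorphic_ball_component Suc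
        bdd_fun_mult bdd_fun_cnj bdd_fun_component)
qed

lemma moment_scale: "moment \<phi> m (c *s x) = c ^ m * moment \<phi> m x"
  unfolding moment_def by (simp add: hip_scale_left power_mult_distrib mult.assoc)

lemma moment_measurable [measurable]:
  assumes "bdd_fun \<phi>" shows "moment \<phi> m \<in> borel_measurable borel"
proof -
  have [measurable]: "\<phi> \<in> borel_measurable \<nu>" using assms by (rule bdd_fun_measurable)
  have "(\<lambda>x. moment \<phi> m x) \<in> borel_measurable borel"
    unfolding moment_def by (rule borel_measurable_lebesgue_integral) measurable
  then show ?thesis by simp
qed

lemma moment_bound:
  assumes "bdd_fun \<phi>"
  shows "\<exists>B. \<forall>x. norm x \<le> 1 \<longrightarrow> cmod (moment \<phi> m x) \<le> B"
proof -
  have "cmod (moment \<phi> m x) \<le> (\<integral>w. cmod (\<phi> w) \<partial>\<nu>)" if x: "norm x \<le> 1" for x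
    unfolding moment_def
  proof (rule order_trans[OF integral_norm_bound integral_mono])
    show "cmod (hip x w ^ m * \<phi> w) \<le> cmod (\<phi> w)" if "w \<in> space \<nu>" for w
    proof -
      have "norm w \<le> 1" using that by (simp add: space_\<nu>)
      then have "cmod (hip x w) \<le> 1"
        using cmod_hip_le[of x w] x by (meson mult_le_one norm_ge_zero order_trans)
      then show ?thesis unfolding norm_mult norm_power by (simp add: mult_left_le_one_le power_le_one)
    qed
  qed (intro integrable_norm moment_integrable bdd_fun_integrable assms)+
  then show ?thesis by blast
qed

lemma bdd_fun_moment: "bdd_fun \<phi> \<Longrightarrow> bdd_fun (moment \<phi> m)"
  using moment_bound[of \<phi> m] measurable_compose[OF id_measurable_\<nu> moment_measurable[of \<phi> m]]
  unfolding bdd_fun_def space_\<nu> by force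

text \<open>Fubini as an adjoint relation: pairing with a moment on the sphere becomes pairing with
  \<open>\<phi>\<close> on \<open>\<nu>\<close>, where the reproducing formulas apply to the inner
  integral.\<close>

lemma sphere_integral_cnj_moment:
  assumes \<phi>: "bdd_fun \<phi>" and g[measurable]: "g \<in> borel_measurable sphere_measure"
    and B: "\<And>\<xi>. norm \<xi> = 1 \<Longrightarrow> cmod (g \<xi>) \<le> B"
  shows "(\<integral>\<xi>. g \<xi> * cnj (moment \<phi> m \<xi>) \<partial>sphere_measure)
    = (\<integral>w. cnj (\<phi> w) * (\<integral>\<xi>. g \<xi> * hip w \<xi> ^ m \<partial>sphere_measure) \<partial>\<nu>)"
proof -
  obtain B' where B': "\<And>z. z \<in> space \<nu> \<Longrightarrow> cmod (\<phi> z) \<le> B'"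
    and [measurable]: "\<phi> \<in> borel_measurable \<nu>"
    using \<phi> unfolding bdd_fun_def by blast
  let ?S = "sphere_measure :: (complex ^ 'n) measure"
  interpret P: pair_sigma_finite ?S \<nu> by unfold_locales
  interpret PF: finite_measure "?S \<Otimes>\<^sub>M \<nu>"
    by (intro finite_measureI) (simp add: space_pair_measure emeasure_pair_measure_Times ennreal_mult_eq_top_iff
        sphere_measure.emeasure_finite emeasure_finite del: space_sphere_measure)
  have int: "integrable (?S \<Otimes>\<^sub>M \<nu>) (\<lambda>(\<xi>, w). g \<xi> * (hip w \<xi> ^ m * cnj (\<phi> w)))"
  proof (rule PF.integrable_const_bound[where B = "B * (1 * B')"])
    show "AE p in ?S \<Otimes>\<^sub>M \<nu>. cmod (case p of (\<xi>, w) \<Rightarrow> g \<xi> * (hip w \<xi> ^ m * cnj (\<phi> w))) \<le> B * (1 * B')"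
    proof (rule AE_I2, clarsimp simp: space_pair_measure)
      fix \<xi> w :: "complex ^ 'n" assume x: "norm \<xi> = 1" and w: "w \<in> space \<nu>"
      have "cmod (hip w \<xi>) \<le> 1" using cmod_hip_le[of w \<xi>] x w by (simp add: space_\<nu>)
      then have "cmod (hip w \<xi>) ^ m * cmod (\<phi> w) \<le> 1 * B'"
        by (intro mult_mono power_le_one B'[OF w]) auto
      moreover have "0 \<le> B" using B[OF x] norm_ge_zero order_trans by blast
      ultimately show "cmod (g \<xi> * (hip w \<xi> ^ m * cnj (\<phi> w))) \<le> B * B'"
        unfolding norm_mult norm_power complex_mod_cnj using B[OF x] by (intro mult_mono) auto
    qed
  qed measurable
  have "(\<integral>\<xi>. g \<xi> * cnj (moment \<phi> m \<xi>) \<partial>?S) = (\<integral>\<xi>. (\<integral>w. g \<xi> * (hip w \<xi> ^ m * cnj (\<phi> w)) \<partial>\<nu>) \<partial>?S)"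
  proof (intro Bochner_Integration.integral_cong refl)
    fix \<xi>
    have "cnj (moment \<phi> m \<xi>) = (\<integral>w. hip w \<xi> ^ m * cnj (\<phi> w) \<partial>\<nu>)"
      unfolding moment_def Bochner_Integration.integral_cnj[symmetric] by (simp only: complex_cnj_mult complex_cnj_power cnj_hip)
    then show "g \<xi> * cnj (moment \<phi> m \<xi>) = (\<integral>w. g \<xi> * (hip w \<xi> ^ m * cnj (\<phi> w)) \<partial>\<nu>)" by simp
  qed
  also have "\<dots> = (\<integral>w. (\<integral>\<xi>. g \<xi> * (hip w \<xi> ^ m * cnj (\<phi> w)) \<partial>?S) \<partial>\<nu>)"
    by (rule P.Fubini_integral[OF int, symmetric])
  also have "\<dots> = (\<integral>w. cnj (\<phi> w) * (\<integral>\<xi>. g \<xi> * hip w \<xi> ^ m \<partial>sphere_measure) \<partial>\<nu>)"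
    unfolding integral_mult_right_zero[symmetric] by (simp only: mult_ac)
  finally show ?thesis .
qed

text \<open>The quadratic form of the kernel <z, w>^m at \<open>\<phi>\<close>, as
  \<open>integral_moment\<close> shows. Written as a norm on the sphere, it is visibly
  nonnegative.\<close>

definition energy :: "(complex ^ 'n \<Rightarrow> complex) \<Rightarrow> nat \<Rightarrow> real" where
  "energy \<phi> m = szego_coeff TYPE('n) m * (\<integral>\<xi>. (cmod (moment \<phi> m \<xi>))\<^sup>2 \<partial>sphere_measure)"

lemma energy_nonneg: "0 \<le> energy \<phi> m"
  unfolding energy_def by (intro mult_nonneg_nonneg Bochner_Integration.integral_nonneg) auto

lemma moment_sphere_measurable: "bdd_fun \<phi> \<Longrightarrow> moment \<phi> m \<in> borel_measurable sphere_measure"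
  by (intro borel_measurable_sphere moment_measurable)

text \<open>Both claims follow from the adjoint relation with g = \<open>moment \<phi> j\<close> and
  the reproducing formula for homogeneous polynomials, which kills j \<noteq> m.\<close>

lemma sphere_integral_moment_cnj_moment:
  assumes \<phi>: "bdd_fun \<phi>"
  shows "(\<integral>\<xi>. moment \<phi> j \<xi> * cnj (moment \<phi> m \<xi>) \<partial>sphere_measure) =
    (if j = m then of_real (energy \<phi> m / szego_coeff TYPE('n) m) else 0)"
    and integral_moment: "(\<integral>w. moment \<phi> m w * cnj (\<phi> w) \<partial>\<nu>) = of_real (energy \<phi> m)"
proof -
  have c: "of_real (szego_coeff TYPE('n) m) \<noteq> (0::complex)" for m
    using szego_coeff_pos[where 'n='n, of m] unfolding of_real_eq_0_iff by linarith
  have *: "(\<integral>\<xi>. moment \<phi> j \<xi> * cnj (moment \<phi> m \<xi>) \<partial>sphere_measure) =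
    (if j = m then (\<integral>w. moment \<phi> m w * cnj (\<phi> w) \<partial>\<nu>) / of_real (szego_coeff TYPE('n) m) else 0)" for j m
  proof -
    obtain B where B: "\<And>x. norm x \<le> 1 \<Longrightarrow> cmod (moment \<phi> j x) \<le> B" using moment_bound[OF \<phi>] by blast
    have "(\<integral>\<xi>. moment \<phi> j \<xi> * cnj (moment \<phi> m \<xi>) \<partial>sphere_measure) =
      (\<integral>w. cnj (\<phi> w) * (\<integral>\<xi>. moment \<phi> j \<xi> * hip w \<xi> ^ m \<partial>sphere_measure) \<partial>\<nu>)"
      by (rule sphere_integral_cnj_moment[OF \<phi> moment_sphere_measurable[OF \<phi>], of _ B]) (use B in auto)
    also have "\<dots> = (\<integral>w. (if j = m then 1 / of_real (szego_coeff TYPE('n) m) else 0) * (moment \<phi> m w * cnj (\<phi> w)) \<partial>\<nu>)"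
      by (subst sphere_integral_homogeneous_szego[OF holomorphic_ball_moment[OF \<phi>] moment_scale])
         (auto intro!: Bochner_Integration.integral_cong)
    finally show ?thesis by simp
  qed
  have "(\<integral>\<xi>. moment \<phi> m \<xi> * cnj (moment \<phi> m \<xi>) \<partial>sphere_measure) = of_real (\<integral>\<xi>. (cmod (moment \<phi> m \<xi>))\<^sup>2 \<partial>sphere_measure)" for m
    unfolding complex_norm_square[symmetric] by (rule integral_complex_of_real)
  then show i: "(\<integral>w. moment \<phi> m w * cnj (\<phi> w) \<partial>\<nu>) = of_real (energy \<phi> m)" for m
    using *[of m m] c[of m] by (simp add: energy_def field_simps)
  show "(\<integral>\<xi>. moment \<phi> j \<xi> * cnj (moment \<phi> m \<xi>) \<partial>sphere_measure) =
    (if j = m then of_real (energy \<phi> m / szego_coeff TYPE('n) m) else 0)"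
    unfolding * i by simp
qed

text \<open>Since <z, w>^(m+1) is the sum of z_i cnj w_i <z, w>^m, an extra power in the kernel
  amounts to multiplying \<open>\<phi>\<close> by conjugate coordinates. This is the elementary case
  of Schur multiplication.\<close>

lemma energy_Suc:
  assumes \<phi>: "bdd_fun \<phi>"
  shows "energy \<phi> (Suc m) = (\<Sum>i\<in>UNIV. energy (\<lambda>w. cnj (w $ i) * \<phi> w) m)"
proof -
  have b: "bdd_fun (\<lambda>w. cnj (w $ i) * \<phi> w)" for i
    by (intro bdd_fun_mult bdd_fun_cnj bdd_fun_component \<phi>)
  have "of_real (energy \<phi> (Suc m)) = (\<integral>w. (\<Sum>i\<in>UNIV. moment (\<lambda>w. cnj (w $ i) * \<phi> w) m w * cnj (cnj (w $ i) * \<phi> w)) \<partial>\<nu>)"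
    unfolding integral_moment[OF \<phi>, symmetric] moment_Suc[OF \<phi>]
    by (intro Bochner_Integration.integral_cong refl) (simp add: sum_distrib_right sum_distrib_left mult_ac)
  also have "\<dots> = (\<Sum>i\<in>UNIV. (\<integral>w. moment (\<lambda>w. cnj (w $ i) * \<phi> w) m w * cnj (cnj (w $ i) * \<phi> w) \<partial>\<nu>))"
    by (intro Bochner_Integration.integral_sum bdd_fun_integrable bdd_fun_mult[OF bdd_fun_moment[OF b] bdd_fun_cnj[OF b]])
  also have "\<dots> = of_real (\<Sum>i\<in>UNIV. energy (\<lambda>w. cnj (w $ i) * \<phi> w) m)"
    unfolding integral_moment[OF b] by simp
  finally show ?thesis unfolding of_real_eq_iff .
qed

text \<open>Moments of different degrees are orthogonal on the sphere, so only the diagonal of the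
  expanded square survives.\<close>

lemma sphere_integral_moment_sum:
  assumes \<phi>: "bdd_fun \<phi>"
  shows "(\<integral>\<xi>. (cmod (\<Sum>m\<le>L. of_real (e m) * moment \<phi> m \<xi>))\<^sup>2 \<partial>sphere_measure)
    = (\<Sum>m\<le>L. (e m)\<^sup>2 * energy \<phi> m / szego_coeff TYPE('n) m)"
proof -
  have int: "integrable sphere_measure (\<lambda>\<xi>. moment \<phi> j \<xi> * cnj (moment \<phi> m \<xi>))" for j m
  proof -
    obtain B B' where B: "\<And>x. norm x \<le> 1 \<Longrightarrow> cmod (moment \<phi> j x) \<le> B" "\<And>x. norm x \<le> 1 \<Longrightarrow> cmod (moment \<phi> m x) \<le> B'"
      using moment_bound[OF \<phi>] by metis
    have [measurable]: "moment \<phi> m \<in> borel_measurable sphere_measure" for m by (rule moment_sphere_measurable[OF \<phi>])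
    show ?thesis
    proof (rule integrable_sphere[where B = "B * B'"])
      show "cmod (moment \<phi> j \<xi> * cnj (moment \<phi> m \<xi>)) \<le> B * B'" if "norm \<xi> = 1" for \<xi>
        unfolding norm_mult complex_mod_cnj using B[of \<xi>] that
        by (intro mult_mono) (auto intro: order_trans[OF norm_ge_zero])
    qed measurable
  qed
  have "of_real (\<integral>\<xi>. (cmod (\<Sum>m\<le>L. of_real (e m) * moment \<phi> m \<xi>))\<^sup>2 \<partial>sphere_measure)
     = (\<integral>\<xi>. (\<Sum>j\<le>L. \<Sum>m\<le>L. of_real (e j * e m) * (moment \<phi> j \<xi> * cnj (moment \<phi> m \<xi>))) \<partial>sphere_measure)"
    unfolding integral_complex_of_real[symmetric]
    by (intro Bochner_Integration.integral_cong refl)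
       (simp add: complex_norm_square sum_product mult_ac del: of_real_power)
  also have "\<dots> = (\<Sum>j\<le>L. \<Sum>m\<le>L. of_real (e j * e m) * (\<integral>\<xi>. moment \<phi> j \<xi> * cnj (moment \<phi> m \<xi>) \<partial>sphere_measure))"
  proof (subst Bochner_Integration.integral_sum)
    show "(\<Sum>j\<le>L. (\<integral>\<xi>. (\<Sum>m\<le>L. of_real (e j * e m) * (moment \<phi> j \<xi> * cnj (moment \<phi> m \<xi>))) \<partial>sphere_measure))
      = (\<Sum>j\<le>L. \<Sum>m\<le>L. of_real (e j * e m) * (\<integral>\<xi>. moment \<phi> j \<xi> * cnj (moment \<phi> m \<xi>) \<partial>sphere_measure))"
      unfolding integral_mult_right_zero[symmetric]
      by (intro sum.cong refl Bochner_Integration.integral_sum integrable_mult_right int)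
  qed (intro Bochner_Integration.integrable_sum integrable_mult_right int)
  also have "\<dots> = (\<Sum>j\<le>L. \<Sum>m\<le>L. if m = j then of_real ((e m)\<^sup>2 * energy \<phi> m / szego_coeff TYPE('n) m) else 0)"
    unfolding sphere_integral_moment_cnj_moment[OF \<phi>]
    by (intro sum.cong refl) (auto simp: power2_eq_square)
  also have "\<dots> = of_real (\<Sum>m\<le>L. (e m)\<^sup>2 * energy \<phi> m / szego_coeff TYPE('n) m)"
    by (simp add: sum.delta)
  finally show ?thesis unfolding of_real_eq_iff .
qed

text \<open>Duality: the embedding is tested on the truncated Szego projection \<open>h\<close> of
  \<open>\<phi>\<close> times \<open>\<nu>\<close>. Its Hardy norm is at most \<open>S\<close>, so
  its \<open>\<nu>\<close>-norm is at most C S; but \<open>S\<close> is also the pairing of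
  \<open>h\<close> with \<open>\<phi>\<close>. The truncation at \<open>L\<close> keeps
  \<open>S\<close> finite, so that it can be absorbed.\<close>

lemma energy_carleson:
  assumes C: "C > 0"
    and H: "\<And>h. h \<in> hardy_space \<Longrightarrow> sq_integral h \<nu> \<le> ennreal C * hardy_normsq h"
    and \<phi>: "bdd_fun \<phi>"
  shows "(\<Sum>m\<le>L. szego_coeff TYPE('n) m * energy \<phi> m) \<le> C * (\<integral>z. (cmod (\<phi> z))\<^sup>2 \<partial>\<nu>)"
proof -
  define S where "S = (\<Sum>m\<le>L. szego_coeff TYPE('n) m * energy \<phi> m)"
  have S0: "S \<ge> 0" unfolding S_def by (intro sum_nonneg mult_nonneg_nonneg energy_nonneg) auto
  define h where "h = (\<lambda>x. \<Sum>m\<le>L. of_real (szego_coeff TYPE('n) m) * moment \<phi> m x)"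
  have hol: "holomorphic_ball h"
    unfolding h_def by (intro holomorphic_ball_sum holomorphic_ball_mult holomorphic_ball_const holomorphic_ball_moment \<phi>) auto
  have bh: "bdd_fun h"
    unfolding h_def by (intro bdd_fun_sum bdd_fun_mult bdd_fun_const bdd_fun_moment \<phi>) auto
  have mean: "sphere_mean h t \<le> S" if t: "0 < t" "t < 1" for t
  proof -
    have "h (t *\<^sub>R \<xi>) = (\<Sum>m\<le>L. of_real (szego_coeff TYPE('n) m * t ^ m) * moment \<phi> m \<xi>)" for \<xi>
      unfolding h_def scaleR_conv_vec_scale moment_scale by (simp add: mult.assoc)
    then have "sphere_mean h t = (\<Sum>m\<le>L. (szego_coeff TYPE('n) m * t ^ m)\<^sup>2 * energy \<phi> m / szego_coeff TYPE('n) m)"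
      unfolding sphere_mean_def using sphere_integral_moment_sum[OF \<phi>, of "\<lambda>m. szego_coeff TYPE('n) m * t ^ m" L] by simp
    also have "\<dots> \<le> S"
      unfolding S_def
    proof (rule sum_mono)
      fix m
      have "(szego_coeff TYPE('n) m * t ^ m)\<^sup>2 * energy \<phi> m / szego_coeff TYPE('n) m = (t ^ m)\<^sup>2 * (szego_coeff TYPE('n) m * energy \<phi> m)"
        using szego_coeff_pos[where 'n='n, of m] by (simp add: power2_eq_square field_simps)
      also have "\<dots> \<le> 1 * (szego_coeff TYPE('n) m * energy \<phi> m)"
        using t by (intro mult_right_mono mult_nonneg_nonneg energy_nonneg) (auto simp: power_le_one)
      finally show "(szego_coeff TYPE('n) m * t ^ m)\<^sup>2 * energy \<phi> m / szego_coeff TYPE('n) m \<le> szego_coeff TYPE('n) m * energy \<phi> m" by simp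
    qed
    finally show ?thesis .
  qed
  have norm_h: "hardy_normsq h \<le> ennreal S"
    unfolding hardy_normsq_def
    by (rule SUP_least) (use mean nn_integral_sphere_mean(2)[OF hol] in \<open>auto simp: ennreal_leI\<close>)
  then have "h \<in> hardy_space" using hol by (auto simp: hardy_space_def le_less_trans)
  from H[OF this] have "sq_integral h \<nu> \<le> ennreal C * ennreal S"
    using norm_h by (meson mult_left_mono order_trans zero_le)
  also have "sq_integral h \<nu> = ennreal (\<integral>z. (cmod (h z))\<^sup>2 \<partial>\<nu>)"
    by (intro nn_integral_eq_integral bdd_fun_square_integrable bh) auto
  finally have hC: "(\<integral>z. (cmod (h z))\<^sup>2 \<partial>\<nu>) \<le> C * S"
    using C S0 by (simp add: ennreal_mult[symmetric])
  have "of_real S = (\<Sum>m\<le>L. of_real (szego_coeff TYPE('n) m) * (\<integral>z. moment \<phi> m z * cnj (\<phi> z) \<partial>\<nu>))"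
    unfolding integral_moment[OF \<phi>] S_def by simp
  also have "\<dots> = (\<Sum>m\<le>L. (\<integral>z. of_real (szego_coeff TYPE('n) m) * (moment \<phi> m z * cnj (\<phi> z)) \<partial>\<nu>))"
    by simp
  also have "\<dots> = (\<integral>z. (\<Sum>m\<le>L. of_real (szego_coeff TYPE('n) m) * (moment \<phi> m z * cnj (\<phi> z))) \<partial>\<nu>)"
    by (intro Bochner_Integration.integral_sum[symmetric] integrable_mult_right bdd_fun_integrable bdd_fun_mult bdd_fun_moment bdd_fun_cnj \<phi>)
  also have "\<dots> = (\<integral>z. h z * cnj (\<phi> z) \<partial>\<nu>)"
    unfolding h_def by (simp add: sum_distrib_right mult.assoc)
  finally have "S = cmod (\<integral>z. h z * cnj (\<phi> z) \<partial>\<nu>)" using S0 by (metis abs_of_nonneg norm_of_real)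
  \<comment> \<open>The weights 1/C and C are chosen so that the term in \<open>h\<close>
    contributes at most S/2, to be absorbed on the left.\<close>
  also have "\<dots> \<le> (\<integral>z. ((cmod (h z))\<^sup>2 / C + C * (cmod (\<phi> z))\<^sup>2) / 2 \<partial>\<nu>)"
  proof (rule order_trans[OF integral_norm_bound integral_mono])
    show "integrable \<nu> (\<lambda>z. cmod (h z * cnj (\<phi> z)))"
      by (intro integrable_norm bdd_fun_integrable bdd_fun_mult bdd_fun_cnj bh \<phi>)
    show "integrable \<nu> (\<lambda>z. ((cmod (h z))\<^sup>2 / C + C * (cmod (\<phi> z))\<^sup>2) / 2)"
      using bdd_fun_square_integrable[OF bh] bdd_fun_square_integrable[OF \<phi>] by simp
    show "cmod (h z * cnj (\<phi> z)) \<le> ((cmod (h z))\<^sup>2 / C + C * (cmod (\<phi> z))\<^sup>2) / 2" for z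
    proof -
      have "0 \<le> (cmod (h z) - C * cmod (\<phi> z))\<^sup>2 / C" using C by simp
      then show ?thesis using C by (simp add: norm_mult power2_eq_square field_simps)
    qed
  qed
  also have "\<dots> = ((\<integral>z. (cmod (h z))\<^sup>2 \<partial>\<nu>) / C + C * (\<integral>z. (cmod (\<phi> z))\<^sup>2 \<partial>\<nu>)) / 2"
    using bdd_fun_square_integrable[OF bh] bdd_fun_square_integrable[OF \<phi>] by simp
  also have "\<dots> \<le> (S + C * (\<integral>z. (cmod (\<phi> z))\<^sup>2 \<partial>\<nu>)) / 2"
    using hC C by (simp add: divide_le_eq mult.commute)
  finally show ?thesis unfolding S_def[symmetric] by simp
qed

end

section \<open>The Schur multiplier and dilation of the embedding\<close>

definition schur_fps :: "real \<Rightarrow> real fps" where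
  "schur_fps q = Abs_fps (\<lambda>j. case j of 0 \<Rightarrow> 1 | Suc i \<Rightarrow> (q - 1) * q ^ i)"

text \<open>This identifies the series as (1 - x) / (1 - q x). With q = 1 / s^2 its n-th power is
  the quotient of the Szego kernels of the balls of radius s and 1.\<close>

lemma schur_fps_mult: "schur_fps q * (1 - fps_const q * fps_X) = 1 - fps_X"
proof (rule fps_ext)
  fix m
  have "schur_fps q * (1 - fps_const q * fps_X) = schur_fps q - fps_const q * (fps_X * schur_fps q)"
    by (simp add: algebra_simps)
  then have "fps_nth (schur_fps q * (1 - fps_const q * fps_X)) m =
      fps_nth (schur_fps q) m - q * (if m = 0 then 0 else fps_nth (schur_fps q) (m - 1))"
    by simp
  then show "fps_nth (schur_fps q * (1 - fps_const q * fps_X)) m = fps_nth (1 - fps_X) m"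
    by (cases m; cases "m - 1") (auto simp: schur_fps_def)
qed

lemma schur_fps_nonneg: "q \<ge> 1 \<Longrightarrow> fps_nth (schur_fps q) j \<ge> 0"
  by (simp add: schur_fps_def split: nat.split)

lemma sum_schur_fps_le:
  assumes q: "q \<ge> 1" and x: "x \<ge> 0" "q * x < 1"
  shows "(\<Sum>j\<le>L. fps_nth (schur_fps q) j * x ^ j) \<le> (1 - x) / (1 - q * x)"
proof -
  \<comment> \<open>An extra nonnegative term allows the constant term to be split off for every
    \<open>L\<close>; what remains is geometric.\<close>
  have "(\<Sum>j\<le>L. fps_nth (schur_fps q) j * x ^ j) \<le> (\<Sum>j\<le>Suc L. fps_nth (schur_fps q) j * x ^ j)"
    using schur_fps_nonneg[OF q] x by simp
  also have "\<dots> = 1 + (\<Sum>j\<le>L. (q - 1) * x * (q * x) ^ j)"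
    unfolding sum.atMost_Suc_shift by (simp add: schur_fps_def power_mult_distrib mult_ac)
  also have "\<dots> = 1 + (q - 1) * x * (\<Sum>j<Suc L. (q * x) ^ j)"
    by (simp only: sum_distrib_left lessThan_Suc_atMost)
  also have "\<dots> \<le> 1 + (q - 1) * x * (1 / (1 - q * x))"
  proof -
    have "(1 - q * x) * (\<Sum>j<Suc L. (q * x) ^ j) = 1 - (q * x) ^ Suc L"
      by (rule one_diff_power_eq[symmetric])
    also have "\<dots> \<le> 1" using q x by simp
    finally have "(\<Sum>j<Suc L. (q * x) ^ j) \<le> 1 / (1 - q * x)" using x by (simp add: field_simps)
    then show ?thesis using q x by (intro add_left_mono mult_left_mono) auto
  qed
  also have "\<dots> = (1 - x) / (1 - q * x)" using x by (simp add: field_simps)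
  finally show ?thesis .
qed

context ball_finite_measure
begin

text \<open>The \<open>L\<^sup>2(\<nu>)\<close> operator with kernel \<open>\<Sum>m. b m \<langle>z, w\<rangle>^m\<close> has norm at most \<open>d\<close>.\<close>

definition kernel_bound :: "real fps \<Rightarrow> real \<Rightarrow> bool" where
  "kernel_bound b d \<longleftrightarrow> (\<forall>\<phi> L. bdd_fun \<phi> \<longrightarrow>
     (\<Sum>m\<le>L. fps_nth b m * energy \<phi> m) \<le> d * (\<integral>z. (cmod (\<phi> z))\<^sup>2 \<partial>\<nu>))"

text \<open>Each application of \<open>energy_Suc\<close> replaces \<open>\<phi>\<close> by the
  functions cnj w_i \<phi>, whose squared norms add up to the integral of |w|^2 |\<phi>|^2, at most
  R^2 times the original.\<close>

lemma kernel_bound_shift: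
  assumes kb: "kernel_bound b d" and d: "d \<ge> 0" and R: "AE z in \<nu>. norm z \<le> R" "R \<ge> 0"
  shows "bdd_fun \<phi> \<Longrightarrow> (\<Sum>m\<le>L. fps_nth b m * energy \<phi> (m + j)) \<le> d * (R\<^sup>2) ^ j * (\<integral>z. (cmod (\<phi> z))\<^sup>2 \<partial>\<nu>)"
proof (induction j arbitrary: \<phi>)
  case 0
  then show ?case using kb by (simp add: kernel_bound_def)
next
  case (Suc j)
  let ?\<phi> = "\<lambda>i w. cnj (w $ i) * \<phi> w"
  have b: "bdd_fun (?\<phi> i)" for i
    by (intro bdd_fun_mult bdd_fun_cnj bdd_fun_component Suc)
  have "(\<Sum>m\<le>L. fps_nth b m * energy \<phi> (m + Suc j)) = (\<Sum>i\<in>UNIV. \<Sum>m\<le>L. fps_nth b m * energy (?\<phi> i) (m + j))"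
    unfolding add_Suc_right energy_Suc[OF Suc.prems] sum_distrib_left by (rule sum.swap)
  also have "\<dots> \<le> (\<Sum>i\<in>UNIV. d * (R\<^sup>2) ^ j * (\<integral>z. (cmod (?\<phi> i z))\<^sup>2 \<partial>\<nu>))"
    by (intro sum_mono Suc.IH b)
  also have "\<dots> = d * (R\<^sup>2) ^ j * (\<integral>z. (\<Sum>i\<in>UNIV. (cmod (?\<phi> i z))\<^sup>2) \<partial>\<nu>)"
    by (subst Bochner_Integration.integral_sum) (auto intro: bdd_fun_square_integrable b simp: sum_distrib_left)
  also have "\<dots> \<le> d * (R\<^sup>2) ^ j * (\<integral>z. R\<^sup>2 * (cmod (\<phi> z))\<^sup>2 \<partial>\<nu>)"
  proof (intro mult_left_mono integral_mono_AE)
    show "AE z in \<nu>. (\<Sum>i\<in>UNIV. (cmod (?\<phi> i z))\<^sup>2) \<le> R\<^sup>2 * (cmod (\<phi> z))\<^sup>2"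
      using R(1)
    proof eventually_elim
      case (elim z)
      have "(\<Sum>i\<in>UNIV. (cmod (?\<phi> i z))\<^sup>2) = (norm z)\<^sup>2 * (cmod (\<phi> z))\<^sup>2"
        by (simp add: norm_vec_power2 norm_mult power_mult_distrib sum_distrib_right)
      then show ?case using elim by (simp add: mult_right_mono power_mono)
    qed
    show "integrable \<nu> (\<lambda>z. \<Sum>i\<in>UNIV. (cmod (?\<phi> i z))\<^sup>2)"
      by (intro Bochner_Integration.integrable_sum bdd_fun_square_integrable b)
    show "integrable \<nu> (\<lambda>z. R\<^sup>2 * (cmod (\<phi> z))\<^sup>2)"
      by (intro integrable_mult_right bdd_fun_square_integrable Suc)
  qed (use d in auto)
  finally show ?case by (simp add: mult_ac)
qed

text \<open>The Cauchy product is regrouped by the degree \<open>j\<close> taken from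
  \<open>c\<close>; each group is a shifted kernel with bound d R^(2j). Nonnegativity of the
  coefficients of \<open>c\<close> lets these bounds be added, which costs the factor
  \<open>G\<close>.\<close>

lemma kernel_bound_mult:
  assumes kb: "kernel_bound b d" and d: "d \<ge> 0" and R: "AE z in \<nu>. norm z \<le> R" "R \<ge> 0"
    and c: "\<And>j. fps_nth c j \<ge> 0" and G: "\<And>L. (\<Sum>j\<le>L. fps_nth c j * (R\<^sup>2) ^ j) \<le> G"
  shows "kernel_bound (b * c) (d * G)"
  unfolding kernel_bound_def
proof (intro allI impI)
  fix \<phi> L assume \<phi>: "bdd_fun \<phi>"
  let ?N = "\<integral>z. (cmod (\<phi> z))\<^sup>2 \<partial>\<nu>"
  have "?N \<ge> 0" by (intro Bochner_Integration.integral_nonneg) auto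
  have "(\<Sum>k\<le>L. fps_nth (b * c) k * energy \<phi> k) =
      (\<Sum>k\<le>L. \<Sum>j\<le>k. fps_nth c j * (fps_nth b (k - j) * energy \<phi> (k - j + j)))"
  proof (rule sum.cong[OF refl])
    fix k
    have "fps_nth (b * c) k = (\<Sum>j\<le>k. fps_nth c j * fps_nth b (k - j))"
      unfolding mult.commute[of b c] fps_mult_nth by (simp add: atMost_atLeast0)
    then show "fps_nth (b * c) k * energy \<phi> k = (\<Sum>j\<le>k. fps_nth c j * (fps_nth b (k - j) * energy \<phi> (k - j + j)))"
      by (simp add: sum_distrib_right mult.assoc)
  qed
  also have "\<dots> = (\<Sum>(j, m)\<in>{(j, m). j + m \<le> L}. fps_nth c j * (fps_nth b m * energy \<phi> (m + j)))"
    by (rule sum.triangle_reindex_eq[symmetric])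
  also have "{(j, m). j + m \<le> L} = Sigma {..L} (\<lambda>j. {..L - j})" by auto
  also have "(\<Sum>(j, m)\<in>Sigma {..L} (\<lambda>j. {..L - j}). fps_nth c j * (fps_nth b m * energy \<phi> (m + j)))
      = (\<Sum>j\<le>L. fps_nth c j * (\<Sum>m\<le>L - j. fps_nth b m * energy \<phi> (m + j)))"
    by (simp add: sum.Sigma[symmetric] sum_distrib_left)
  also have "\<dots> \<le> (\<Sum>j\<le>L. fps_nth c j * (d * (R\<^sup>2) ^ j * ?N))"
    by (intro sum_mono mult_left_mono kernel_bound_shift kb d R c \<phi>)
  also have "\<dots> = (\<Sum>j\<le>L. fps_nth c j * (R\<^sup>2) ^ j) * (d * ?N)"
    unfolding sum_distrib_right by (intro sum.cong refl) (simp only: mult_ac)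
  also have "\<dots> \<le> G * (d * ?N)"
    using \<open>?N \<ge> 0\<close> d by (intro mult_right_mono G) auto
  finally show "(\<Sum>k\<le>L. fps_nth (b * c) k * energy \<phi> k) \<le> d * G * ?N" by (simp add: mult_ac)
qed

text \<open>Multiplying the kernel n times by the Schur factor turns the bound for the unit ball
  into one for the Szego kernel of the ball of radius \<open>s\<close>. Duality is then run
  backwards: the square norm of \<open>f\<close> is the limit of pairings of \<open>f\<close> on the
  sphere of radius \<open>s\<close> with polynomials whose sphere norms that bound controls.\<close>

lemma carleson_dilation:
  assumes C: "C > 0"
    and H: "\<And>h. h \<in> hardy_space \<Longrightarrow> sq_integral h \<nu> \<le> ennreal C * hardy_normsq h"
    and R: "AE z in \<nu>. norm z \<le> R" "R \<ge> 0" "R < s" and s: "s < 1"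
    and f: "holomorphic_ball f"
  shows "sq_integral f \<nu>
    \<le> ennreal (C * ((1 - R\<^sup>2) / (1 - R\<^sup>2 / s\<^sup>2)) ^ CARD('n) * sphere_mean f s)"
proof -
  define n where "n = CARD('n)"
  have n: "n > 0" by (simp add: n_def)
  have s0: "s > 0" using R by simp
  define q where "q = 1 / s\<^sup>2"
  have s2: "s\<^sup>2 < 1" "R\<^sup>2 < s\<^sup>2" "s\<^sup>2 > 0" using s R s0 by (simp_all add: power_less_one_iff power_strict_mono)
  have q: "q \<ge> 1" "q * R\<^sup>2 < 1" using s2 by (simp_all add: q_def divide_simps)
  define D where "D = (1 - R\<^sup>2) / (1 - q * R\<^sup>2)"
  have D: "D > 0" using q s2 by (simp add: D_def)
  define K where "K = C * D ^ n"
  have K: "K > 0" using C D by (simp add: K_def)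
  \<comment> \<open>The binomial series: the coefficients of (1 - X)^(-n) are the
    \<open>szego_coeff\<close>.\<close>
  define a :: "real fps" where "a = inverse ((1 - fps_X) ^ n)"
  have a: "fps_nth a m = szego_coeff TYPE('n) m" for m
    using one_minus_const_fps_X_neg_power'[OF n, of "1::real"] by (simp add: a_def n_def)
  have kb: "kernel_bound (a * schur_fps q ^ i) (C * D ^ i)" for i
  proof (induction i)
    case 0
    then show ?case
      unfolding kernel_bound_def using energy_carleson[OF C H] by (simp add: a)
  next
    case (Suc i)
    have "kernel_bound (a * schur_fps q ^ i * schur_fps q) (C * D ^ i * D)"
      by (rule kernel_bound_mult[OF Suc _ R(1,2)])
         (use C D q sum_schur_fps_le[OF q(1), of "R\<^sup>2"] schur_fps_nonneg[OF q(1)] in \<open>auto simp: D_def\<close>)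
    then show ?case by (simp add: mult_ac)
  qed
  \<comment> \<open>The numerators (1 - X)^n cancel against \<open>a\<close>, which leaves the
    binomial series in q X with coefficients \<open>szego_coeff\<close> times q^m.\<close>
  have "a * schur_fps q ^ n = inverse ((1 - fps_const q * fps_X) ^ n)"
  proof -
    have "fps_nth (1 - fps_const q * fps_X) 0 \<noteq> (0::real)" "fps_nth (1 - fps_X) 0 \<noteq> (0::real)" by simp_all
    then have nz: "fps_nth ((1 - fps_const q * fps_X) ^ n) 0 \<noteq> (0::real)" "fps_nth ((1 - fps_X) ^ n) 0 \<noteq> (0::real)"
      by (simp_all add: fps_nth_power_0)
    have "a * schur_fps q ^ n * (1 - fps_const q * fps_X) ^ n = a * (1 - fps_X) ^ n"
      by (simp add: mult.assoc power_mult_distrib[symmetric] schur_fps_mult)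
    also have "\<dots> = 1" unfolding a_def using nz(2) by (rule inverse_mult_eq_1)
    finally have "(1 - fps_const q * fps_X) ^ n * (a * schur_fps q ^ n) = 1" by (simp add: mult.commute)
    from fps_inverse_unique[OF this] show ?thesis by simp
  qed
  then have b: "fps_nth (a * schur_fps q ^ n) m = szego_coeff TYPE('n) m * q ^ m" for m
    using one_minus_const_fps_X_neg_power'[OF n, of q] by (simp add: n_def)
  have KB: "(\<Sum>m\<le>L. szego_coeff TYPE('n) m * q ^ m * energy \<phi> m) \<le> K * (\<integral>z. (cmod (\<phi> z))\<^sup>2 \<partial>\<nu>)" if "bdd_fun \<phi>" for \<phi> L
    using kb[of n] that unfolding kernel_bound_def b K_def by blast
  \<comment> \<open>\<open>f\<close> may be unbounded near the unit sphere; cutting it off outside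
    |z| \<le> R, where \<open>\<nu>\<close> has no mass, gives an admissible test function.\<close>
  define \<phi> where "\<phi> = (\<lambda>z. if norm z \<le> R then f z else 0)"
  have \<phi>: "bdd_fun \<phi>"
  proof -
    have "cball 0 R \<subseteq> ball (0::complex^'n) 1" using R s by auto
    then have co: "continuous_on (cball 0 R) f" using holomorphic_ball_continuous_on[OF f] continuous_on_subset by blast
    have "(\<lambda>z. indicator (cball 0 R) z *\<^sub>R f z) \<in> borel_measurable borel"
      by (rule borel_measurable_continuous_on_indicator[OF _ co]) simp
    also have "(\<lambda>z. indicator (cball 0 R) z *\<^sub>R f z) = \<phi>" by (auto simp: \<phi>_def indicator_def)
    finally have m: "\<phi> \<in> borel_measurable \<nu>" using measurable_compose[OF id_measurable_\<nu>] by blast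
    have "bounded (f ` cball 0 R)" by (intro compact_imp_bounded compact_continuous_image co) simp
    then obtain B where "\<forall>z\<in>cball 0 R. cmod (f z) \<le> B" unfolding bounded_iff by auto
    then have "cmod (\<phi> z) \<le> max B 0" for z by (auto simp: \<phi>_def le_max_iff_disj)
    then show ?thesis using m unfolding bdd_fun_def by blast
  qed
  define N where "N = (\<integral>z. (cmod (\<phi> z))\<^sup>2 \<partial>\<nu>)"
  have f\<phi>: "AE z in \<nu>. f z = \<phi> z" using R(1) by eventually_elim (simp add: \<phi>_def)
  obtain B where B: "\<And>\<xi>. norm \<xi> = 1 \<Longrightarrow> cmod (f (s *\<^sub>R \<xi>)) \<le> B"
    using sphere_slice_measurable_bounded(2)[OF f s0 s] by blast
  have B0: "B \<ge> 0"
    by (rule order_trans[OF norm_ge_zero B[of "axis undefined 1"]]) (simp add: norm_axis_1)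
  have fm[measurable]: "(\<lambda>\<xi>. f (s *\<^sub>R \<xi>)) \<in> borel_measurable sphere_measure"
    by (rule sphere_slice_measurable_bounded[OF f s0 s])
  define I where "I = (\<lambda>m w. \<integral>\<xi>. f (s *\<^sub>R \<xi>) * hip w \<xi> ^ m \<partial>sphere_measure)"
  \<comment> \<open>The expansion recovers f(z) from w = z / s; homogeneity in \<open>w\<close>
    moves the scaling into the coefficient 1 / s^m.\<close>
  have Iscale: "I m w = of_real (s ^ m) * I m (w /\<^sub>R s)" for m w
  proof -
    have "hip w \<xi> ^ m = of_real (s ^ m) * hip (w /\<^sub>R s) \<xi> ^ m" for \<xi>
    proof -
      have "hip w \<xi> = of_real s * hip (w /\<^sub>R s) \<xi>"
        using s0 by (simp add: hip_scaleR_left mult.assoc[symmetric])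
      then show ?thesis by (metis of_real_power power_mult_distrib)
    qed
    then show ?thesis unfolding I_def integral_mult_right_zero[symmetric] by (simp only: mult_ac)
  qed
  have Ibound: "cmod (I m w) \<le> norm w ^ m * B" for m w
  proof -
    have le: "cmod (f (s *\<^sub>R \<xi>) * hip w \<xi> ^ m) \<le> norm w ^ m * B" if "norm \<xi> = 1" for \<xi>
    proof -
      have "cmod (f (s *\<^sub>R \<xi>) * hip w \<xi> ^ m) \<le> B * norm w ^ m"
        unfolding norm_mult norm_power using B[OF that] cmod_hip_le[of w \<xi>] that
        by (intro mult_mono power_mono) (auto intro: order_trans[OF norm_ge_zero])
      then show ?thesis by (simp add: mult.commute)
    qed
    have [measurable]: "(\<lambda>\<xi>. hip w \<xi> ^ m) \<in> borel_measurable sphere_measure" by (intro borel_measurable_sphere) measurable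
    have "cmod (I m w) \<le> (\<integral>\<xi>. norm w ^ m * B \<partial>(sphere_measure :: (complex ^ 'n) measure))"
      unfolding I_def
    proof (rule order_trans[OF integral_norm_bound integral_mono])
      show "integrable sphere_measure (\<lambda>\<xi>. cmod (f (s *\<^sub>R \<xi>) * hip w \<xi> ^ m))"
        by (rule integrable_sphere[where B = "norm w ^ m * B"]) (use le in auto)
    qed (use le in auto)
    then show ?thesis by (simp add: measure_sphere_measure)
  qed
  have Imeas[measurable]: "I m \<in> borel_measurable borel" for m
  proof -
    have "(\<lambda>w. I m w) \<in> borel_measurable borel"
      unfolding I_def by (rule sphere_measure.borel_measurable_lebesgue_integral) measurable
    then show ?thesis by simp
  qed
  have bI: "bdd_fun (\<lambda>w. I m w)" for m
  proof -
    have "cmod (I m w) \<le> B" if "norm w \<le> 1" for w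
      using Ibound[of m w] that mult_right_mono[OF power_le_one[of "norm w" m] B0] by simp
    then show ?thesis
      unfolding bdd_fun_def space_\<nu> using measurable_compose[OF id_measurable_\<nu> Imeas] by force
  qed
  \<comment> \<open>\<open>J L\<close> pairs the truncated expansion of \<open>f\<close> with
    \<open>\<phi>\<close> on \<open>\<nu>\<close>. Fubini turns it into a pairing with
    \<open>H L\<close> on the sphere. The coefficients 1 / s^m square to q^m, so \<open>KB\<close>
    bounds the norm of \<open>H L\<close>.\<close>
  define H where "H = (\<lambda>L \<xi>. \<Sum>m\<le>L. of_real (szego_coeff TYPE('n) m / s ^ m) * moment \<phi> m \<xi>)"
  define J where "J = (\<lambda>L. \<integral>z. (\<Sum>m\<le>L. of_real (szego_coeff TYPE('n) m / s ^ m) * I m z) * cnj (\<phi> z) \<partial>\<nu>)"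
  have M0: "sphere_mean f s \<ge> 0" by (rule sphere_mean_nonneg)
  have N0: "N \<ge> 0" unfolding N_def by (rule Bochner_Integration.integral_nonneg) simp
  have "cmod (J L) \<le> (K * sphere_mean f s + N) / 2" for L
  proof -
    have mm[measurable]: "moment \<phi> m \<in> borel_measurable sphere_measure" for m by (rule moment_sphere_measurable[OF \<phi>])
    have "\<exists>B. \<forall>m\<le>L. \<forall>x. norm x \<le> 1 \<longrightarrow> cmod (moment \<phi> m x) \<le> B m" using moment_bound[OF \<phi>] by metis
    then obtain Bm where Bm: "\<And>m x. m \<le> L \<Longrightarrow> norm x \<le> 1 \<Longrightarrow> cmod (moment \<phi> m x) \<le> Bm m" by blast
    define BH where "BH = (\<Sum>m\<le>L. szego_coeff TYPE('n) m / s ^ m * Bm m)"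
    have BH: "cmod (H L \<xi>) \<le> BH" if "norm \<xi> = 1" for \<xi>
      unfolding H_def BH_def
      by (intro order_trans[OF norm_sum] sum_mono, unfold norm_mult norm_of_real)
         (use Bm that s0 in \<open>auto intro!: divide_right_mono mult_left_mono\<close>)
    have [measurable]: "H L \<in> borel_measurable sphere_measure"
    proof -
      have "(\<lambda>\<xi>. H L \<xi>) \<in> borel_measurable sphere_measure" unfolding H_def by measurable
      then show ?thesis by simp
    qed
    have i1: "integrable sphere_measure (\<lambda>\<xi>. f (s *\<^sub>R \<xi>) * cnj (moment \<phi> m \<xi>))" if "m \<le> L" for m
      by (rule integrable_sphere[where B = "B * Bm m"], measurable, unfold norm_mult complex_mod_cnj)
         (use B Bm that in \<open>auto intro!: mult_mono intro: order_trans[OF norm_ge_zero]\<close>)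
    have i2: "integrable sphere_measure (\<lambda>\<xi>. (cmod (H L \<xi>))\<^sup>2)"
      by (rule integrable_sphere[where B = "BH\<^sup>2"]) (use BH in \<open>auto intro!: power_mono\<close>)
    have i3: "integrable sphere_measure (\<lambda>\<xi>. (cmod (f (s *\<^sub>R \<xi>)))\<^sup>2)"
      by (rule nn_integral_sphere_mean[OF f s0 s])
    have i4: "integrable sphere_measure (\<lambda>\<xi>. f (s *\<^sub>R \<xi>) * cnj (H L \<xi>))"
      by (rule integrable_sphere[where B = "B * BH"], measurable, unfold norm_mult complex_mod_cnj)
         (use B BH in \<open>auto intro!: mult_mono intro: order_trans[OF norm_ge_zero]\<close>)
    have "J L = (\<integral>z. (\<Sum>m\<le>L. of_real (szego_coeff TYPE('n) m / s ^ m) * (cnj (\<phi> z) * I m z)) \<partial>\<nu>)"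
      unfolding J_def sum_distrib_right by (simp only: mult_ac)
    also have "\<dots> = (\<Sum>m\<le>L. (\<integral>z. of_real (szego_coeff TYPE('n) m / s ^ m) * (cnj (\<phi> z) * I m z) \<partial>\<nu>))"
      by (intro Bochner_Integration.integral_sum integrable_mult_right bdd_fun_integrable bdd_fun_mult bdd_fun_cnj \<phi> bI)
    also have "\<dots> = (\<Sum>m\<le>L. (\<integral>\<xi>. of_real (szego_coeff TYPE('n) m / s ^ m) * (f (s *\<^sub>R \<xi>) * cnj (moment \<phi> m \<xi>)) \<partial>sphere_measure))"
      unfolding integral_mult_right_zero sphere_integral_cnj_moment[OF \<phi> fm B, simplified] I_def by simp
    also have "\<dots> = (\<integral>\<xi>. (\<Sum>m\<le>L. of_real (szego_coeff TYPE('n) m / s ^ m) * (f (s *\<^sub>R \<xi>) * cnj (moment \<phi> m \<xi>))) \<partial>sphere_measure)"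
      by (intro Bochner_Integration.integral_sum[symmetric] integrable_mult_right i1) auto
    also have "\<dots> = (\<integral>\<xi>. f (s *\<^sub>R \<xi>) * cnj (H L \<xi>) \<partial>sphere_measure)"
      unfolding H_def by (simp add: sum_distrib_left mult_ac)
    \<comment> \<open>The weights K and 1/K balance the two terms: the square norm of
      \<open>H L\<close> is at most K N, so N enters with the factor 1/2 and can be absorbed in the
      limit.\<close>
    finally have "cmod (J L) \<le> (\<integral>\<xi>. (K * (cmod (f (s *\<^sub>R \<xi>)))\<^sup>2 + (cmod (H L \<xi>))\<^sup>2 / K) / 2 \<partial>sphere_measure)"
    proof (elim ssubst, intro order_trans[OF integral_norm_bound integral_mono])
      show "cmod (f (s *\<^sub>R \<xi>) * cnj (H L \<xi>)) \<le> (K * (cmod (f (s *\<^sub>R \<xi>)))\<^sup>2 + (cmod (H L \<xi>))\<^sup>2 / K) / 2" for \<xi>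
      proof -
        have "0 \<le> (K * cmod (f (s *\<^sub>R \<xi>)) - cmod (H L \<xi>))\<^sup>2 / K" using K by simp
        then show ?thesis using K by (simp add: norm_mult power2_eq_square field_simps)
      qed
    qed (use i2 i3 i4 in auto)
    also have "\<dots> = (K * sphere_mean f s + (\<integral>\<xi>. (cmod (H L \<xi>))\<^sup>2 \<partial>sphere_measure) / K) / 2"
      using i2 i3 by (simp add: sphere_mean_def)
    also have "(\<integral>\<xi>. (cmod (H L \<xi>))\<^sup>2 \<partial>sphere_measure) = (\<Sum>m\<le>L. (szego_coeff TYPE('n) m / s ^ m)\<^sup>2 * energy \<phi> m / szego_coeff TYPE('n) m)"
      unfolding H_def by (rule sphere_integral_moment_sum[OF \<phi>])
    also have "\<dots> = (\<Sum>m\<le>L. szego_coeff TYPE('n) m * q ^ m * energy \<phi> m)"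
    proof (rule sum.cong[OF refl])
      fix m
      show "(szego_coeff TYPE('n) m / s ^ m)\<^sup>2 * energy \<phi> m / szego_coeff TYPE('n) m = szego_coeff TYPE('n) m * q ^ m * energy \<phi> m"
        using szego_coeff_pos[where 'n='n, of m] by (simp add: q_def power2_eq_square field_simps power_mult_distrib)
    qed
    also have "(K * sphere_mean f s + \<dots> / K) / 2 \<le> (K * sphere_mean f s + (K * N) / K) / 2"
      using KB[OF \<phi>, of L] K by (intro divide_right_mono add_left_mono) (auto simp: N_def)
    finally show ?thesis using K by simp
  qed
  moreover have "J \<longlonglongrightarrow> of_real N"
  proof -
    have R1: "R / s < 1" "0 \<le> R / s" using R s0 by auto
    \<comment> \<open>On the support |z| / s \<le> R / s < 1, so the expansion has one summable
      majorant for all z and \<open>L\<close>, as dominated convergence requires.\<close>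
    define W where "W = (\<Sum>m. szego_coeff TYPE('n) m * (R / s) ^ m * B)"
    have sW: "summable (\<lambda>m. szego_coeff TYPE('n) m * (R / s) ^ m * B)"
      by (rule summable_mult2[OF summable_szego_coeff[OF R1(2,1)]])
    have Ieq: "of_real (szego_coeff TYPE('n) m / s ^ m) * I m z = of_real (szego_coeff TYPE('n) m) * I m (z /\<^sub>R s)" for m z
      using s0 by (subst Iscale) simp
    have "(\<lambda>L. \<integral>z. (\<Sum>m\<le>L. of_real (szego_coeff TYPE('n) m / s ^ m) * I m z) * cnj (\<phi> z) \<partial>\<nu>) \<longlonglongrightarrow> (\<integral>z. \<phi> z * cnj (\<phi> z) \<partial>\<nu>)"
    proof (rule integral_dominated_convergence[where w = "\<lambda>z. W * cmod (\<phi> z)"])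
      show "(\<lambda>z. \<phi> z * cnj (\<phi> z)) \<in> borel_measurable \<nu>"
        by (intro bdd_fun_measurable bdd_fun_mult bdd_fun_cnj \<phi>)
      show "(\<lambda>z. (\<Sum>m\<le>L. of_real (szego_coeff TYPE('n) m / s ^ m) * I m z) * cnj (\<phi> z)) \<in> borel_measurable \<nu>" for L
        by (intro bdd_fun_measurable bdd_fun_mult bdd_fun_cnj \<phi> bdd_fun_sum bdd_fun_const bI) auto
      show "integrable \<nu> (\<lambda>z. W * cmod (\<phi> z))"
        by (intro integrable_mult_right integrable_norm bdd_fun_integrable \<phi>)
      show "AE z in \<nu>. (\<lambda>L. (\<Sum>m\<le>L. of_real (szego_coeff TYPE('n) m / s ^ m) * I m z) * cnj (\<phi> z)) \<longlonglongrightarrow> \<phi> z * cnj (\<phi> z)"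
        using R(1)
      proof eventually_elim
        case (elim z)
        have "norm (z /\<^sub>R s) < 1" using elim R(3) s0 by (simp add: field_simps)
        from szego_expansion[OF f s0 s this]
        have "(\<lambda>m. of_real (szego_coeff TYPE('n) m / s ^ m) * I m z) sums \<phi> z"
          unfolding Ieq using s0 elim by (simp add: I_def \<phi>_def)
        then show ?case unfolding sums_def_le by (intro tendsto_mult_right)
      qed
      show "AE z in \<nu>. cmod ((\<Sum>m\<le>L. of_real (szego_coeff TYPE('n) m / s ^ m) * I m z) * cnj (\<phi> z)) \<le> W * cmod (\<phi> z)" for L
        using R(1)
      proof eventually_elim
        case (elim z)
        have "cmod (\<Sum>m\<le>L. of_real (szego_coeff TYPE('n) m / s ^ m) * I m z) \<le> (\<Sum>m\<le>L. szego_coeff TYPE('n) m * (R / s) ^ m * B)"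
        proof (intro order_trans[OF norm_sum] sum_mono)
          fix m
          have "norm (z /\<^sub>R s) \<le> R / s" using elim s0 by (simp add: divide_simps)
          then have "cmod (I m (z /\<^sub>R s)) \<le> (R / s) ^ m * B"
            using Ibound[of m "z /\<^sub>R s"] mult_right_mono[OF power_mono[of "norm (z /\<^sub>R s)" "R / s" m] B0] by simp
          then show "cmod (of_real (szego_coeff TYPE('n) m / s ^ m) * I m z) \<le> szego_coeff TYPE('n) m * (R / s) ^ m * B"
            unfolding Ieq norm_mult norm_of_real by (simp add: mult_left_mono mult.assoc)
        qed
        also have "\<dots> \<le> W"
          unfolding W_def by (rule sum_le_suminf[OF sW]) (use R1 B0 in auto)
        finally show ?case unfolding norm_mult complex_mod_cnj by (rule mult_right_mono) simp
      qed
    qed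
    moreover have "(\<integral>z. \<phi> z * cnj (\<phi> z) \<partial>\<nu>) = of_real N"
      unfolding N_def complex_norm_square[symmetric] by (rule integral_complex_of_real)
    ultimately show ?thesis by (simp add: J_def)
  qed
  ultimately have "cmod (of_real N) \<le> (K * sphere_mean f s + N) / 2"
    by (intro Lim_bounded[OF tendsto_norm]) auto
  then have NK: "N \<le> K * sphere_mean f s" using N0 by simp
  have "sq_integral f \<nu> = sq_integral \<phi> \<nu>"
    by (intro nn_integral_cong_AE) (use f\<phi> in \<open>auto elim: eventually_mono\<close>)
  also have "\<dots> = ennreal N"
    unfolding N_def by (intro nn_integral_eq_integral bdd_fun_square_integrable \<phi>) auto
  also have "\<dots> \<le> ennreal (K * sphere_mean f s)" using NK by (rule ennreal_leI)
  finally show ?thesis by (simp add: K_def D_def q_def n_def)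
qed

end

section \<open>Weights of class S\<close>

locale class_S_weight =
  fixes n :: nat and \<rho> :: "real \<Rightarrow> real"
  assumes n: "n \<ge> 1" and class_S: "weight_class_S n \<rho>"
begin

abbreviation r :: "nat \<Rightarrow> real" where "r \<equiv> weight_point \<rho>"

lemma weight: "weight n \<rho>" using class_S by (simp add: weight_class_S_def)

lemma rho_pos: "0 \<le> x \<Longrightarrow> x < 1 \<Longrightarrow> 0 < \<rho> x"
  using weight by (simp add: weight_def)

lemma rho_set_integrable: "set_integrable lborel {0..<1} \<rho>"
  using weight by (simp add: weight_def)

lemma rho_measurable [measurable]: "(\<lambda>x. indicator {0..<1} x * \<rho> x) \<in> borel_measurable borel"
  using borel_measurable_integrable[OF rho_set_integrable[unfolded set_integrable_def]] by simp

lemma weight_point_mem: "0 \<le> r k" "r k < 1"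
  and weight_point_mass: "(LBINT x:{r k..<1}. \<rho> x) = (1 / 2) ^ k"
  using theI'[OF weight_point_exists_unique[OF weight n, of k]] by (simp_all add: weight_point_def)

lemma nn_integral_rho:
  assumes "A \<subseteq> {0..<1}" "A \<in> sets borel"
  shows "(\<integral>\<^sup>+x. ennreal (\<rho> x) * indicator A x \<partial>lborel) = ennreal (LBINT x:A. \<rho> x)"
proof -
  have "set_integrable lborel A \<rho>" using set_integrable_subset[OF rho_set_integrable] assms by simp
  then have "(\<integral>\<^sup>+x. ennreal (indicator A x *\<^sub>R \<rho> x) \<partial>lborel) = ennreal (LBINT x:A. \<rho> x)"
    unfolding set_lebesgue_integral_def set_integrable_def
    by (rule nn_integral_eq_integral) (use assms rho_pos in \<open>auto intro!: AE_I2 simp: indicator_def less_imp_le subset_eq\<close>)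
  moreover have "ennreal (indicator A x *\<^sub>R \<rho> x) = ennreal (\<rho> x) * indicator A x" for x
    by (simp add: indicator_def)
  ultimately show ?thesis by simp
qed

lemma nn_integral_rho_tail: "(\<integral>\<^sup>+x. ennreal (\<rho> x) * indicator {r k..<1} x \<partial>lborel) = ennreal ((1 / 2) ^ k)"
  using nn_integral_rho[of "{r k..<1}"] weight_point_mem[of k] by (simp add: weight_point_mass)

lemma weight_point_strict_mono: "strict_mono r"
proof (rule strict_monoI_Suc, rule ccontr)
  fix k assume "\<not> r k < r (Suc k)"
  then have "{r k..<1} \<subseteq> {r (Suc k)..<1}" by auto
  then have "(\<integral>\<^sup>+x. ennreal (\<rho> x) * indicator {r k..<1} x \<partial>lborel) \<le> (\<integral>\<^sup>+x. ennreal (\<rho> x) * indicator {r (Suc k)..<1} x \<partial>lborel)"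
    by (intro nn_integral_mono mult_left_mono) (auto simp: indicator_def)
  then show False unfolding nn_integral_rho_tail by simp
qed

lemma weight_point_pos: "k \<ge> 1 \<Longrightarrow> 0 < r k"
  using weight_point_mem(1)[of 0] strict_monoD[OF weight_point_strict_mono, of 0 k] by linarith

lemma nn_integral_rho_shell:
  "(\<integral>\<^sup>+x. ennreal (\<rho> x) * indicator {r k..<r (Suc k)} x \<partial>lborel) = ennreal ((1 / 2) ^ Suc k)"
proof -
  have lt: "r k < r (Suc k)" using weight_point_strict_mono by (simp add: strict_mono_def)
  have sub: "set_integrable lborel A \<rho>" if "A \<subseteq> {0..<1}" "A \<in> sets borel" for A
    using set_integrable_subset[OF rho_set_integrable] that by simp
  have "{r k..<1} = {r k..<r (Suc k)} \<union> {r (Suc k)..<1}"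
    using lt weight_point_mem(2)[of "Suc k"] by (simp add: ivl_disj_un)
  then have "(LBINT x:{r k..<1}. \<rho> x) = (LBINT x:{r k..<r (Suc k)}. \<rho> x) + (LBINT x:{r (Suc k)..<1}. \<rho> x)"
    using weight_point_mem[of k] weight_point_mem[of "Suc k"]
    by (simp, intro set_integral_Un sub) auto
  then have "(LBINT x:{r k..<r (Suc k)}. \<rho> x) = (1 / 2) ^ Suc k"
    unfolding weight_point_mass by simp
  moreover have "(\<integral>\<^sup>+x. ennreal (\<rho> x) * indicator {r k..<r (Suc k)} x \<partial>lborel) = ennreal (LBINT x:{r k..<r (Suc k)}. \<rho> x)"
    by (rule nn_integral_rho) (use weight_point_mem[of k] weight_point_mem[of "Suc k"] in auto)
  ultimately show ?thesis by (simp only:)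
qed

section \<open>Geometric decay of the gaps and weighted power integrals\<close>

definition ratio :: real where
  "ratio = (INF k. (1 - r k) / (1 - r (Suc k)))"

lemma ratio_gt_1: "ratio > 1"
  using class_S by (simp add: weight_class_S_def ratio_def)

lemma ratio_mult_le: "ratio * (1 - r (Suc k)) \<le> 1 - r k"
proof -
  have "ratio \<le> (1 - r k) / (1 - r (Suc k))"
    unfolding ratio_def
  proof (rule cINF_lower)
    show "bdd_below (range (\<lambda>k. (1 - r k) / (1 - r (Suc k))))"
      by (rule bdd_belowI[of _ 0]) (use weight_point_mem(2) in \<open>auto simp: less_imp_le\<close>)
  qed simp
  then show ?thesis using weight_point_mem(2)[of "Suc k"] by (simp add: field_simps)
qed

lemma ratio_power_mult_le: "ratio ^ i * (1 - r (k + i)) \<le> 1 - r k"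
proof (induction i)
  case (Suc i)
  have "ratio ^ i * (ratio * (1 - r (Suc (k + i)))) \<le> ratio ^ i * (1 - r (k + i))"
    using ratio_gt_1 by (intro mult_left_mono ratio_mult_le) auto
  with Suc show ?case by (simp add: mult_ac)
qed simp

lemma ratio_power_le: "ratio ^ k \<le> 1 / (1 - r k)"
  using ratio_power_mult_le[of k 0] weight_point_mem(1)[of 0] weight_point_mem(2)[of k] by (simp add: field_simps)

text \<open>The gaps \<open>1 - r k\<close> decay geometrically, so the points exhaust the interval.
  An index of at least 1 is delivered because the shell estimates need a positive inner
  radius.\<close>

lemma exists_weight_point_gt:
  assumes "R < 1" shows "\<exists>k\<ge>1. R < r k"
proof -
  obtain k where k: "1 / (1 - R) < ratio ^ k" using real_arch_pow[OF ratio_gt_1] by blast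
  have "ratio ^ k \<le> ratio ^ Suc k" using ratio_gt_1 by (intro power_increasing) auto
  then have "1 / (1 - R) < 1 / (1 - r (Suc k))" using k ratio_power_le[of "Suc k"] by linarith
  then have "R < r (Suc k)" using assms weight_point_mem(2)[of "Suc k"] by (simp add: divide_simps split: if_splits)
  then show ?thesis by (intro exI[of _ "Suc k"]) auto
qed

text \<open>The degree of the monomial multipliers, hence a lower bound for the order of vanishing
  at the origin of the products.\<close>

definition vorder :: "nat \<Rightarrow> nat" where
  "vorder k = nat \<lceil>1 / (1 - r k)\<rceil>"

lemma vorder_bounds: "1 / (1 - r k) \<le> real (vorder k)" "real (vorder k) \<le> 2 / (1 - r k)" "ratio ^ k \<le> real (vorder k)"
proof -
  \<comment> \<open>A number that is at least 1 is at most doubled by rounding up; this gives the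
    constant 2.\<close>
  have 1: "1 / (1 - r k) \<ge> 1" using weight_point_mem[of k] by (simp add: field_simps)
  then have "real (vorder k) = of_int \<lceil>1 / (1 - r k)\<rceil>" unfolding vorder_def by simp
  then show *: "1 / (1 - r k) \<le> real (vorder k)" and "real (vorder k) \<le> 2 / (1 - r k)"
    using 1 by linarith+
  show "ratio ^ k \<le> real (vorder k)" using ratio_power_le[of k] * by linarith
qed

text \<open>From -ln r \<le> (1 - r) / r and 2m \<le> 4 / (1 - r), the logarithm is at least -4 / r.
  For k \<ge> 1 the divisor is bounded below by \<open>r 1\<close> > 0, which makes the bound
  uniform.\<close>

lemma weight_point_power_ge:
  assumes k: "k \<ge> 1"
  shows "exp (- 4 / r 1) \<le> r k ^ (2 * vorder k)"
proof -
  have rk: "0 < r 1" "r 1 \<le> r k" "r k < 1" "0 < r k"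
    using weight_point_pos[of 1] weight_point_pos[OF k] weight_point_mem[of k] k weight_point_strict_mono
    by (auto simp: strict_mono_less_eq)
  have "ln (1 / r k) \<le> 1 / r k - 1" using rk by (intro ln_le_minus_one) auto
  then have l: "- ln (r k) \<le> (1 - r k) / r k" using rk by (simp add: ln_div diff_divide_distrib)
  have "real (2 * vorder k) * (- ln (r k)) \<le> (4 / (1 - r k)) * ((1 - r k) / r k)"
    using vorder_bounds(2)[of k] l rk by (intro mult_mono) auto
  also have "\<dots> = 4 / r k"
  proof -
    have "(a / b) * (b / c) = a / c" if "b \<noteq> 0" for a b c :: real using that by simp
    then show ?thesis using rk by (metis diff_gt_0_iff_gt less_numeral_extra(3))
  qed
  also have "\<dots> \<le> 4 / r 1" using rk by (intro divide_left_mono) auto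
  finally have "- 4 / r 1 \<le> real (2 * vorder k) * ln (r k)" by simp
  then have "exp (- 4 / r 1) \<le> exp (real (2 * vorder k) * ln (r k))" by simp
  also have "\<dots> = r k ^ (2 * vorder k)" using rk by (subst exp_of_nat_mult) simp
  finally show ?thesis .
qed

lemma exp_neg_le_power: "0 < p \<Longrightarrow> 0 < y \<Longrightarrow> exp (- y) \<le> (real p / y) ^ p"
proof -
  assume p: "0 < p" and y: "0 < (y :: real)"
  have "y / real p \<le> exp (y / real p)" using exp_ge_add_one_self[of "y / real p"] by linarith
  then have "(y / real p) ^ p \<le> exp (y / real p) ^ p" using y by (intro power_mono) auto
  also have "\<dots> = exp y" using p by (simp add: exp_of_nat_mult[symmetric])
  finally have "inverse (exp y) \<le> inverse ((y / real p) ^ p)"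
    using p y by (intro le_imp_inverse_le) auto
  then show ?thesis by (simp add: exp_minus power_inverse[symmetric])
qed

text \<open>Going down i shells multiplies the gap by at least \<open>ratio ^ i\<close>, so the
  power is at most exp(- ratio^i). Any geometric rate follows; 1/4 is chosen because the \<rho>-mass
  grows only by the factor 2 per shell.\<close>

lemma weight_point_power_le:
  "\<exists>P>0. \<forall>k i. i \<le> k \<longrightarrow> r (k - i) ^ (2 * vorder k) \<le> P * (1 / 4) ^ i"
proof -
  \<comment> \<open>The bound exp(-y) \<le> (p / y)^p at y = \<open>ratio ^ i\<close> decays like
    ratio^(-p i), which beats 4^(-i) for this \<open>p\<close>.\<close>
  obtain p where p: "4 < ratio ^ p" using real_arch_pow[OF ratio_gt_1] by blast
  then have p0: "p > 0" by (cases p) auto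
  show ?thesis
  proof (intro exI[of _ "real p ^ p"] conjI allI impI)
    show "real p ^ p > 0" using p0 by simp
    fix k i :: nat assume i: "i \<le> k"
    define x where "x = r (k - i)"
    have x: "0 \<le> x" "x < 1" using weight_point_mem by (auto simp: x_def)
    have "ratio ^ i * (1 - r k) \<le> 1 - x" using ratio_power_mult_le[of i "k - i"] i by (simp add: x_def)
    then have "ratio ^ i * (1 - r k) * real (vorder k) \<le> (1 - x) * real (vorder k)"
      by (intro mult_right_mono) auto
    moreover have "ratio ^ i * 1 \<le> ratio ^ i * ((1 - r k) * real (vorder k))"
      using vorder_bounds(1)[of k] weight_point_mem(2)[of k] ratio_gt_1
      by (intro mult_left_mono) (auto simp: field_simps)
    ultimately have y: "ratio ^ i \<le> (1 - x) * real (vorder k)" by (simp add: mult.assoc)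
    have "x ^ (2 * vorder k) \<le> exp (x - 1) ^ (2 * vorder k)"
      using x exp_ge_add_one_self[of "x - 1"] by (intro power_mono) auto
    also have "\<dots> = exp (real (2 * vorder k) * (x - 1))" by (rule exp_of_nat_mult[symmetric])
    also have "\<dots> \<le> exp (- (ratio ^ i))"
    proof -
      have "0 \<le> (1 - x) * real (vorder k)" using x by simp
      then have "real (2 * vorder k) * (x - 1) \<le> - (ratio ^ i)" using y by (simp add: algebra_simps)
      then show ?thesis by simp
    qed
    also have "\<dots> \<le> (real p / ratio ^ i) ^ p"
      using ratio_gt_1 p0 by (intro exp_neg_le_power) auto
    also have "\<dots> = real p ^ p * (1 / (ratio ^ p)) ^ i"
      by (simp add: power_divide power_mult[symmetric] mult.commute)
    also have "\<dots> \<le> real p ^ p * (1 / 4) ^ i"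
      using p by (intro mult_left_mono power_mono divide_left_mono) auto
    finally show "r (k - i) ^ (2 * vorder k) \<le> real p ^ p * (1 / 4) ^ i" by (simp add: x_def)
  qed
qed

text \<open>The part beyond \<open>r k\<close> has mass 2^-k. Below it, the decay 4^-i of the power
  on the i-th shell down outweighs the growth 2^i of the mass.\<close>

lemma nn_integral_power_rho_le:
  "\<exists>C>0. \<forall>k. (\<integral>\<^sup>+x. ennreal (x ^ (2 * vorder k) * \<rho> x) * indicator {0..<1} x \<partial>lborel) \<le> ennreal (C * (1 / 2) ^ k)"
proof -
  obtain P where P: "P > 0" "\<And>k i. i \<le> k \<Longrightarrow> r (k - i) ^ (2 * vorder k) \<le> P * (1 / 4) ^ i"
    using weight_point_power_le by blast
  define T where "T = (LBINT x:{0..<1}. \<rho> x)"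
  have T0: "T \<ge> 0"
    unfolding T_def set_lebesgue_integral_def
    by (rule Bochner_Integration.integral_nonneg) (use rho_pos in \<open>auto simp: indicator_def less_imp_le\<close>)
  have Tn: "(\<integral>\<^sup>+x. ennreal (\<rho> x) * indicator {0..<1} x \<partial>lborel) = ennreal T"
    unfolding T_def by (rule nn_integral_rho) auto
  show ?thesis
  \<comment> \<open>The three terms stem from the region below \<open>r 0\<close>, the shells
    between \<open>r 0\<close> and \<open>r k\<close>, and the tail beyond
    \<open>r k\<close>.\<close>
  proof (intro exI[of _ "P * T + 4 * P + 1"] conjI allI)
    show "P * T + 4 * P + 1 > 0" using P T0 by (simp add: add_nonneg_pos)
    fix k
    define m where "m = vorder k"
    define G where "G = (\<lambda>x. ennreal (\<rho> x) * indicator {0..<1} x)"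
    have [measurable]: "G \<in> borel_measurable borel"
    proof -
      have "(\<lambda>x. ennreal (indicator {0..<1} x * \<rho> x)) \<in> borel_measurable borel" by measurable
      also have "(\<lambda>x. ennreal (indicator {0..<1} x * \<rho> x)) = G" by (auto simp: G_def indicator_def)
      finally show ?thesis .
    qed
    have Gt: "G x * indicator {r j..<1} x = ennreal (\<rho> x) * indicator {r j..<1} x" for j x
      using weight_point_mem(1)[of j] by (auto simp: G_def indicator_def)
    \<comment> \<open>On each shell the power is replaced by its value at the outer endpoint, and
      the shell is enlarged to the tail from \<open>r j\<close>, whose mass is exactly 2^-j.\<close>
    have pw: "ennreal (x ^ (2 * m) * \<rho> x) * indicator {0..<1} x \<le>
        ennreal (r 0 ^ (2 * m)) * G x + (\<Sum>j<k. ennreal (r (Suc j) ^ (2 * m)) * (G x * indicator {r j..<1} x)) + G x * indicator {r k..<1} x" for x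
    proof (cases "x \<in> {0..<1}")
      case True
      have e: "ennreal (x ^ (2 * m) * \<rho> x) * indicator {0..<1} x = ennreal (x ^ (2 * m)) * G x"
        using True rho_pos[of x] by (simp add: G_def ennreal_mult less_imp_le)
      consider "x < r 0" | "x \<ge> r k" | j where "j < k" "r j \<le> x" "x < r (Suc j)"
      proof (cases "x < r 0 \<or> x \<ge> r k")
        case False
        define j where "j = (LEAST j. x < r (Suc j))"
        have ex: "x < r (Suc (k - 1))" using False by (cases k) auto
        have lt: "x < r (Suc j)" unfolding j_def by (rule LeastI[of _ "k - 1"]) (rule ex)
        have "r j \<le> x"
        proof (cases j)
          case (Suc i)
          then have "\<not> x < r (Suc i)" using not_less_Least[of i "\<lambda>j. x < r (Suc j)"] by (simp add: j_def)
          then show ?thesis using Suc by simp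
        qed (use False in auto)
        moreover have "j < k"
        proof (rule ccontr)
          assume "\<not> j < k"
          then have "r k \<le> r j" using weight_point_strict_mono by (simp add: strict_mono_less_eq)
          then show False using \<open>r j \<le> x\<close> False by auto
        qed
        ultimately show ?thesis using that(3) lt by blast
      qed (use that in auto)
      then show ?thesis
      proof cases
        case 1
        then have "ennreal (x ^ (2 * m)) * G x \<le> ennreal (r 0 ^ (2 * m)) * G x"
          using True by (intro mult_right_mono ennreal_leI power_mono) auto
        then show ?thesis unfolding e by (simp add: add_increasing2 order_trans)
      next
        case 2
        then have "ennreal (x ^ (2 * m)) * G x \<le> G x * indicator {r k..<1} x"
          using True by (simp add: mult_left_le power_le_one mult.commute)
        then show ?thesis unfolding e by (simp add: add_increasing)
      next
        case 3
        then have "ennreal (x ^ (2 * m)) * G x \<le> ennreal (r (Suc j) ^ (2 * m)) * (G x * indicator {r j..<1} x)"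
          using True by (simp, intro mult_right_mono ennreal_leI power_mono) auto
        also have "\<dots> \<le> (\<Sum>j<k. ennreal (r (Suc j) ^ (2 * m)) * (G x * indicator {r j..<1} x))"
          by (rule member_le_sum) (use 3 in auto)
        finally show ?thesis unfolding e by (simp add: add_increasing add_increasing2)
      qed
    qed simp
    have "(\<integral>\<^sup>+x. ennreal (x ^ (2 * m) * \<rho> x) * indicator {0..<1} x \<partial>lborel) \<le>
        (\<integral>\<^sup>+x. ennreal (r 0 ^ (2 * m)) * G x + (\<Sum>j<k. ennreal (r (Suc j) ^ (2 * m)) * (G x * indicator {r j..<1} x)) + G x * indicator {r k..<1} x \<partial>lborel)"
      by (intro nn_integral_mono pw)
    also have "\<dots> = ennreal (r 0 ^ (2 * m)) * ennreal T + (\<Sum>j<k. ennreal (r (Suc j) ^ (2 * m)) * ennreal ((1 / 2) ^ j)) + ennreal ((1 / 2) ^ k)"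
    proof -
      have "(\<integral>\<^sup>+x. G x * indicator {r j..<1} x \<partial>lborel) = ennreal ((1 / 2) ^ j)" for j
        unfolding Gt by (rule nn_integral_rho_tail)
      moreover have "(\<integral>\<^sup>+x. G x \<partial>lborel) = ennreal T" unfolding G_def by (rule Tn)
      ultimately show ?thesis by (simp add: nn_integral_add nn_integral_sum nn_integral_cmult)
    qed
    also have "\<dots> = ennreal (r 0 ^ (2 * m) * T + (\<Sum>j<k. r (Suc j) ^ (2 * m) * (1 / 2) ^ j) + (1 / 2) ^ k)"
      using T0 weight_point_mem(1) by (simp add: ennreal_mult[symmetric] sum_nonneg ennreal_plus[symmetric] del: ennreal_plus)
    also have "\<dots> \<le> ennreal ((P * T + 4 * P + 1) * (1 / 2) ^ k)"
    proof (rule ennreal_leI)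
      have "r 0 ^ (2 * m) \<le> P * (1 / 4) ^ k" using P(2)[of k k] by (simp add: m_def)
      also have "\<dots> \<le> P * (1 / 2) ^ k" using P(1) by (intro mult_left_mono power_mono) auto
      finally have a: "r 0 ^ (2 * m) * T \<le> P * (1 / 2) ^ k * T" using T0 by (rule mult_right_mono)
      \<comment> \<open>Counting from the top, j = k - 1 - i: the outer endpoint of the shell is
        then \<open>r (k - i)\<close>, as in the decay estimate.\<close>
      have "(\<Sum>j<k. r (Suc j) ^ (2 * m) * (1 / 2) ^ j) = (\<Sum>i<k. r (Suc (k - Suc i)) ^ (2 * m) * (1 / 2) ^ (k - Suc i))"
        by (rule sum.nat_diff_reindex[symmetric])
      also have "\<dots> \<le> (\<Sum>i<k. (2 * P * (1 / 2) ^ k) * (1 / 2) ^ i)"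
      proof (rule sum_mono)
        fix i assume "i \<in> {..<k}"
        then have i: "Suc (k - Suc i) = k - i" "i \<le> k" "k = Suc i + (k - Suc i)" by auto
        have "r (Suc (k - Suc i)) ^ (2 * m) * (1 / 2) ^ (k - Suc i) \<le> P * (1 / 4) ^ i * (1 / 2) ^ (k - Suc i)"
          unfolding i(1) m_def by (intro mult_right_mono P(2) i) auto
        also have "(1 / 4 :: real) ^ i = (1 / 2) ^ i * (1 / 2) ^ i" by (simp add: power_mult_distrib[symmetric])
        also have "P * ((1 / 2) ^ i * (1 / 2) ^ i) * (1 / 2) ^ (k - Suc i) = (2 * P * ((1 / 2) ^ Suc i * (1 / 2) ^ (k - Suc i))) * (1 / 2) ^ i"
          by simp
        also have "(1 / 2 :: real) ^ Suc i * (1 / 2) ^ (k - Suc i) = (1 / 2) ^ k"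
          unfolding power_add[symmetric] i(3)[symmetric] ..
        finally show "r (Suc (k - Suc i)) ^ (2 * m) * (1 / 2) ^ (k - Suc i) \<le> (2 * P * (1 / 2) ^ k) * (1 / 2) ^ i" .
      qed
      also have "\<dots> = (2 * P * (1 / 2) ^ k) * (\<Sum>i<k. (1 / 2) ^ i)" by (simp add: sum_distrib_left)
      also have "\<dots> \<le> (2 * P * (1 / 2) ^ k) * 2"
        using P(1) by (intro mult_left_mono) (simp_all add: sum_gp_strict)
      finally show "r 0 ^ (2 * m) * T + (\<Sum>j<k. r (Suc j) ^ (2 * m) * (1 / 2) ^ j) + (1 / 2) ^ k \<le> (P * T + 4 * P + 1) * (1 / 2) ^ k"
        using a by (simp add: algebra_simps)
    qed
    finally show "(\<integral>\<^sup>+x. ennreal (x ^ (2 * vorder k) * \<rho> x) * indicator {0..<1} x \<partial>lborel) \<le> ennreal ((P * T + 4 * P + 1) * (1 / 2) ^ k)"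
      by (simp add: m_def)
  qed
qed

end

section \<open>Monomials and Carleson constants\<close>

text \<open>Words instead of multi-indices: each monomial occurs once per ordering, so the
  multinomial coefficients are built in and the squares over \<open>words m\<close> add up to
  |z|^(2m).\<close>

definition word_monomial :: "'n list \<Rightarrow> complex ^ 'n \<Rightarrow> complex" where
  "word_monomial I z = prod_list (map (\<lambda>i. z $ i) I)"

abbreviation word_mult :: "'n list \<Rightarrow> (complex ^ 'n \<Rightarrow> complex) \<Rightarrow> complex ^ 'n \<Rightarrow> complex" where
  "word_mult I f \<equiv> \<lambda>z. word_monomial I z * f z"

abbreviation words :: "nat \<Rightarrow> 'n list set" where
  "words m \<equiv> {I. length I = m}"

lemma sum_word_monomial:
  "(\<Sum>I\<in>words m. (cmod (word_monomial I (z :: complex ^ 'n)))\<^sup>2) = norm z ^ (2 * m)"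
proof (induction m)
  case (Suc m)
  have eq: "words (Suc m) = (\<lambda>(i :: 'n, I). i # I) ` (UNIV \<times> words m)"
    by (auto simp: length_Suc_conv image_iff)
  have inj: "inj_on (\<lambda>(i :: 'n, I). i # I) (UNIV \<times> words m)" by (auto simp: inj_on_def)
  have "(\<Sum>I\<in>words (Suc m). (cmod (word_monomial I z))\<^sup>2) = (\<Sum>(i, I)\<in>UNIV \<times> words m. (cmod (z $ i))\<^sup>2 * (cmod (word_monomial I z))\<^sup>2)"
    unfolding eq by (subst sum.reindex[OF inj]) (auto intro!: sum.cong simp: word_monomial_def norm_mult power_mult_distrib)
  also have "\<dots> = (\<Sum>i\<in>UNIV. (cmod (z $ i))\<^sup>2) * (\<Sum>I\<in>words m. (cmod (word_monomial I z))\<^sup>2)"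
    by (simp add: sum_product sum.cartesian_product)
  also have "\<dots> = (norm z)\<^sup>2 * norm z ^ (2 * m)" by (simp only: Suc norm_vec_power2)
  finally show ?case by (simp add: power2_eq_square)
qed (simp add: word_monomial_def)

lemma holomorphic_ball_word_monomial: "holomorphic_ball (word_monomial (I :: 'n::finite list))"
proof (induction I)
  case Nil
  have "word_monomial ([] :: 'n list) = (\<lambda>z. 1)" by (simp add: word_monomial_def fun_eq_iff)
  then show ?case by (simp add: holomorphic_ball_const)
next
  case (Cons i I)
  have "word_monomial (i # I) = (\<lambda>z. z $ i * word_monomial I z)" by (simp add: word_monomial_def fun_eq_iff)
  then show ?case by (simp add: holomorphic_ball_mult holomorphic_ball_component Cons)
qed

lemma word_monomial_scale: "word_monomial I (c *s z) = c ^ length I * word_monomial I z"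
  by (induction I) (simp_all add: word_monomial_def)

lemma ball_restrict_measurable:
  assumes "sets M = sets (restrict_space borel (ball 0 1))" "(\<lambda>z. h z * indicator (ball 0 1) z) \<in> borel_measurable borel"
  shows "(h :: complex ^ 'n \<Rightarrow> ennreal) \<in> borel_measurable M"
proof -
  have "(\<lambda>z. h z * indicator (ball 0 1) z) \<in> borel_measurable (restrict_space borel (ball 0 1))"
    by (rule measurable_restrict_space1) fact
  then have "h \<in> borel_measurable (restrict_space borel (ball 0 1))"
    by (rule measurable_cong[THEN iffD1, rotated]) (simp add: space_restrict_space)
  then show ?thesis unfolding measurable_cong_sets[OF assms(1) refl] .
qed

lemma holomorphic_ball_square_borel:
  assumes "holomorphic_ball (f :: complex ^ 'n \<Rightarrow> complex)"
  shows "(\<lambda>z. ennreal ((cmod (f z))\<^sup>2) * indicator (ball 0 1) z) \<in> borel_measurable borel"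
proof -
  have [measurable]: "(\<lambda>z. if norm z < 1 then f z else 0) \<in> borel_measurable borel"
    by (rule holomorphic_ball_borel[OF assms])
  have "(\<lambda>z. ennreal ((cmod (if norm z < 1 then f z else 0))\<^sup>2)) \<in> borel_measurable borel" by measurable
  also have "(\<lambda>z. ennreal ((cmod (if norm z < 1 then f z else 0))\<^sup>2)) = (\<lambda>z. ennreal ((cmod (f z))\<^sup>2) * indicator (ball 0 1) z)"
    by (auto simp: indicator_def)
  finally show ?thesis .
qed

lemma hardy_normsq_alt:
  assumes "holomorphic_ball f"
  shows "hardy_normsq f = (SUP x\<in>{0<..<1}. ennreal (sphere_mean f x))"
  unfolding hardy_normsq_def by (intro SUP_cong refl nn_integral_sphere_mean assms) auto

lemma sphere_mean_le_hardy: "holomorphic_ball f \<Longrightarrow> 0 < x \<Longrightarrow> x < 1 \<Longrightarrow> ennreal (sphere_mean f x) \<le> hardy_normsq f"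
  unfolding hardy_normsq_alt by (rule SUP_upper) simp

lemma carleson_constant_le:
  "(\<And>f. f \<in> X \<Longrightarrow> sq_integral f \<mu> \<le> C * N f) \<Longrightarrow> carleson_constant X N \<mu> \<le> C"
  unfolding carleson_constant_def by (rule Inf_lower) simp

text \<open>The infimum is itself an admissible constant, as one sees by dividing by
  \<open>N f\<close>. In \<open>ennreal\<close> this requires \<open>N f\<close> to be positive and
  finite; when it is 0, any admissible constant shows that the integral vanishes.\<close>

lemma carleson_constant_attained:
  assumes f: "f \<in> X" "N f < \<infinity>" and c: "carleson_constant X N \<mu> < \<infinity>"
  shows "sq_integral f \<mu> \<le> carleson_constant X N \<mu> * N f"
proof -
  let ?S = "{C. \<forall>f\<in>X. sq_integral f \<mu> \<le> C * N f}"
  obtain C0 where C0: "C0 \<in> ?S" using c unfolding carleson_constant_def Inf_less_iff by blast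
  show ?thesis
  proof (cases "N f = 0")
    case True
    then show ?thesis using C0 f by auto
  next
    case False
    have "sq_integral f \<mu> / N f \<le> carleson_constant X N \<mu>"
      unfolding carleson_constant_def
    proof (rule Inf_greatest)
      fix C assume "C \<in> ?S"
      then have "sq_integral f \<mu> \<le> C * N f" using f by auto
      then show "sq_integral f \<mu> / N f \<le> C"
        using False by (intro divide_le_posI_ennreal) (auto simp: mult.commute zero_less_iff_neq_zero)
    qed
    then have "sq_integral f \<mu> / N f * N f \<le> carleson_constant X N \<mu> * N f"
      by (rule mult_right_mono) simp
    moreover have "sq_integral f \<mu> / N f * N f = sq_integral f \<mu>"
      using False f by (simp add: ennreal_divide_times ennreal_divide_self less_top)
    ultimately show ?thesis by simp
  qed
qed

text \<open>Point evaluations are uniformly bounded on |z| \<le> R, and \<open>\<nu>\<close> is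
  finite. This handles the shell k = 0, which the monomial argument leaves out.\<close>

lemma (in ball_finite_measure) hardy_carleson_compact_support:
  assumes R: "AE z in \<nu>. norm z \<le> R" "R < 1"
  shows "\<exists>C>0. \<forall>f\<in>hardy_space. sq_integral f \<nu> \<le> ennreal C * hardy_normsq f"
proof -
  define R' where "R' = max R 0"
  have R': "0 \<le> R'" "R' < 1" "R \<le> R'" using R by (auto simp: R'_def)
  define s where "s = (1 + R') / 2"
  have s: "0 < s" "s < 1" "R' < s" using R' by (auto simp: s_def)
  obtain C where C: "C > 0" "\<And>(f :: complex ^ 'n \<Rightarrow> complex) z. holomorphic_ball f \<Longrightarrow> norm z \<le> R' \<Longrightarrow> (cmod (f z))\<^sup>2 \<le> C * sphere_mean f s"
    using sphere_mean_pointwise[of "R' / s", where 'n = 'n] R' s by (auto simp: field_simps)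
  show ?thesis
  \<comment> \<open>The summand 1 keeps the constant positive when \<open>\<nu>\<close> is
    zero.\<close>
  proof (intro exI[of _ "C * (measure \<nu> (space \<nu>) + 1)"] conjI ballI)
    show "C * (measure \<nu> (space \<nu>) + 1) > 0" using C by (simp add: add_nonneg_pos)
    fix f :: "complex ^ 'n \<Rightarrow> complex" assume "f \<in> hardy_space"
    then have f: "holomorphic_ball f" by (simp add: hardy_space_def)
    have "sq_integral f \<nu> \<le> (\<integral>\<^sup>+z. ennreal C * hardy_normsq f \<partial>\<nu>)"
    proof (rule nn_integral_mono_AE)
      show "AE z in \<nu>. ennreal ((cmod (f z))\<^sup>2) \<le> ennreal C * hardy_normsq f"
        using R(1)
      proof eventually_elim
        case (elim z)
        then have "ennreal ((cmod (f z))\<^sup>2) \<le> ennreal (C * sphere_mean f s)" using C(2)[OF f, of z] R' by (intro ennreal_leI) auto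
        also have "\<dots> = ennreal C * ennreal (sphere_mean f s)" using C by (simp add: ennreal_mult sphere_mean_nonneg)
        also have "\<dots> \<le> ennreal C * hardy_normsq f" by (intro mult_left_mono sphere_mean_le_hardy f s) auto
        finally show ?case .
      qed
    qed
    also have "\<dots> = ennreal C * hardy_normsq f * ennreal (measure \<nu> (space \<nu>))" by (simp add: emeasure_eq_measure)
    also have "\<dots> \<le> ennreal C * hardy_normsq f * ennreal (measure \<nu> (space \<nu>) + 1)" by (intro mult_left_mono ennreal_leI) auto
    also have "\<dots> = ennreal (C * (measure \<nu> (space \<nu>) + 1)) * hardy_normsq f" using C by (simp add: ennreal_mult mult_ac)
    finally show "sq_integral f \<nu> \<le> ennreal (C * (measure \<nu> (space \<nu>) + 1)) * hardy_normsq f" .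
  qed
qed

section \<open>The weighted Bergman norm in polar coordinates\<close>

locale class_S_measure = class_S_weight "CARD('n)" \<rho> + \<mu>: ball_finite_measure \<mu>
  for \<rho> and \<mu> :: "(complex ^ 'n) measure"
begin

text \<open>The density of |f|^2 \<rho> dv in the radius. The radius 0 is excluded because the facts
  on spherical means are stated for positive radii; it is a null set.\<close>

definition radial_density :: "(complex ^ 'n \<Rightarrow> complex) \<Rightarrow> real \<Rightarrow> ennreal" where
  "radial_density f x =
    ennreal (2 * real CARD('n) * x ^ (2 * CARD('n) - 1) * \<rho> x * sphere_mean f x) * indicator {0<..<1} x"

lemma weighted_borel:
  assumes "holomorphic_ball (f :: complex ^ 'n \<Rightarrow> complex)"
  shows "(\<lambda>z. ennreal (norm z ^ (2 * m) * ((cmod (f z))\<^sup>2 * \<rho> (norm z))) * indicator (ball 0 1) z) \<in> borel_measurable borel"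
proof -
  have [measurable]: "(\<lambda>z. if norm z < 1 then f z else 0) \<in> borel_measurable borel"
    by (rule holomorphic_ball_borel[OF assms])
  have [measurable]: "(\<lambda>z :: complex ^ 'n. indicator {0..<1} (norm z) * \<rho> (norm z)) \<in> borel_measurable borel"
    by (rule measurable_compose[OF _ rho_measurable]) measurable
  have "(\<lambda>z. ennreal (norm z ^ (2 * m) * ((cmod (if norm z < 1 then f z else 0))\<^sup>2 * (indicator {0..<1} (norm z) * \<rho> (norm z))))) \<in> borel_measurable borel"
    by measurable
  also have "(\<lambda>z. ennreal (norm z ^ (2 * m) * ((cmod (if norm z < 1 then f z else 0))\<^sup>2 * (indicator {0..<1} (norm z) * \<rho> (norm z)))))
     = (\<lambda>z. ennreal (norm z ^ (2 * m) * ((cmod (f z))\<^sup>2 * \<rho> (norm z))) * indicator (ball 0 1) z)"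
    by (auto simp: indicator_def)
  finally show ?thesis .
qed

text \<open>The factor |z|^(2m) is carried along because it is the sum of the squared monomials of
  degree m; the case m = 0 is the Bergman norm.\<close>

lemma bergman_polar:
  assumes f: "holomorphic_ball (f :: complex ^ 'n \<Rightarrow> complex)"
  shows "(\<integral>\<^sup>+z. ennreal (norm z ^ (2 * m) * ((cmod (f z))\<^sup>2 * \<rho> (norm z))) \<partial>ball_measure)
    = (\<integral>\<^sup>+x. ennreal (x ^ (2 * m)) * radial_density f x \<partial>lborel)"
  unfolding nn_integral_polar[OF weighted_borel[OF f]]
proof (rule nn_integral_cong)
  fix x :: real
  show "ennreal (2 * real CARD('n) * x ^ (2 * CARD('n) - 1)) * indicator {0..<1} x *
         (\<integral>\<^sup>+\<xi>. ennreal (norm (x *\<^sub>R \<xi>) ^ (2 * m) * ((cmod (f (x *\<^sub>R \<xi>)))\<^sup>2 * \<rho> (norm (x *\<^sub>R \<xi>)))) \<partial>sphere_measure) =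
         ennreal (x ^ (2 * m)) * radial_density f x"
  proof (cases "x \<in> {0<..<1}")
    case True
    have "(\<integral>\<^sup>+\<xi>. ennreal (norm (x *\<^sub>R \<xi>) ^ (2 * m) * ((cmod (f (x *\<^sub>R \<xi>)))\<^sup>2 * \<rho> (norm (x *\<^sub>R \<xi>)))) \<partial>sphere_measure) =
      (\<integral>\<^sup>+\<xi>. ennreal (x ^ (2 * m) * \<rho> x) * ennreal ((cmod (f (x *\<^sub>R \<xi>)))\<^sup>2) \<partial>sphere_measure)"
      by (rule nn_integral_cong) (use True rho_pos[of x] in \<open>simp add: ennreal_mult[symmetric] mult_ac\<close>)
    also have "\<dots> = ennreal (x ^ (2 * m) * \<rho> x) * ennreal (sphere_mean f x)"
      using True sphere_slice_measurable_bounded(1)[OF f, of x] nn_integral_sphere_mean(2)[OF f, of x]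
      by (subst nn_integral_cmult) auto
    finally show ?thesis using True rho_pos[of x] sphere_mean_nonneg[of f x]
      by (simp add: radial_density_def ennreal_mult[symmetric] mult_ac)
  next
    case False
    then consider "x = 0" | "x \<notin> {0..<1}" by force
    then show ?thesis
    proof cases
      case 1
      have "2 * CARD('n) - 1 \<noteq> 0" using n by linarith
      then show ?thesis using 1 by (simp add: radial_density_def power_0_left)
    qed (use False in \<open>simp add: radial_density_def\<close>)
  qed
qed

lemma bergman_normsq_polar:
  assumes "holomorphic_ball (f :: complex ^ 'n \<Rightarrow> complex)"
  shows "bergman_normsq \<rho> f = (\<integral>\<^sup>+x. radial_density f x \<partial>lborel)"
  using bergman_polar[OF assms, of 0] by (simp add: bergman_normsq_def)

lemma radial_density_measurable [measurable]:
  assumes f: "holomorphic_ball (f :: complex ^ 'n \<Rightarrow> complex)"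
  shows "radial_density f \<in> borel_measurable borel"
proof -
  define F where "F = (\<lambda>z. if norm z < 1 then f z else 0)"
  have [measurable]: "F \<in> borel_measurable borel" unfolding F_def by (rule holomorphic_ball_borel[OF f])
  have [measurable]: "(\<lambda>z. z) \<in> (sphere_measure :: (complex ^ 'n) measure) \<rightarrow>\<^sub>M borel"
    by (rule borel_measurable_sphere) simp
  have [measurable]: "(\<lambda>x. \<integral>\<^sup>+\<xi>. ennreal ((cmod (F (x *\<^sub>R \<xi>)))\<^sup>2) \<partial>sphere_measure) \<in> borel_measurable borel"
    by (rule sphere_measure.borel_measurable_nn_integral) measurable
  have "(\<lambda>x. ennreal (2 * real CARD('n) * x ^ (2 * CARD('n) - 1) * (indicator {0..<1} x * \<rho> x)) *
      (\<integral>\<^sup>+\<xi>. ennreal ((cmod (F (x *\<^sub>R \<xi>)))\<^sup>2) \<partial>sphere_measure) * indicator {0<..<1} x) \<in> borel_measurable borel"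
    by measurable
  also have "(\<lambda>x. ennreal (2 * real CARD('n) * x ^ (2 * CARD('n) - 1) * (indicator {0..<1} x * \<rho> x)) *
      (\<integral>\<^sup>+\<xi>. ennreal ((cmod (F (x *\<^sub>R \<xi>)))\<^sup>2) \<partial>sphere_measure) * indicator {0<..<1} x) = radial_density f"
  proof
    fix x :: real
    show "ennreal (2 * real CARD('n) * x ^ (2 * CARD('n) - 1) * (indicator {0..<1} x * \<rho> x)) *
      (\<integral>\<^sup>+\<xi>. ennreal ((cmod (F (x *\<^sub>R \<xi>)))\<^sup>2) \<partial>sphere_measure) * indicator {0<..<1} x = radial_density f x"
    proof (cases "x \<in> {0<..<1}")
      case True
      have "(\<integral>\<^sup>+\<xi>. ennreal ((cmod (F (x *\<^sub>R \<xi>)))\<^sup>2) \<partial>sphere_measure) = ennreal (sphere_mean f x)"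
        unfolding nn_integral_sphere_mean(2)[OF f, of x, symmetric, OF True[simplified, THEN conjunct1] True[simplified, THEN conjunct2]]
        by (rule nn_integral_cong) (use True in \<open>simp add: F_def\<close>)
      then show ?thesis using True rho_pos[of x] sphere_mean_nonneg[of f x]
        by (simp add: radial_density_def ennreal_mult[symmetric])
    qed (simp add: radial_density_def)
  qed
  finally show ?thesis .
qed

text \<open>The shell has \<rho>-mass 2^-(k+1), and on it the Jacobian x^(2n-1) is at least its
  value at \<open>r 1\<close>. For k \<ge> 1 this value is positive and independent of k.\<close>

lemma bergman_shell_ge:
  assumes f: "holomorphic_ball (f :: complex ^ 'n \<Rightarrow> complex)" and k: "k \<ge> 1"
    and b: "b \<ge> 0" "\<And>x. r k \<le> x \<Longrightarrow> x < r (Suc k) \<Longrightarrow> b \<le> sphere_mean f x"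
  shows "ennreal (2 * real CARD('n) * r 1 ^ (2 * CARD('n) - 1) * b * (1 / 2) ^ Suc k)
    \<le> (\<integral>\<^sup>+x. radial_density f x * indicator {r k..<r (Suc k)} x \<partial>lborel)"
proof -
  let ?c = "2 * real CARD('n) * r 1 ^ (2 * CARD('n) - 1) * b"
  have r1: "0 < r 1" "r 1 \<le> r k" using weight_point_pos[of 1] k weight_point_strict_mono by (auto simp: strict_mono_less_eq)
  have c: "?c \<ge> 0" using r1 b by simp
  have "ennreal (?c * (1 / 2) ^ Suc k) = ennreal ?c * (\<integral>\<^sup>+x. ennreal (\<rho> x) * indicator {r k..<r (Suc k)} x \<partial>lborel)"
    unfolding nn_integral_rho_shell by (rule ennreal_mult) (use c in auto)
  also have "\<dots> = (\<integral>\<^sup>+x. ennreal ?c * (ennreal (\<rho> x) * indicator {r k..<r (Suc k)} x) \<partial>lborel)"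
  proof (rule nn_integral_cmult[symmetric])
    have "(\<lambda>x. ennreal (indicator {0..<1} x * \<rho> x) * indicator {r k..<r (Suc k)} x) \<in> borel_measurable lborel" by measurable
    also have "(\<lambda>x. ennreal (indicator {0..<1} x * \<rho> x) * indicator {r k..<r (Suc k)} x) = (\<lambda>x. ennreal (\<rho> x) * indicator {r k..<r (Suc k)} x)"
      using weight_point_mem[of k] weight_point_mem[of "Suc k"] by (auto simp: fun_eq_iff indicator_def)
    finally show "(\<lambda>x. ennreal (\<rho> x) * indicator {r k..<r (Suc k)} x) \<in> borel_measurable lborel" .
  qed
  also have "\<dots> \<le> (\<integral>\<^sup>+x. radial_density f x * indicator {r k..<r (Suc k)} x \<partial>lborel)"
  proof (rule nn_integral_mono)
    fix x
    show "ennreal ?c * (ennreal (\<rho> x) * indicator {r k..<r (Suc k)} x) \<le> radial_density f x * indicator {r k..<r (Suc k)} x"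
    proof (cases "x \<in> {r k..<r (Suc k)}")
      case True
      then have x: "0 < x" "x < 1" "r 1 \<le> x" using r1 weight_point_mem(2)[of "Suc k"] by auto
      have "?c * \<rho> x \<le> (2 * real CARD('n) * x ^ (2 * CARD('n) - 1) * sphere_mean f x) * \<rho> x"
        using x True b r1 rho_pos[of x] by (intro mult_right_mono mult_mono power_mono) auto
      then have "ennreal (?c * \<rho> x) \<le> ennreal (2 * real CARD('n) * x ^ (2 * CARD('n) - 1) * \<rho> x * sphere_mean f x)"
        by (intro ennreal_leI) (simp add: mult_ac)
      then show ?thesis using True x c rho_pos[of x] by (simp add: radial_density_def ennreal_mult)
    qed simp
  qed
  finally show ?thesis .
qed

text \<open>A shell beyond \<open>R\<close> is fixed. Every sphere in it bounds |f(z)|^2 by its mean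
  with the same constant, since |z| \<le> q x, and integration over the shell brings in the Bergman
  norm.\<close>

lemma bergman_pointwise:
  assumes R: "R < 1"
  shows "\<exists>C>0. \<forall>f z. holomorphic_ball f \<longrightarrow> norm z \<le> R \<longrightarrow>
    ennreal ((cmod (f (z :: complex ^ 'n)))\<^sup>2) \<le> ennreal C * bergman_normsq \<rho> f"
proof -
  obtain k where k: "k \<ge> 1" "max R 0 < r k" using exists_weight_point_gt[of "max R 0"] R by auto
  define q where "q = max R 0 / r k"
  have q: "0 \<le> q" "q < 1" "q * r k = max R 0" using k by (auto simp: q_def)
  obtain C where C: "C > 0" "\<And>(f :: complex ^ 'n \<Rightarrow> complex) s z. holomorphic_ball f \<Longrightarrow> 0 < s \<Longrightarrow> s < 1 \<Longrightarrow> norm z \<le> q * s \<Longrightarrow> (cmod (f z))\<^sup>2 \<le> C * sphere_mean f s"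
    using sphere_mean_pointwise[OF q(1,2), where 'n='n] by blast
  define c where "c = 2 * real CARD('n) * r 1 ^ (2 * CARD('n) - 1) * (1 / 2) ^ Suc k"
  have c: "c > 0" using weight_point_pos[of 1] n by (simp add: c_def)
  show ?thesis
  proof (intro exI[of _ "C / c"] conjI allI impI)
    show "C / c > 0" using C c by simp
    fix f :: "complex ^ 'n \<Rightarrow> complex" and z :: "complex ^ 'n" assume f: "holomorphic_ball f" and z: "norm z \<le> R"
    define b where "b = (cmod (f z))\<^sup>2 / C"
    have b: "b \<ge> 0" using C by (simp add: b_def)
    have bm: "b \<le> sphere_mean f x" if "r k \<le> x" "x < r (Suc k)" for x
    proof -
      have x: "0 < x" "x < 1" using that k weight_point_mem(2)[of "Suc k"] by auto
      have "norm z \<le> q * x" using z q that mult_left_mono[OF that(1) q(1)] by linarith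
      from C(2)[OF f x this] show ?thesis using C by (simp add: b_def field_simps)
    qed
    have "ennreal (c * b) \<le> (\<integral>\<^sup>+x. radial_density f x * indicator {r k..<r (Suc k)} x \<partial>lborel)"
      using bergman_shell_ge[OF f k(1) b bm] by (simp add: c_def mult_ac)
    also have "\<dots> \<le> bergman_normsq \<rho> f"
      unfolding bergman_normsq_polar[OF f] by (intro nn_integral_mono) (auto simp: indicator_def)
    finally have "ennreal (C / c) * ennreal (c * b) \<le> ennreal (C / c) * bergman_normsq \<rho> f"
      by (rule mult_left_mono) simp
    moreover have "ennreal (C / c) * ennreal (c * b) = ennreal ((cmod (f z))\<^sup>2)"
      using C c b by (simp add: ennreal_mult[symmetric] b_def)
    ultimately show "ennreal ((cmod (f z))\<^sup>2) \<le> ennreal (C / c) * bergman_normsq \<rho> f" by simp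
  qed
qed

lemma sum_bergman_shells_le:
  assumes f: "holomorphic_ball (f :: complex ^ 'n \<Rightarrow> complex)"
  shows "(\<Sum>k. \<integral>\<^sup>+x. radial_density f x * indicator {r (k + N)..<r (Suc (k + N))} x \<partial>lborel) \<le> bergman_normsq \<rho> f"
proof -
  have disj: "disjoint_family (\<lambda>k. {r (k + N)..<r (Suc (k + N))})"
    unfolding disjoint_family_on_def
  proof (intro ballI impI)
    fix i j :: nat assume "i \<noteq> j"
    have mono: "r (Suc (a + N)) \<le> r (b + N)" if "a < b" for a b
      using that weight_point_strict_mono by (simp add: strict_mono_less_eq)
    show "{r (i + N)..<r (Suc (i + N))} \<inter> {r (j + N)..<r (Suc (j + N))} = {}"
      using \<open>i \<noteq> j\<close> mono[of i j] mono[of j i] by (cases i j rule: linorder_cases) auto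
  qed
  note [measurable] = radial_density_measurable[OF f]
  have "(\<Sum>k. \<integral>\<^sup>+x. radial_density f x * indicator {r (k + N)..<r (Suc (k + N))} x \<partial>lborel)
    = (\<integral>\<^sup>+x. (\<Sum>k. radial_density f x * indicator {r (k + N)..<r (Suc (k + N))} x) \<partial>lborel)"
    by (rule nn_integral_suminf[symmetric]) measurable
  also have "\<dots> = (\<integral>\<^sup>+x. radial_density f x * indicator (\<Union>k. {r (k + N)..<r (Suc (k + N))}) x \<partial>lborel)"
    by (intro nn_integral_cong) (simp add: ennreal_suminf_cmult suminf_indicator[OF disj])
  also have "\<dots> \<le> bergman_normsq \<rho> f"
    unfolding bergman_normsq_polar[OF f] by (intro nn_integral_mono) (auto simp: indicator_def)
  finally show ?thesis .
qed

text \<open>Every spherical mean is at most the Hardy norm, and the remaining Jacobian factor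
  x^(2n-1) is at most 1.\<close>

lemma weighted_le_hardy:
  assumes f: "holomorphic_ball (f :: complex ^ 'n \<Rightarrow> complex)"
  shows "(\<integral>\<^sup>+z. ennreal (norm z ^ (2 * m) * ((cmod (f z))\<^sup>2 * \<rho> (norm z))) \<partial>ball_measure)
    \<le> hardy_normsq f * ennreal (2 * real CARD('n)) * (\<integral>\<^sup>+x. ennreal (x ^ (2 * m) * \<rho> x) * indicator {0..<1} x \<partial>lborel)"
proof -
  have [measurable]: "(\<lambda>x. ennreal (x ^ (2 * m) * \<rho> x) * indicator {0..<1} x) \<in> borel_measurable borel"
  proof -
    have "(\<lambda>x. ennreal (x ^ (2 * m) * (indicator {0..<1} x * \<rho> x))) \<in> borel_measurable borel" by measurable
    also have "(\<lambda>x. ennreal (x ^ (2 * m) * (indicator {0..<1} x * \<rho> x))) = (\<lambda>x. ennreal (x ^ (2 * m) * \<rho> x) * indicator {0..<1} x)"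
      by (auto simp: indicator_def)
    finally show ?thesis .
  qed
  have "ennreal (x ^ (2 * m)) * radial_density f x \<le>
      hardy_normsq f * ennreal (2 * real CARD('n)) * (ennreal (x ^ (2 * m) * \<rho> x) * indicator {0..<1} x)" for x
  proof (cases "x \<in> {0<..<1}")
    case True
    then have x: "0 < x" "x < 1" by auto
    define M where "M = sphere_mean f x"
    have M: "M \<ge> 0" by (simp add: M_def sphere_mean_nonneg)
    have rx: "\<rho> x > 0" using x by (simp add: rho_pos)
    have "ennreal (x ^ (2 * m)) * radial_density f x =
       ennreal (x ^ (2 * m) * (2 * real CARD('n) * x ^ (2 * CARD('n) - 1) * \<rho> x * M))"
      using x rx M by (simp add: radial_density_def M_def ennreal_mult)
    also have "\<dots> \<le> ennreal (M * (2 * real CARD('n)) * (x ^ (2 * m) * \<rho> x))"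
    proof (rule ennreal_leI)
      have "x ^ (2 * CARD('n) - 1) \<le> 1" using x by (intro power_le_one) auto
      then have "(x ^ (2 * m) * (2 * real CARD('n)) * \<rho> x * M) * x ^ (2 * CARD('n) - 1) \<le> (x ^ (2 * m) * (2 * real CARD('n)) * \<rho> x * M) * 1"
        using x rx M by (intro mult_left_mono) auto
      then show "x ^ (2 * m) * (2 * real CARD('n) * x ^ (2 * CARD('n) - 1) * \<rho> x * M) \<le> M * (2 * real CARD('n)) * (x ^ (2 * m) * \<rho> x)"
        by (simp add: mult_ac)
    qed
    also have "\<dots> = ennreal M * ennreal (2 * real CARD('n)) * ennreal (x ^ (2 * m) * \<rho> x)"
      using x rx M by (simp add: ennreal_mult)
    also have "\<dots> \<le> hardy_normsq f * ennreal (2 * real CARD('n)) * ennreal (x ^ (2 * m) * \<rho> x)"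
      using sphere_mean_le_hardy[OF f x] by (intro mult_right_mono) (auto simp: M_def)
    finally show ?thesis using x by simp
  qed (simp add: radial_density_def)
  then have "(\<integral>\<^sup>+x. ennreal (x ^ (2 * m)) * radial_density f x \<partial>lborel) \<le>
      (\<integral>\<^sup>+x. hardy_normsq f * ennreal (2 * real CARD('n)) * (ennreal (x ^ (2 * m) * \<rho> x) * indicator {0..<1} x) \<partial>lborel)"
    by (rule nn_integral_mono)
  then show ?thesis unfolding bergman_polar[OF f] by (subst (asm) nn_integral_cmult) auto
qed

end

section \<open>Carleson measures\<close>

text \<open>On the complex line through z the product is t^|I| h(t), where the zero at the origin is
  an explicit factor. The maximum principle for \<open>h\<close> alone gives the bound, with t = |z|
  / R'.\<close>

lemma schwarz_word_monomial:
  fixes f :: "complex ^ 'n \<Rightarrow> complex"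
  assumes f: "holomorphic_ball f" and R: "0 < R'" "R' < 1" "R \<le> R'" and z: "norm z \<le> R"
    and B: "\<And>w. norm w \<le> R' \<Longrightarrow> cmod (word_monomial I w * f w) \<le> B"
  shows "cmod (word_monomial I z * f z) \<le> (R / R') ^ length I * B"
proof -
  obtain u where u: "norm u = 1" "z = of_real (norm z) *s u" by (rule vec_polar_decomposition)
  define w where "w = R' *\<^sub>R u"
  define t where "t = norm z / R'"
  have t: "0 \<le> t" "t \<le> R / R'" "t \<le> 1" using R z by (auto simp: t_def field_simps)
  have zt: "z = of_real t *s w"
  proof -
    have "of_real t *s w = of_real (norm z) *s u" using R by (simp add: w_def t_def vec_eq_iff scaleR_conv_of_real[where 'a=complex])
    then show ?thesis using u(2) by simp
  qed
  have nw: "norm w = R'" using u R by (simp add: w_def)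
  \<comment> \<open>The monomial is frozen at \<open>w\<close>: on |c| = 1 it has the same modulus
    at \<open>w\<close> and at \<open>c *s w\<close>, so \<open>h\<close> inherits the bound
    \<open>B\<close> there.\<close>
  define h where "h = (\<lambda>c. word_monomial I w * f (0 + c *s w))"
  have "(\<lambda>c. f (0 + c *s w)) holomorphic_on ball 0 (1 / R')"
    by (rule holomorphic_on_subset[OF holomorphic_on_slice[OF f]])
       (use R nw in \<open>auto simp: norm_vec_scale field_simps\<close>)
  then have "h holomorphic_on ball 0 (1 / R')" unfolding h_def by (intro holomorphic_intros)
  moreover have sub: "cball 0 1 \<subseteq> ball (0::complex) (1 / R')"
  proof
    fix c :: complex assume "c \<in> cball 0 1"
    moreover have "1 < 1 / R'" using R by simp
    ultimately show "c \<in> ball 0 (1 / R')" by simp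
  qed
  ultimately have hol: "h holomorphic_on cball 0 1" by (rule holomorphic_on_subset)
  have "cmod (h (of_real t)) \<le> B"
  proof (rule maximum_modulus_frontier[where S = "cball 0 1" and f = h])
    show "h holomorphic_on interior (cball 0 1)" by (rule holomorphic_on_subset[OF hol]) (simp add: interior_subset)
    show "continuous_on (closure (cball 0 1)) h" using holomorphic_on_imp_continuous_on[OF hol] by simp
    fix c :: complex assume "c \<in> frontier (cball 0 1)"
    then have c: "cmod c = 1" by simp
    have "cmod (h c) = cmod (word_monomial I (c *s w) * f (c *s w))"
      using c by (simp add: h_def word_monomial_scale norm_mult norm_power)
    also have "\<dots> \<le> B" by (rule B) (use c nw in \<open>simp add: norm_vec_scale\<close>)
    finally show "cmod (h c) \<le> B" .
  qed (use t in auto)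
  moreover have "word_monomial I z * f z = of_real t ^ length I * h (of_real t)"
    by (subst (1 2) zt) (simp add: h_def word_monomial_scale)
  ultimately have "cmod (word_monomial I z * f z) \<le> t ^ length I * B"
    using t by (simp add: norm_mult norm_power mult_left_mono)
  also have "\<dots> \<le> (R / R') ^ length I * B"
    using t order_trans[OF norm_ge_zero B[of 0]] R by (intro mult_right_mono power_mono) auto
  finally show ?thesis .
qed

section \<open>From Hardy bounds on the shells to the Bergman embedding\<close>

context class_S_measure
begin

abbreviation \<mu>k :: "nat \<Rightarrow> (complex ^ 'n) measure" where
  "\<mu>k k \<equiv> density \<mu> (indicator (shell \<rho> k))"

abbreviation hardy_const :: "nat \<Rightarrow> ennreal" where
  "hardy_const k \<equiv> carleson_constant hardy_space hardy_normsq (\<mu>k k)"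

lemma shell_alt: "shell \<rho> k = (ball 0 (r (Suc k)) - ball 0 (r k) :: (complex ^ 'n) set)"
  using weight_point_mem(2)[of "Suc k"] by (auto simp: shell_def)

lemma ball_sets_\<mu>: "R \<le> 1 \<Longrightarrow> ball 0 R \<in> sets \<mu>"
  unfolding \<mu>.sets_\<nu> by (auto simp: sets_restrict_space image_iff intro!: bexI[of _ "ball 0 R"])

lemma shell_sets [measurable]: "shell \<rho> k \<in> sets \<mu>"
  unfolding shell_alt
  by (intro sets.Diff ball_sets_\<mu>) (use weight_point_mem(2) less_imp_le in blast)+

lemma square_measurable: "holomorphic_ball f \<Longrightarrow> (\<lambda>z. ennreal ((cmod (f z))\<^sup>2)) \<in> borel_measurable \<mu>"
  by (rule ball_restrict_measurable[OF \<mu>.sets_\<nu> holomorphic_ball_square_borel])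

lemma nn_integral_\<mu>k:
  "g \<in> borel_measurable \<mu> \<Longrightarrow> (\<integral>\<^sup>+z. g z \<partial>\<mu>k k) = (\<integral>\<^sup>+z. g z * indicator (shell \<rho> k) z \<partial>\<mu>)"
  by (subst nn_integral_density) (auto simp: mult.commute)

lemma ball_finite_measure_\<mu>k: "ball_finite_measure (\<mu>k k)"
proof (intro ball_finite_measure.intro ball_finite_measure_axioms.intro finite_measureI)
  have "emeasure (\<mu>k k) (space (\<mu>k k)) = emeasure \<mu> (shell \<rho> k)"
    using shell_sets[of k] sets.sets_into_space[OF shell_sets[of k]]
    by (subst emeasure_density) (auto simp: indicator_inter_arith[symmetric] Int_absorb2 nn_integral_indicator)
  then show "emeasure (\<mu>k k) (space (\<mu>k k)) \<noteq> \<infinity>" by (simp add: \<mu>.emeasure_finite)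
  show "sets (\<mu>k k) = sets (restrict_space borel (ball 0 1))" by (simp add: \<mu>.sets_\<nu>)
qed

lemma AE_\<mu>k_norm_le: "AE z in \<mu>k k. norm z \<le> r (Suc k)"
  by (subst AE_density) (auto simp: shell_def indicator_def)

text \<open>The dilation estimate is applied with R = \<open>r (k + 1)\<close>, which bounds the
  support of \<open>\<mu>k k\<close>, and with every sphere of shell k + 2. Integrating the radius
  over that shell replaces the spherical mean by a piece of the Bergman norm.\<close>

lemma shell_bound:
  "\<exists>E>0. \<forall>k C f. C > 0 \<longrightarrow>
     (\<forall>h\<in>hardy_space. sq_integral h (\<mu>k k) \<le> ennreal (C * (1 / 2) ^ k) * hardy_normsq h) \<longrightarrow>
     holomorphic_ball f \<longrightarrow>
     sq_integral f (\<mu>k k) \<le>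
       ennreal (E * C) * (\<integral>\<^sup>+x. radial_density f x * indicator {r (k + 2)..<r (Suc (k + 2))} x \<partial>lborel)"
proof -
  \<comment> \<open>The class S condition gives 1 - R \<le> D (x - R) for all radii x of shell k +
    2; \<open>D\<close> then bounds the base of the dilation constant.\<close>
  define D where "D = ratio / (ratio - 1)"
  have D: "D > 0" using ratio_gt_1 by (simp add: D_def)
  define c where "c = 2 * real CARD('n) * r 1 ^ (2 * CARD('n) - 1)"
  have c: "c > 0" using weight_point_pos[of 1] n by (simp add: c_def)
  show ?thesis
  \<comment> \<open>The 8 compensates between the factor 2^-k in the Hardy bound and the mass
    2^-(k+3) of shell k + 2.\<close>
  proof (intro exI[of _ "8 * D ^ CARD('n) / c"] conjI allI impI)
    show "8 * D ^ CARD('n) / c > 0" using D c by simp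
    fix k and C :: real and f :: "complex ^ 'n \<Rightarrow> complex"
    assume C: "C > 0" and H: "\<forall>h\<in>hardy_space. sq_integral h (\<mu>k k) \<le> ennreal (C * (1 / 2) ^ k) * hardy_normsq h"
      and f: "holomorphic_ball f"
    interpret \<mu>k: ball_finite_measure "\<mu>k k" by (rule ball_finite_measure_\<mu>k)
    let ?I = "\<integral>\<^sup>+z. ennreal ((cmod (f z))\<^sup>2) \<partial>\<mu>k k"
    define C' where "C' = C * (1 / 2) ^ k"
    have C': "C' > 0" using C by (simp add: C'_def)
    have bd: "?I \<le> ennreal (C' * D ^ CARD('n) * sphere_mean f x)" if x: "r (k + 2) \<le> x" "x < r (Suc (k + 2))" for x
    proof -
      define R where "R = r (Suc k)"
      have R: "0 < R" "R < x" "x < 1"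
        using weight_point_pos[of "Suc k"] x weight_point_mem(2)[of "Suc (k + 2)"] strict_monoD[OF weight_point_strict_mono, of "Suc k" "k + 2"]
        by (auto simp: R_def)
      have "ratio * (1 - x) \<le> ratio * (1 - r (Suc (Suc k)))" using x ratio_gt_1 by (intro mult_left_mono) auto
      also have "\<dots> \<le> 1 - R" unfolding R_def by (rule ratio_mult_le)
      finally have "(1 - R) * (ratio - 1) \<le> ratio * (x - R)" by (simp add: algebra_simps)
      then have xR: "1 - R \<le> D * (x - R)" using ratio_gt_1 by (simp add: D_def field_simps)
      have x2: "x\<^sup>2 \<le> x" using R by (simp add: power2_eq_square mult_left_le)
      \<comment> \<open>The companion factor: with the bound on 1 - R it compares x^2 (1 - R^2) with
        x^2 - R^2 = (x - R)(x + R).\<close>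
      have "x\<^sup>2 * (1 + R) \<le> x + R"
      proof -
        have "x\<^sup>2 * R \<le> 1 * R" using x2 R by (intro mult_right_mono) auto
        then show ?thesis using x2 by (simp add: algebra_simps)
      qed
      then have "(1 - R) * (x\<^sup>2 * (1 + R)) \<le> (D * (x - R)) * (x + R)"
        using xR R D by (intro mult_mono) auto
      then have le: "x\<^sup>2 * (1 - R\<^sup>2) \<le> D * (x\<^sup>2 - R\<^sup>2)"
        by (simp add: power2_eq_square algebra_simps)
      have pos: "x\<^sup>2 - R\<^sup>2 > 0" using R by (simp add: power_strict_mono)
      have "(1 - R\<^sup>2) / (1 - R\<^sup>2 / x\<^sup>2) = x\<^sup>2 * (1 - R\<^sup>2) / (x\<^sup>2 - R\<^sup>2)"
        using R pos by (simp add: field_simps)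
      also have "\<dots> \<le> D" using le pos by (simp add: divide_le_eq)
      finally have DD: "(1 - R\<^sup>2) / (1 - R\<^sup>2 / x\<^sup>2) \<le> D" .
      have nn: "0 \<le> (1 - R\<^sup>2) / (1 - R\<^sup>2 / x\<^sup>2)"
        using R pos by (intro divide_nonneg_nonneg) (auto simp: field_simps power_le_one)
      have "?I \<le> ennreal (C' * ((1 - R\<^sup>2) / (1 - R\<^sup>2 / x\<^sup>2)) ^ CARD('n) * sphere_mean f x)"
        by (rule \<mu>k.carleson_dilation[OF C' _ _ _ _ _ f])
           (use H R AE_\<mu>k_norm_le[of k] in \<open>auto simp: C'_def R_def\<close>)
      also have "\<dots> \<le> ennreal (C' * D ^ CARD('n) * sphere_mean f x)"
        using DD nn C' by (intro ennreal_leI mult_right_mono mult_left_mono power_mono sphere_mean_nonneg) auto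
      finally show ?thesis .
    qed
    have lt: "r (k + 2) < r (Suc (k + 2))" using weight_point_strict_mono by (simp add: strict_mono_def)
    have fin: "?I < \<infinity>" using bd[OF order_refl lt] by (simp add: le_less_trans)
    \<comment> \<open>\<open>b\<close> is the integral divided by its dilation constant; it lies
      below the spherical mean at every radius of the shell, the form that
      \<open>bergman_shell_ge\<close> expects.\<close>
    define b where "b = enn2real ?I / (C' * D ^ CARD('n))"
    have I: "?I = ennreal (C' * D ^ CARD('n) * b)" using fin C' D by (simp add: b_def less_top)
    have b0: "b \<ge> 0" using C' D by (simp add: b_def)
    have bm: "b \<le> sphere_mean f x" if x: "r (k + 2) \<le> x" "x < r (Suc (k + 2))" for x
    proof -
      have "C' * D ^ CARD('n) * b \<le> C' * D ^ CARD('n) * sphere_mean f x"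
        using bd[OF x] unfolding I using C' D sphere_mean_nonneg[of f x] by (subst (asm) ennreal_le_iff) auto
      then show ?thesis using C' D by simp
    qed
    from bergman_shell_ge[where k = "k + 2" and b = b, OF f _ b0 bm]
    have "ennreal (c * b * (1 / 2) ^ Suc (k + 2)) \<le> (\<integral>\<^sup>+x. radial_density f x * indicator {r (k + 2)..<r (Suc (k + 2))} x \<partial>lborel)"
      by (simp add: c_def)
    then have "ennreal (8 * D ^ CARD('n) / c * C) * ennreal (c * b * (1 / 2) ^ Suc (k + 2)) \<le> ennreal (8 * D ^ CARD('n) / c * C) * (\<integral>\<^sup>+x. radial_density f x * indicator {r (k + 2)..<r (Suc (k + 2))} x \<partial>lborel)"
      by (rule mult_left_mono) simp
    moreover have "ennreal (8 * D ^ CARD('n) / c * C) * ennreal (c * b * (1 / 2) ^ Suc (k + 2)) = ?I"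
      unfolding I using c C D b0 by (simp add: ennreal_mult[symmetric] C'_def power_add field_simps)
    ultimately show "?I \<le> ennreal (8 * D ^ CARD('n) / c * C) * (\<integral>\<^sup>+x. radial_density f x * indicator {r (k + 2)..<r (Suc (k + 2))} x \<partial>lborel)"
      by simp
  qed
qed

text \<open>The shells from \<open>N\<close> on miss exactly the ball of radius \<open>r N\<close>,
  which is kept as a separate term so that finitely many shells can be treated differently.\<close>

lemma nn_integral_shells:
  assumes [measurable]: "g \<in> borel_measurable \<mu>"
  shows "(\<integral>\<^sup>+z. g z \<partial>\<mu>) \<le> (\<integral>\<^sup>+z. g z * indicator (ball 0 (r N)) z \<partial>\<mu>) + (\<Sum>k. \<integral>\<^sup>+z. g z \<partial>\<mu>k (k + N))"
proof -
  have [measurable]: "ball 0 (r N) \<in> sets \<mu>" using weight_point_mem(2)[of N] by (intro ball_sets_\<mu>) simp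
  have pw: "g z \<le> g z * indicator (ball 0 (r N)) z + (\<Sum>k. g z * indicator (shell \<rho> (k + N)) z)" if "z \<in> space \<mu>" for z
  proof (cases "norm z < r N")
    case False
    have "norm z < 1" using that by (simp add: \<mu>.space_\<nu>)
    then obtain k0 where k0: "norm z < r k0" using exists_weight_point_gt by blast
    have "r k0 \<le> r (Suc (k0 + N))" using weight_point_strict_mono by (simp add: strict_mono_less_eq)
    then have ex: "norm z < r (Suc (k0 + N))" using k0 by linarith
    \<comment> \<open>The least outer radius exceeding |z| determines the shell: minimality places
      |z| above the inner radius.\<close>
    define k where "k = (LEAST k. norm z < r (Suc (k + N)))"
    have lt: "norm z < r (Suc (k + N))" unfolding k_def by (rule LeastI[of _ k0]) (rule ex)
    have "r (k + N) \<le> norm z"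
    proof (cases k)
      case (Suc i)
      then have "\<not> norm z < r (Suc (i + N))" using not_less_Least[of i "\<lambda>k. norm z < r (Suc (k + N))"] by (simp add: k_def)
      then show ?thesis using Suc by simp
    qed (use False in auto)
    then have "z \<in> shell \<rho> (k + N)" using lt \<open>norm z < 1\<close> by (simp add: shell_def)
    then have "g z = (\<Sum>k\<in>{k}. g z * indicator (shell \<rho> (k + N)) z)" by simp
    also have "\<dots> \<le> (\<Sum>k. g z * indicator (shell \<rho> (k + N)) z)" by (rule sum_le_suminf) auto
    finally show ?thesis by (simp add: add_increasing)
  qed simp
  have "(\<integral>\<^sup>+z. g z \<partial>\<mu>) \<le> (\<integral>\<^sup>+z. g z * indicator (ball 0 (r N)) z + (\<Sum>k. g z * indicator (shell \<rho> (k + N)) z) \<partial>\<mu>)"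
    by (rule nn_integral_mono) (rule pw)
  also have "\<dots> = (\<integral>\<^sup>+z. g z * indicator (ball 0 (r N)) z \<partial>\<mu>) + (\<Sum>k. \<integral>\<^sup>+z. g z * indicator (shell \<rho> (k + N)) z \<partial>\<mu>)"
    by (subst nn_integral_add, measurable, subst nn_integral_suminf) measurable
  finally show ?thesis by (simp add: nn_integral_\<mu>k)
qed

text \<open>The constant \<open>E\<close> is chosen before \<open>C\<close> and \<open>N\<close>. So
  the same estimate serves boundedness with N = 0 and compactness with small \<open>C\<close> and
  large \<open>N\<close>. Each shell of \<open>\<mu>\<close> uses its own piece of the Bergman norm,
  and the pieces are disjoint.\<close>

lemma bergman_embedding_le:
  "\<exists>E>0. \<forall>C N f. C > 0 \<longrightarrow>
     (\<forall>k\<ge>N. hardy_const k \<le> ennreal (C * (1 / 2) ^ k)) \<longrightarrow>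
     holomorphic_ball f \<longrightarrow>
     sq_integral f \<mu> \<le>
       (\<integral>\<^sup>+z. ennreal ((cmod (f z))\<^sup>2) * indicator (ball 0 (r N)) z \<partial>\<mu>) + ennreal (E * C) * bergman_normsq \<rho> f"
proof -
  obtain E where E: "E > 0" "\<And>k C f. C > 0 \<Longrightarrow>
     (\<And>h. h \<in> hardy_space \<Longrightarrow> sq_integral h (\<mu>k k) \<le> ennreal (C * (1 / 2) ^ k) * hardy_normsq h) \<Longrightarrow>
     holomorphic_ball f \<Longrightarrow>
     sq_integral f (\<mu>k k) \<le>
       ennreal (E * C) * (\<integral>\<^sup>+x. radial_density f x * indicator {r (k + 2)..<r (Suc (k + 2))} x \<partial>lborel)"
    using shell_bound by blast
  show ?thesis
  proof (intro exI[of _ E] conjI allI impI)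
    show "E > 0" by fact
    fix C N f assume C: "C > 0" and H: "\<forall>k\<ge>N. hardy_const k \<le> ennreal (C * (1 / 2) ^ k)"
      and f: "holomorphic_ball (f :: complex ^ 'n \<Rightarrow> complex)"
    let ?J = "\<lambda>k. \<integral>\<^sup>+x. radial_density f x * indicator {r (k + (N + 2))..<r (Suc (k + (N + 2)))} x \<partial>lborel"
    have "sq_integral f (\<mu>k (k + N)) \<le> ennreal (E * C) * ?J k" for k
    proof -
      have "sq_integral h (\<mu>k (k + N)) \<le> ennreal (C * (1 / 2) ^ (k + N)) * hardy_normsq h"
        if h: "h \<in> hardy_space" for h
      proof -
        have le: "hardy_const (k + N) \<le> ennreal (C * (1 / 2) ^ (k + N))" using H by simp
        have "sq_integral h (\<mu>k (k + N)) \<le> hardy_const (k + N) * hardy_normsq h"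
          by (rule carleson_constant_attained[OF h]) (use h le in \<open>auto simp: hardy_space_def intro: le_less_trans\<close>)
        also have "\<dots> \<le> ennreal (C * (1 / 2) ^ (k + N)) * hardy_normsq h" using le by (rule mult_right_mono) simp
        finally show ?thesis .
      qed
      from E(2)[OF C this f] show ?thesis by (simp add: add.assoc)
    qed
    then have "(\<Sum>k. \<integral>\<^sup>+z. ennreal ((cmod (f z))\<^sup>2) \<partial>\<mu>k (k + N)) \<le> (\<Sum>k. ennreal (E * C) * ?J k)"
      by (intro suminf_le) auto
    also have "\<dots> \<le> ennreal (E * C) * bergman_normsq \<rho> f"
      unfolding ennreal_suminf_cmult by (intro mult_left_mono sum_bergman_shells_le f) auto
    finally show "sq_integral f \<mu> \<le>
       (\<integral>\<^sup>+z. ennreal ((cmod (f z))\<^sup>2) * indicator (ball 0 (r N)) z \<partial>\<mu>) + ennreal (E * C) * bergman_normsq \<rho> f"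
      using nn_integral_shells[OF square_measurable[OF f], of N] by (meson add_left_mono order_trans)
  qed
qed

lemma bergman_inner_ball:
  "\<exists>C>0. \<forall>f. holomorphic_ball f \<longrightarrow>
     (\<integral>\<^sup>+z. ennreal ((cmod (f z))\<^sup>2) * indicator (ball 0 (r N)) z \<partial>\<mu>) \<le> ennreal C * bergman_normsq \<rho> f"
proof -
  obtain C where C: "C > 0" "\<And>f z. holomorphic_ball f \<Longrightarrow> norm z \<le> r N \<Longrightarrow>
    ennreal ((cmod (f (z :: complex ^ 'n)))\<^sup>2) \<le> ennreal C * bergman_normsq \<rho> f"
    using bergman_pointwise[OF weight_point_mem(2)[of N]] by blast
  let ?m = "measure \<mu> (space \<mu>)"
  show ?thesis
  proof (intro exI[of _ "C * (?m + 1)"] conjI allI impI)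
    show "C * (?m + 1) > 0" using C by (simp add: add_nonneg_pos)
    fix f :: "complex ^ 'n \<Rightarrow> complex" assume f: "holomorphic_ball f"
    have "(\<integral>\<^sup>+z. ennreal ((cmod (f z))\<^sup>2) * indicator (ball 0 (r N)) z \<partial>\<mu>) \<le> (\<integral>\<^sup>+z. ennreal C * bergman_normsq \<rho> f \<partial>\<mu>)"
      by (intro nn_integral_mono) (use C(2)[OF f] in \<open>auto simp: indicator_def\<close>)
    also have "\<dots> = ennreal C * bergman_normsq \<rho> f * ennreal ?m" by (simp add: \<mu>.emeasure_eq_measure)
    also have "\<dots> \<le> ennreal C * bergman_normsq \<rho> f * ennreal (?m + 1)" by (intro mult_left_mono ennreal_leI) auto
    also have "\<dots> = ennreal (C * (?m + 1)) * bergman_normsq \<rho> f" using C by (simp add: ennreal_mult mult_ac)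
    finally show "(\<integral>\<^sup>+z. ennreal ((cmod (f z))\<^sup>2) * indicator (ball 0 (r N)) z \<partial>\<mu>) \<le> ennreal (C * (?m + 1)) * bergman_normsq \<rho> f" .
  qed
qed

lemma carleson_if_hardy_carleson:
  assumes C: "C > 0" and H: "\<And>k. k \<ge> N \<Longrightarrow> hardy_const k \<le> ennreal (C * (1 / 2) ^ k)"
  shows "carleson_measure (bergman_space \<rho>) (bergman_normsq \<rho>) \<mu>"
proof -
  obtain E where E: "E > 0" "\<And>f. holomorphic_ball f \<Longrightarrow>
     sq_integral f \<mu> \<le>
       (\<integral>\<^sup>+z. ennreal ((cmod (f z))\<^sup>2) * indicator (ball 0 (r N)) z \<partial>\<mu>) + ennreal (E * C) * bergman_normsq \<rho> f"
    using bergman_embedding_le C H by blast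
  obtain C2 where C2: "C2 > 0" "\<And>f. holomorphic_ball f \<Longrightarrow>
     (\<integral>\<^sup>+z. ennreal ((cmod (f z))\<^sup>2) * indicator (ball 0 (r N)) z \<partial>\<mu>) \<le> ennreal C2 * bergman_normsq \<rho> f"
    using bergman_inner_ball by blast
  show ?thesis
    unfolding carleson_measure_def
  proof (intro exI[of _ "C2 + E * C"] conjI ballI)
    show "C2 + E * C > 0" using C C2 E by (simp add: add_pos_pos)
    fix f :: "complex ^ 'n \<Rightarrow> complex" assume "f \<in> bergman_space \<rho>"
    then have f: "holomorphic_ball f" by (simp add: bergman_space_def)
    have "sq_integral f \<mu> \<le> ennreal C2 * bergman_normsq \<rho> f + ennreal (E * C) * bergman_normsq \<rho> f"
      using E(2)[OF f] C2(2)[OF f] by (meson add_right_mono order_trans)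
    also have "\<dots> = ennreal (C2 + E * C) * bergman_normsq \<rho> f"
      using C C2 E by (simp add: distrib_right)
    finally show "sq_integral f \<mu> \<le> ennreal (C2 + E * C) * bergman_normsq \<rho> f" .
  qed
qed

text \<open>Beyond a large \<open>N\<close> the shell constants are small and the Bergman norms
  bounded; inside the ball of radius \<open>r N\<close>, uniform convergence and finiteness of
  \<open>\<mu>\<close> suffice.\<close>

lemma vanishing_if_limit:
  assumes lim: "(\<lambda>k. 2 ^ k * hardy_const k) \<longlonglongrightarrow> 0"
  shows "vanishing_carleson_measure (bergman_space \<rho>) (bergman_normsq \<rho>) \<mu>"
proof -
  have ev: "\<exists>N. \<forall>k\<ge>N. hardy_const k \<le> ennreal (e * (1 / 2) ^ k)" if e: "e > 0" for e :: real
  proof -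
    have "\<forall>\<^sub>F k in sequentially. 2 ^ k * hardy_const k < ennreal e"
      using order_tendstoD(2)[OF lim, of "ennreal e"] e by simp
    then obtain N where N: "\<And>k. k \<ge> N \<Longrightarrow> 2 ^ k * hardy_const k < ennreal e"
      by (auto simp: eventually_sequentially)
    have "hardy_const k \<le> ennreal (e * (1 / 2) ^ k)" if "k \<ge> N" for k
    proof -
      have "ennreal ((1 / 2) ^ k) * (2 ^ k * hardy_const k) \<le> ennreal ((1 / 2) ^ k) * ennreal e"
        using N[OF that] by (intro mult_left_mono) auto
      also have "\<dots> = ennreal (e * (1 / 2) ^ k)" using e by (simp add: ennreal_mult mult.commute)
      finally have le: "ennreal ((1 / 2) ^ k) * 2 ^ k * hardy_const k \<le> ennreal (e * (1 / 2) ^ k)"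
        by (simp only: mult.assoc)
      have "ennreal ((1 / 2) ^ k) * 2 ^ k = 1"
      proof -
        have "(2 :: ennreal) ^ k = ennreal (2 ^ k)" by (simp add: ennreal_power[symmetric])
        then have "ennreal ((1 / 2) ^ k) * 2 ^ k = ennreal ((1 / 2) ^ k * 2 ^ k)" by (simp add: ennreal_mult)
        then show ?thesis by (simp add: power_mult_distrib[symmetric])
      qed
      with le show ?thesis by simp
    qed
    then show ?thesis by blast
  qed
  obtain E where E: "E > 0" "\<And>C N f. C > 0 \<Longrightarrow>
     (\<forall>k\<ge>N. hardy_const k \<le> ennreal (C * (1 / 2) ^ k)) \<Longrightarrow>
     holomorphic_ball f \<Longrightarrow>
     sq_integral f \<mu> \<le>
       (\<integral>\<^sup>+z. ennreal ((cmod (f z))\<^sup>2) * indicator (ball 0 (r N)) z \<partial>\<mu>) + ennreal (E * C) * bergman_normsq \<rho> f"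
    using bergman_embedding_le by blast
  show ?thesis
    unfolding vanishing_carleson_measure_def
  proof (intro conjI allI impI)
    obtain N where "\<forall>k\<ge>N. hardy_const k \<le> ennreal (1 * (1 / 2) ^ k)" using ev[of 1] by auto
    then show "carleson_measure (bergman_space \<rho>) (bergman_normsq \<rho>) \<mu>"
      by (intro carleson_if_hardy_carleson[of 1 N]) auto
    fix f :: "nat \<Rightarrow> complex ^ 'n \<Rightarrow> complex"
    assume "(\<forall>j. f j \<in> bergman_space \<rho>) \<and> (\<exists>M::real. \<forall>j. bergman_normsq \<rho> (f j) \<le> ennreal M) \<and>
      (\<forall>K. compact K \<and> K \<subseteq> ball 0 1 \<longrightarrow> uniform_limit K f (\<lambda>_. 0) sequentially)"
    then obtain M :: real where fX: "\<And>j. f j \<in> bergman_space \<rho>" and M: "\<And>j. bergman_normsq \<rho> (f j) \<le> ennreal M"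
      and unif: "\<And>K. compact K \<Longrightarrow> K \<subseteq> ball 0 1 \<Longrightarrow> uniform_limit K f (\<lambda>_. 0) sequentially" by blast
    have hol: "holomorphic_ball (f j)" for j using fX by (simp add: bergman_space_def)
    show "(\<lambda>j. \<integral>\<^sup>+z. ennreal ((cmod (f j z))\<^sup>2) \<partial>\<mu>) \<longlonglongrightarrow> 0"
    proof (rule order_tendstoI)
      fix a :: ennreal assume "0 < a"
      then obtain b where b: "0 < b" "b < a" using dense by blast
      then obtain d where d: "b = ennreal d" "d > 0" by (cases b) (auto simp: less_top)
      \<comment> \<open>The bound \<open>M\<close> may be 0 or negative, and the next step divides
        by it.\<close>
      define M' where "M' = max M 0 + 1"
      have M': "M' > 0" "\<And>j. bergman_normsq \<rho> (f j) \<le> ennreal M'"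
        using order_trans[OF M ennreal_leI[of M "max M 0 + 1"]] by (simp_all add: M'_def add_nonneg_pos)
      \<comment> \<open>With this \<open>e\<close> the outer shells contribute at most d/2.\<close>
      define e where "e = d / (2 * E * M')"
      have e: "e > 0" using d E M' by (simp add: e_def)
      obtain N where N: "\<forall>k\<ge>N. hardy_const k \<le> ennreal (e * (1 / 2) ^ k)" using ev[OF e] by blast
      let ?m = "measure \<mu> (space \<mu>)"
      \<comment> \<open>The target for |f_j|^2 on the inner ball, so that its integral is at most
        d/2; the added 1 covers the case of zero measure.\<close>
      define t where "t = d / (2 * (?m + 1))"
      have t: "t > 0" "t * ?m \<le> d / 2"
      proof -
        have "?m + 1 > 0" by (simp add: add_nonneg_pos)
        then show "t > 0" using d by (simp add: t_def)
        have "t * ?m \<le> t * (?m + 1)" using \<open>t > 0\<close> by simp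
        also have "\<dots> = d / 2" using \<open>?m + 1 > 0\<close> by (simp add: t_def field_simps)
        finally show "t * ?m \<le> d / 2" .
      qed
      have "uniform_limit (cball 0 (r N)) f (\<lambda>_. 0) sequentially"
        using weight_point_mem(2)[of N] by (intro unif) auto
      then have "\<forall>\<^sub>F j in sequentially. \<forall>z\<in>cball 0 (r N). dist (f j z) 0 < sqrt t"
        using t unfolding uniform_limit_iff by simp
      then show "\<forall>\<^sub>F j in sequentially. sq_integral (f j) \<mu> < a"
      proof eventually_elim
        case (elim j)
        have sq: "(cmod (f j z))\<^sup>2 \<le> t" if "norm z < r N" for z
        proof -
          have "cmod (f j z) \<le> sqrt t" using elim that by (force simp: less_imp_le)
          then have "(cmod (f j z))\<^sup>2 \<le> (sqrt t)\<^sup>2" by (intro power_mono) auto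
          then show ?thesis using t by simp
        qed
        have "(\<integral>\<^sup>+z. ennreal ((cmod (f j z))\<^sup>2) * indicator (ball 0 (r N)) z \<partial>\<mu>) \<le> (\<integral>\<^sup>+z. ennreal t \<partial>\<mu>)"
          by (intro nn_integral_mono) (use sq in \<open>auto simp: indicator_def intro: ennreal_leI\<close>)
        also have "\<dots> = ennreal (t * ?m)" using t by (simp add: \<mu>.emeasure_eq_measure ennreal_mult)
        also have "\<dots> \<le> ennreal (d / 2)" using t by (intro ennreal_leI) auto
        finally have 1: "(\<integral>\<^sup>+z. ennreal ((cmod (f j z))\<^sup>2) * indicator (ball 0 (r N)) z \<partial>\<mu>) \<le> ennreal (d / 2)" .
        have "ennreal (E * e) * bergman_normsq \<rho> (f j) \<le> ennreal (E * e) * ennreal M'" by (intro mult_left_mono M') auto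
        also have "\<dots> = ennreal (E * e * M')" by (rule ennreal_mult[symmetric]) (use E e M' in auto)
        also have "E * e * M' = d / 2" using E M' by (simp add: e_def)
        finally have 2: "ennreal (E * e) * bergman_normsq \<rho> (f j) \<le> ennreal (d / 2)" .
        have "sq_integral (f j) \<mu> \<le> ennreal (d / 2) + ennreal (d / 2)"
          using E(2)[OF e N hol[of j]] add_mono[OF 1 2] by (rule order_trans)
        also have "\<dots> = ennreal d" using d by (simp add: ennreal_plus[symmetric] del: ennreal_plus)
        finally show ?case using b d by simp
      qed
    qed simp
  qed
qed

section \<open>From the Bergman embedding to Hardy bounds by monomial multiplication\<close>

lemma word_monomial_le_1: "norm z \<le> 1 \<Longrightarrow> cmod (word_monomial I (z :: complex ^ 'n)) \<le> 1"
proof (induction I)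
  case (Cons i I)
  then have "cmod (z $ i) \<le> 1" using Finite_Cartesian_Product.norm_nth_le[of z i] by simp
  then show ?case using Cons by (simp add: word_monomial_def norm_mult mult_le_one)
qed (simp add: word_monomial_def)

lemma bergman_space_word_monomial_mult:
  assumes f: "f \<in> hardy_space"
  shows "(\<lambda>z. word_monomial I z * f (z :: complex ^ 'n)) \<in> bergman_space \<rho>"
proof -
  have hol: "holomorphic_ball f" and fin: "hardy_normsq f < \<infinity>" using f by (auto simp: hardy_space_def)
  have "bergman_normsq \<rho> (word_mult I f) \<le> (\<integral>\<^sup>+z. ennreal (norm z ^ (2 * 0) * ((cmod (f z))\<^sup>2 * \<rho> (norm z))) \<partial>ball_measure)"
    unfolding bergman_normsq_def
  proof (rule nn_integral_mono)
    fix z :: "complex ^ 'n" assume "z \<in> space ball_measure"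
    then have z: "norm z < 1" by (simp add: ball_measure_def space_restrict_space)
    have "(cmod (word_monomial I z))\<^sup>2 \<le> 1" using word_monomial_le_1[of z I] z by (simp add: power_le_one)
    then have "(cmod (word_monomial I z))\<^sup>2 * ((cmod (f z))\<^sup>2 * \<rho> (norm z)) \<le> 1 * ((cmod (f z))\<^sup>2 * \<rho> (norm z))"
      using z rho_pos[of "norm z"] by (intro mult_right_mono) auto
    then show "ennreal ((cmod (word_monomial I z * f z))\<^sup>2 * \<rho> (norm z)) \<le> ennreal (norm z ^ (2 * 0) * ((cmod (f z))\<^sup>2 * \<rho> (norm z)))"
      by (intro ennreal_leI) (simp add: norm_mult power_mult_distrib mult.assoc)
  qed
  also have "\<dots> \<le> hardy_normsq f * ennreal (2 * real CARD('n)) * (\<integral>\<^sup>+x. ennreal (x ^ (2 * 0) * \<rho> x) * indicator {0..<1} x \<partial>lborel)"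
    by (rule weighted_le_hardy[OF hol])
  also have "\<dots> < \<infinity>" using fin nn_integral_rho[of "{0..<1}"] by (simp add: ennreal_mult_less_top)
  finally show ?thesis
    by (auto simp: bergman_space_def intro!: holomorphic_ball_mult holomorphic_ball_word_monomial hol)
qed

text \<open>On the shell |z|^(2m), the sum of the squared monomials, is bounded below, so
  \<open>f\<close> is controlled by its products with them. Their Bergman norms add up to a weighted
  integral of |f|^2, at most a multiple of 2^-k times the Hardy norm. The hypothesis concerns a
  single \<open>f\<close> and words of one length, so that a failed conclusion produces one bad
  word.\<close>

lemma hardy_shell_bound:
  "\<exists>A>0. \<forall>k\<ge>1. \<forall>f\<in>hardy_space. \<forall>e>0.
     (\<forall>I. length I = vorder k \<longrightarrow> sq_integral (word_mult I f) \<mu> \<le>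
        ennreal e * bergman_normsq \<rho> (word_mult I f)) \<longrightarrow>
     sq_integral f (\<mu>k k) \<le> ennreal (e * A * (1 / 2) ^ k) * hardy_normsq f"
proof -
  obtain C where C: "C > 0" "\<And>k. (\<integral>\<^sup>+x. ennreal (x ^ (2 * vorder k) * \<rho> x) * indicator {0..<1} x \<partial>lborel) \<le> ennreal (C * (1 / 2) ^ k)"
    using nn_integral_power_rho_le by blast
  define c where "c = exp (- 4 / r 1)"
  have c: "c > 0" by (simp add: c_def)
  define A where "A = 2 * real CARD('n) * C / c"
  show ?thesis
  proof (intro exI[of _ A] conjI allI impI ballI)
    show "A > 0" using C c n by (simp add: A_def)
    fix k f and e :: real assume k: "k \<ge> 1" and f: "f \<in> hardy_space" and e: "e > 0"
      and H: "\<forall>I. length I = vorder k \<longrightarrow> sq_integral (word_mult I f) \<mu> \<le>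
        ennreal e * bergman_normsq \<rho> (word_mult I f)"
    have hol: "holomorphic_ball f" using f by (simp add: hardy_space_def)
    let ?m = "vorder k"
    have holw: "holomorphic_ball (word_mult I f)" for I
      by (intro holomorphic_ball_mult holomorphic_ball_word_monomial hol)
    \<comment> \<open>Used twice: with v = 1 for integrals over \<open>\<mu>\<close>, with v =
      \<open>\<rho> (norm z)\<close> for the Bergman norm.\<close>
    have split: "ennreal (norm z ^ (2 * ?m) * ((cmod (f z))\<^sup>2 * v)) = (\<Sum>I\<in>words ?m. ennreal ((cmod (word_monomial I z * f z))\<^sup>2 * v))"
      if "v \<ge> 0" for z v
      using that by (subst sum_ennreal) (auto simp: sum_word_monomial[symmetric] sum_distrib_right norm_mult power_mult_distrib mult.assoc)
    have "ennreal c * sq_integral f (\<mu>k k) = (\<integral>\<^sup>+z. ennreal c * (ennreal ((cmod (f z))\<^sup>2) * indicator (shell \<rho> k) z) \<partial>\<mu>)"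
      unfolding nn_integral_\<mu>k[OF square_measurable[OF hol]]
      by (intro nn_integral_cmult[symmetric] borel_measurable_times_ennreal square_measurable[OF hol] borel_measurable_indicator shell_sets)
    also have "\<dots> \<le> (\<integral>\<^sup>+z. (\<Sum>I\<in>words ?m. ennreal ((cmod (word_monomial I z * f z))\<^sup>2)) \<partial>\<mu>)"
    proof (rule nn_integral_mono)
      fix z
      show "ennreal c * (ennreal ((cmod (f z))\<^sup>2) * indicator (shell \<rho> k) z) \<le> (\<Sum>I\<in>words ?m. ennreal ((cmod (word_monomial I z * f z))\<^sup>2))"
      proof (cases "z \<in> shell \<rho> k")
        case True
        then have "r k \<le> norm z" by (simp add: shell_def)
        then have "c \<le> norm z ^ (2 * ?m)"
          using weight_point_power_ge[OF k] power_mono[of "r k" "norm z" "2 * ?m"] weight_point_mem(1)[of k] by (simp add: c_def)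
        then have "ennreal (c * (cmod (f z))\<^sup>2) \<le> ennreal (norm z ^ (2 * ?m) * ((cmod (f z))\<^sup>2 * 1))"
          by (intro ennreal_leI) (simp add: mult_right_mono)
        then show ?thesis using True c split[of 1 z] by (simp add: ennreal_mult)
      qed simp
    qed
    also have "\<dots> = (\<Sum>I\<in>words ?m. \<integral>\<^sup>+z. ennreal ((cmod (word_monomial I z * f z))\<^sup>2) \<partial>\<mu>)"
      by (rule nn_integral_sum) (rule square_measurable[OF holw])
    also have "\<dots> \<le> (\<Sum>I\<in>words ?m. ennreal e * bergman_normsq \<rho> (word_mult I f))"
      by (rule sum_mono) (use H in auto)
    also have "\<dots> = ennreal e * (\<Sum>I\<in>words ?m. bergman_normsq \<rho> (word_mult I f))"
      by (simp add: sum_distrib_left)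
    also have "(\<Sum>I\<in>words ?m. bergman_normsq \<rho> (word_mult I f)) =
        (\<integral>\<^sup>+z. (\<Sum>I\<in>words ?m. ennreal ((cmod (word_monomial I z * f z))\<^sup>2 * \<rho> (norm z))) \<partial>ball_measure)"
      unfolding bergman_normsq_def
    proof (rule nn_integral_sum[symmetric])
      fix I
      have "sets (ball_measure :: (complex ^ 'n) measure) = sets (restrict_space borel (ball 0 1))"
        unfolding ball_measure_def by (intro sets_restrict_space_cong) simp
      from ball_restrict_measurable[OF this weighted_borel[OF holw, of 0 I]]
      show "(\<lambda>z. ennreal ((cmod (word_monomial I z * f z))\<^sup>2 * \<rho> (norm z))) \<in> borel_measurable ball_measure" by simp
    qed
    also have "\<dots> = (\<integral>\<^sup>+z. ennreal (norm z ^ (2 * ?m) * ((cmod (f z))\<^sup>2 * \<rho> (norm z))) \<partial>ball_measure)"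
    proof (rule nn_integral_cong)
      fix z :: "complex ^ 'n" assume "z \<in> space ball_measure"
      then have "norm z < 1" by (simp add: ball_measure_def space_restrict_space)
      then have "\<rho> (norm z) \<ge> 0" using rho_pos[of "norm z"] by simp
      from split[OF this] show "(\<Sum>I\<in>words ?m. ennreal ((cmod (word_monomial I z * f z))\<^sup>2 * \<rho> (norm z))) = ennreal (norm z ^ (2 * ?m) * ((cmod (f z))\<^sup>2 * \<rho> (norm z)))"
        by simp
    qed
    also have "ennreal e * \<dots> \<le> ennreal e * (hardy_normsq f * ennreal (2 * real CARD('n)) * ennreal (C * (1 / 2) ^ k))"
      by (intro mult_left_mono order_trans[OF weighted_le_hardy[OF hol]] C(2)) auto
    also have "\<dots> = ennreal c * (ennreal (e * A * (1 / 2) ^ k) * hardy_normsq f)"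
    proof -
      have "ennreal e * ennreal (2 * real CARD('n)) * ennreal (C * (1 / 2) ^ k) = ennreal c * ennreal (e * A * (1 / 2) ^ k)"
        using e C c by (simp add: ennreal_mult[symmetric] A_def)
      then have "ennreal e * ennreal (2 * real CARD('n)) * ennreal (C * (1 / 2) ^ k) * hardy_normsq f =
          ennreal c * ennreal (e * A * (1 / 2) ^ k) * hardy_normsq f" by simp
      moreover have "x * (h * y * w) = x * y * w * h" "x * y * h = x * (y * h)" for x y w h :: ennreal
        by (simp_all only: mult_ac)
      ultimately show ?thesis by metis
    qed
    finally show "sq_integral f (\<mu>k k) \<le> ennreal (e * A * (1 / 2) ^ k) * hardy_normsq f"
      by (subst (asm) ennreal_mult_le_mult_iff) (use c in auto)
  qed
qed

lemma hardy_carleson_if_carleson: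
  assumes "carleson_measure (bergman_space \<rho>) (bergman_normsq \<rho>) \<mu>"
  shows "\<exists>C>0. \<forall>k. \<forall>f\<in>hardy_space. sq_integral f (\<mu>k k) \<le> ennreal (C * (1 / 2) ^ k) * hardy_normsq f"
proof -
  obtain C where C: "C > 0" "\<And>f. f \<in> bergman_space \<rho> \<Longrightarrow> sq_integral f \<mu> \<le> ennreal C * bergman_normsq \<rho> f"
    using assms unfolding carleson_measure_def by blast
  obtain A where A: "A > 0" "\<And>k f e. k \<ge> 1 \<Longrightarrow> f \<in> hardy_space \<Longrightarrow> e > 0 \<Longrightarrow>
     (\<And>I. length I = vorder k \<Longrightarrow> sq_integral (word_mult I f) \<mu> \<le>
        ennreal e * bergman_normsq \<rho> (word_mult I f)) \<Longrightarrow>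
     sq_integral f (\<mu>k k) \<le> ennreal (e * A * (1 / 2) ^ k) * hardy_normsq f"
    using hardy_shell_bound by blast
  obtain C0 where C0: "C0 > 0" "\<And>f. f \<in> hardy_space \<Longrightarrow> sq_integral f (\<mu>k 0) \<le> ennreal C0 * hardy_normsq f"
    using ball_finite_measure.hardy_carleson_compact_support[OF ball_finite_measure_\<mu>k AE_\<mu>k_norm_le weight_point_mem(2), of 0] by blast
  show ?thesis
  proof (intro exI[of _ "C * A + C0"] conjI allI ballI)
    show "C * A + C0 > 0" using A C C0 by (simp add: add_pos_pos)
    fix k and f :: "complex ^ 'n \<Rightarrow> complex" assume f: "f \<in> hardy_space"
    show "sq_integral f (\<mu>k k) \<le> ennreal ((C * A + C0) * (1 / 2) ^ k) * hardy_normsq f"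
    proof (cases "k = 0")
      case True
      have "ennreal C0 * hardy_normsq f \<le> ennreal (C * A + C0) * hardy_normsq f"
        using A C by (intro mult_right_mono ennreal_leI) auto
      from order_trans[OF C0(2)[OF f] this] show ?thesis using True by simp
    next
      case False
      have "sq_integral f (\<mu>k k) \<le> ennreal (C * A * (1 / 2) ^ k) * hardy_normsq f"
        by (rule A(2)) (use False f C bergman_space_word_monomial_mult[OF f] in auto)
      also have "\<dots> \<le> ennreal ((C * A + C0) * (1 / 2) ^ k) * hardy_normsq f"
        using A C C0 by (intro mult_right_mono ennreal_leI) auto
      finally show ?thesis .
    qed
  qed
qed

text \<open>If the limit fails, infinitely many shells have a Hardy function violating the small
  bound, and hence a bad monomial multiple of it. Normalized in the Bergman space, these multiples
  vanish to growing order, so they tend to 0 locally uniformly while their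
  \<open>\<mu>\<close>-norms stay at least \<open>e\<close>.\<close>

lemma limit_if_vanishing:
  assumes van: "vanishing_carleson_measure (bergman_space \<rho>) (bergman_normsq \<rho>) \<mu>"
  shows "(\<lambda>k. 2 ^ k * hardy_const k) \<longlonglongrightarrow> 0"
proof (rule ccontr)
  assume not: "\<not> (\<lambda>k. 2 ^ k * hardy_const k) \<longlonglongrightarrow> 0"
  obtain a :: ennreal where a: "0 < a" "\<not> (\<forall>\<^sub>F k in sequentially. 2 ^ k * hardy_const k < a)"
    using not order_tendstoI[of 0 "\<lambda>k. 2 ^ k * hardy_const k"] by auto
  obtain b where b: "0 < b" "b < a" using dense[OF a(1)] by blast
  then obtain d where d: "b = ennreal d" "d > 0" by (cases b) (auto simp: less_top)
  obtain A where A: "A > 0" "\<And>k f e. k \<ge> 1 \<Longrightarrow> f \<in> hardy_space \<Longrightarrow> e > 0 \<Longrightarrow>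
     (\<And>I. length I = vorder k \<Longrightarrow> sq_integral (word_mult I f) \<mu> \<le>
        ennreal e * bergman_normsq \<rho> (word_mult I f)) \<Longrightarrow>
     sq_integral f (\<mu>k k) \<le> ennreal (e * A * (1 / 2) ^ k) * hardy_normsq f"
    using hardy_shell_bound by blast
  \<comment> \<open>Chosen so that e A = d: a failure of the Hardy bound with \<open>d\<close> is a
    failure of the hypothesis of \<open>hardy_shell_bound\<close> with \<open>e\<close>.\<close>
  define e where "e = d / A"
  have e: "e > 0" using A d by (simp add: e_def)
  define P where "P = (\<lambda>N I f. N \<le> length I \<and> holomorphic_ball f \<and> (word_mult I f) \<in> bergman_space \<rho> \<and>
      bergman_normsq \<rho> (word_mult I f) \<le> 1 \<and>
      ennreal e \<le> (\<integral>\<^sup>+z. ennreal ((cmod (word_monomial I z * f (z :: complex ^ 'n)))\<^sup>2) \<partial>\<mu>))"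
  have "\<exists>I f. P N I f" for N
  proof -
    \<comment> \<open>From \<open>k0\<close> on, \<open>vorder k\<close> exceeds \<open>N\<close>,
      since it is at least \<open>ratio ^ k\<close>.\<close>
    obtain k0 where k0: "real N < ratio ^ k0" using real_arch_pow[OF ratio_gt_1] by blast
    have "\<exists>k\<ge>max k0 1. \<not> 2 ^ k * hardy_const k < a"
      using a(2) unfolding eventually_sequentially by blast
    then obtain k where k: "k \<ge> max k0 1" "a \<le> 2 ^ k * hardy_const k"
      unfolding not_less by blast
    have "ratio ^ k0 \<le> ratio ^ k" using k ratio_gt_1 by (intro power_increasing) auto
    then have Nk: "N \<le> vorder k" using k0 vorder_bounds(3)[of k] by linarith
    have "\<not> hardy_const k \<le> ennreal (d * (1 / 2) ^ k)"
    proof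
      assume "hardy_const k \<le> ennreal (d * (1 / 2) ^ k)"
      then have "2 ^ k * hardy_const k \<le> 2 ^ k * ennreal (d * (1 / 2) ^ k)"
        by (rule mult_left_mono) simp
      also have "\<dots> = ennreal d"
      proof -
        have "(2 :: ennreal) ^ k = ennreal (2 ^ k)" by (simp add: ennreal_power[symmetric])
        then have "2 ^ k * ennreal (d * (1 / 2) ^ k) = ennreal (2 ^ k * (d * (1 / 2) ^ k))" using d by (simp add: ennreal_mult)
        also have "2 ^ k * (d * (1 / 2) ^ k) = d" by (simp add: power_divide)
        finally show ?thesis .
      qed
      finally show False using k(2) b d by simp
    qed
    then obtain f where f: "f \<in> hardy_space" "\<not> sq_integral f (\<mu>k k) \<le> ennreal (d * (1 / 2) ^ k) * hardy_normsq f"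
      using carleson_constant_le by blast
    have "e * A = d" using A by (simp add: e_def)
    then obtain I where I: "length I = vorder k" "\<not> sq_integral (word_mult I f) \<mu> \<le>
        ennreal e * bergman_normsq \<rho> (word_mult I f)"
      using A(2)[of k f e] k(1) f e by auto
    define g where "g = (word_mult I f)"
    have hol: "holomorphic_ball f" using f by (simp add: hardy_space_def)
    have gX: "g \<in> bergman_space \<rho>" unfolding g_def by (rule bergman_space_word_monomial_mult[OF f(1)])
    then have g: "holomorphic_ball g" "bergman_normsq \<rho> g < \<infinity>" by (auto simp: bergman_space_def)
    define B where "B = enn2real (bergman_normsq \<rho> g)"
    have Bn: "bergman_normsq \<rho> g = ennreal B" using g by (simp add: B_def less_top)
    \<comment> \<open>A zero Bergman norm would force \<open>g\<close> to vanish on the ball, and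
      then the violated inequality would hold.\<close>
    have "B \<noteq> 0"
    proof
      assume "B = 0"
      then have "g z = 0" if "norm z < 1" for z
        using bergman_pointwise[OF that] g(1) Bn by fastforce
      then have "sq_integral g \<mu> = (\<integral>\<^sup>+z. 0 \<partial>\<mu>)"
        by (intro nn_integral_cong) (simp add: \<mu>.space_\<nu>)
      then show False using I(2) by (simp add: g_def)
    qed
    then have B: "B > 0" using enn2real_nonneg[of "bergman_normsq \<rho> g"] by (simp add: B_def less_le)
    \<comment> \<open>The factor \<open>f\<close> is rescaled, not the product, so that the monomial
      stays explicit for the Schwarz estimate.\<close>
    define f' where "f' = (\<lambda>z. of_real (1 / sqrt B) * f z)"
    have hol': "holomorphic_ball f'" unfolding f'_def by (intro holomorphic_ball_mult holomorphic_ball_const hol)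
    have sc: "(cmod (word_monomial I z * f' z))\<^sup>2 = (1 / B) * (cmod (g z))\<^sup>2" for z
      using B by (simp add: f'_def g_def norm_mult power_mult_distrib norm_divide power_divide)
    have n': "bergman_normsq \<rho> (word_mult I f') = 1"
    proof -
      have "bergman_normsq \<rho> (word_mult I f') = (\<integral>\<^sup>+z. ennreal (1 / B) * ennreal ((cmod (g z))\<^sup>2 * \<rho> (norm z)) \<partial>ball_measure)"
        unfolding bergman_normsq_def sc
      proof (rule nn_integral_cong)
        fix z :: "complex ^ 'n" assume "z \<in> space ball_measure"
        show "ennreal (1 / B * (cmod (g z))\<^sup>2 * \<rho> (norm z)) = ennreal (1 / B) * ennreal ((cmod (g z))\<^sup>2 * \<rho> (norm z))"
          using B by (simp only: mult.assoc) (rule ennreal_mult', simp)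
      qed
      also have "\<dots> = ennreal (1 / B) * bergman_normsq \<rho> g"
        unfolding bergman_normsq_def
      proof (rule nn_integral_cmult)
        have "sets (ball_measure :: (complex ^ 'n) measure) = sets (restrict_space borel (ball 0 1))"
          unfolding ball_measure_def by (intro sets_restrict_space_cong) simp
        from ball_restrict_measurable[OF this weighted_borel[OF g(1), of 0]]
        show "(\<lambda>z. ennreal ((cmod (g z))\<^sup>2 * \<rho> (norm z))) \<in> borel_measurable ball_measure" by simp
      qed
      also have "\<dots> = 1" unfolding Bn using B by (simp add: ennreal_mult[symmetric])
      finally show ?thesis .
    qed
    have "sq_integral (word_mult I f') \<mu> = (\<integral>\<^sup>+z. ennreal (1 / B) * ennreal ((cmod (g z))\<^sup>2) \<partial>\<mu>)"
      unfolding sc using B by (intro nn_integral_cong ennreal_mult) auto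
    also have "\<dots> = ennreal (1 / B) * sq_integral g \<mu>"
      by (rule nn_integral_cmult) (rule square_measurable[OF g(1)])
    also have "\<dots> \<ge> ennreal (1 / B) * (ennreal e * ennreal B)"
      using I(2) Bn by (intro mult_left_mono) (simp_all add: g_def)
    finally have "ennreal e \<le> sq_integral (word_mult I f') \<mu>"
      using B e by (simp add: ennreal_mult[symmetric])
    moreover have "(word_mult I f') \<in> bergman_space \<rho>"
      using n' by (auto simp: bergman_space_def intro!: holomorphic_ball_mult holomorphic_ball_word_monomial hol')
    ultimately show ?thesis unfolding P_def using hol' n' Nk I(1) by (intro exI[of _ I] exI[of _ f']) auto
  qed
  then obtain I f where "\<And>N. P N (I N) (f N)" by metis
  then have If: "\<And>N. N \<le> length (I N)" "\<And>N. holomorphic_ball (f N)"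
      "\<And>N. (word_mult (I N) (f N)) \<in> bergman_space \<rho>"
      "\<And>N. bergman_normsq \<rho> (word_mult (I N) (f N)) \<le> 1"
      "\<And>N. ennreal e \<le> (\<integral>\<^sup>+z. ennreal ((cmod (word_monomial (I N) z * f N (z :: complex ^ 'n)))\<^sup>2) \<partial>\<mu>)"
    unfolding P_def by blast+
  define g where "g = (\<lambda>N z. word_monomial (I N) z * f N z)"
  have unif: "uniform_limit K g (\<lambda>_. 0) sequentially" if K: "compact K" "K \<subseteq> ball 0 1" for K
  proof -
    obtain R where R: "R < 1" "0 < R" "\<And>z. z \<in> K \<Longrightarrow> norm z \<le> R"
    proof (cases "K = {}")
      case True
      then show ?thesis using that[of "1/2"] by auto
    next
      case False
      then obtain z0 where z0: "z0 \<in> K" "\<And>z. z \<in> K \<Longrightarrow> norm z \<le> norm z0"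
        using continuous_attains_sup[OF K(1) False continuous_on_norm[OF continuous_on_id]] by auto
      then have "norm z0 < 1" using K by auto
      show ?thesis
      proof (rule that)
        show "(1 + norm z0) / 2 < 1" "0 < (1 + norm z0) / 2"
          using \<open>norm z0 < 1\<close> by (auto simp: add_pos_nonneg)
        show "norm z \<le> (1 + norm z0) / 2" if "z \<in> K" for z
          using z0(2)[OF that] \<open>norm z0 < 1\<close> by simp
      qed
    qed
    \<comment> \<open>An intermediate radius: unit Bergman norms give a common bound on |w| \<le>
      R', and the Schwarz estimate improves it to (R / R')^N on the compact set.\<close>
    define R' where "R' = (1 + R) / 2"
    have R': "0 < R'" "R' < 1" "R \<le> R'" "R < R'" using R by (auto simp: R'_def)
    obtain C where C: "C > 0" "\<And>f z. holomorphic_ball f \<Longrightarrow> norm z \<le> R' \<Longrightarrow>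
      ennreal ((cmod (f (z :: complex ^ 'n)))\<^sup>2) \<le> ennreal C * bergman_normsq \<rho> f"
      using bergman_pointwise[OF R'(2)] by blast
    have bound: "cmod (g N z) \<le> (R / R') ^ N * sqrt C" if z: "z \<in> K" for N z
    proof -
      have "cmod (word_monomial (I N) z * f N z) \<le> (R / R') ^ length (I N) * sqrt C"
      proof (rule schwarz_word_monomial[OF If(2) R'(1-3) R(3)[OF z]])
        fix w :: "complex ^ 'n" assume w: "norm w \<le> R'"
        have "ennreal ((cmod (word_monomial (I N) w * f N w))\<^sup>2) \<le> ennreal C * bergman_normsq \<rho> (word_mult (I N) (f N))"
          by (rule C(2)[OF _ w]) (intro holomorphic_ball_mult holomorphic_ball_word_monomial If)
        also have "\<dots> \<le> ennreal C * 1" by (intro mult_left_mono If) auto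
        finally have "(cmod (word_monomial (I N) w * f N w))\<^sup>2 \<le> C" using C(1) by simp
        then show "cmod (word_monomial (I N) w * f N w) \<le> sqrt C" by (rule real_le_rsqrt)
      qed
      also have "\<dots> \<le> (R / R') ^ N * sqrt C"
        using R R' If(1)[of N] C by (intro mult_right_mono power_decreasing) auto
      finally show ?thesis by (simp add: g_def)
    qed
    have lim: "(\<lambda>N. (R / R') ^ N * sqrt C) \<longlonglongrightarrow> 0"
      using R R' by (intro tendsto_mult_left_zero LIMSEQ_power_zero) auto
    show ?thesis
      unfolding uniform_limit_iff
    proof (intro allI impI)
      fix t :: real assume "t > 0"
      from order_tendstoD(2)[OF lim this]
      show "\<forall>\<^sub>F N in sequentially. \<forall>z\<in>K. dist (g N z) 0 < t"
        by eventually_elim (use bound in \<open>auto intro: le_less_trans\<close>)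
    qed
  qed
  have "(\<lambda>N. \<integral>\<^sup>+z. ennreal ((cmod (g N z))\<^sup>2) \<partial>\<mu>) \<longlonglongrightarrow> 0"
  proof -
    have "(\<forall>N. g N \<in> bergman_space \<rho>) \<and> (\<exists>M::real. \<forall>N. bergman_normsq \<rho> (g N) \<le> ennreal M) \<and>
      (\<forall>K. compact K \<and> K \<subseteq> ball 0 1 \<longrightarrow> uniform_limit K g (\<lambda>_. 0) sequentially)"
      using If(3,4) unif by (auto simp: g_def intro!: exI[of _ 1])
    then show ?thesis using van unfolding vanishing_carleson_measure_def by blast
  qed
  then have "\<forall>\<^sub>F N in sequentially. sq_integral (g N) \<mu> < ennreal e"
    by (rule order_tendstoD(2)) (use e in auto)
  then have "\<forall>\<^sub>F N::nat in sequentially. False"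
    by eventually_elim (use If(5) in \<open>auto simp: g_def not_less[symmetric]\<close>)
  then show False by simp
qed

end

theorem theorem2p1:
  fixes \<rho> :: "real \<Rightarrow> real" and \<mu> :: "(complex ^ 'n) measure"
    and \<mu>k :: "nat \<Rightarrow> (complex ^ 'n) measure"
  assumes rho: "weight_class_S CARD('n) \<rho>"
    and mu_finite: "finite_measure \<mu>"
    and mu_borel: "sets \<mu> = sets (restrict_space borel (ball 0 1))"
  defines "\<mu>k \<equiv> \<lambda>k. density \<mu> (indicator (shell \<rho> k))"
  shows "(carleson_measure (bergman_space \<rho>) (bergman_normsq \<rho>) \<mu> \<longleftrightarrow>
            (\<forall>k. carleson_measure hardy_space hardy_normsq (\<mu>k k)) \<and>
            (\<exists>C::real. C > 0 \<and>
               (\<forall>k. carleson_constant hardy_space hardy_normsq (\<mu>k k) \<le> ennreal (C * (1 / 2) ^ k))))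
       \<and> (vanishing_carleson_measure (bergman_space \<rho>) (bergman_normsq \<rho>) \<mu> \<longleftrightarrow>
            (\<lambda>k. 2 ^ k * carleson_constant hardy_space hardy_normsq (\<mu>k k)) \<longlonglongrightarrow> 0)"
proof -
  interpret \<mu>: finite_measure \<mu> by (rule mu_finite)
  interpret class_S_measure \<rho> \<mu>
    by unfold_locales (use rho mu_borel in \<open>auto simp: Suc_leI\<close>)
  show ?thesis
    unfolding \<mu>k_def
  proof (intro conjI iffI)
    assume "carleson_measure (bergman_space \<rho>) (bergman_normsq \<rho>) \<mu>"
    then obtain C where C: "C > 0" "\<And>k f. f \<in> hardy_space \<Longrightarrow> (\<integral>\<^sup>+z. ennreal ((cmod (f z))\<^sup>2) \<partial>density \<mu> (indicator (shell \<rho> k))) \<le> ennreal (C * (1 / 2) ^ k) * hardy_normsq f"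
      using hardy_carleson_if_carleson by blast
    show "\<forall>k. carleson_measure hardy_space hardy_normsq (density \<mu> (indicator (shell \<rho> k)))"
      unfolding carleson_measure_def
    proof (intro allI exI conjI ballI)
      show "0 < C * (1 / 2) ^ k" for k using C by simp
    qed (rule C(2))
    show "\<exists>C::real. C > 0 \<and> (\<forall>k. carleson_constant hardy_space hardy_normsq (density \<mu> (indicator (shell \<rho> k))) \<le> ennreal (C * (1 / 2) ^ k))"
      using C by (intro exI[of _ C] conjI allI carleson_constant_le)
  next
    assume "(\<forall>k. carleson_measure hardy_space hardy_normsq (density \<mu> (indicator (shell \<rho> k)))) \<and>
      (\<exists>C::real. C > 0 \<and> (\<forall>k. carleson_constant hardy_space hardy_normsq (density \<mu> (indicator (shell \<rho> k))) \<le> ennreal (C * (1 / 2) ^ k)))"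
    \<comment> \<open>Starting index 0: the hypothesis covers all shells.\<close>
    then show "carleson_measure (bergman_space \<rho>) (bergman_normsq \<rho>) \<mu>"
      using carleson_if_hardy_carleson[of _ 0] by blast
  qed (rule limit_if_vanishing vanishing_if_limit; assumption)+
qed

end
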